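(* Let $(W,T)$ be a dual Coxeter system with $W$ an affine Coxeter group and let $w\in W$. If $w$ is a parabolic quasi-Coxeter element for $(W,T)$, then the Hurwitz action on $\mathrm{Red}_T(w)$ is transitive.
   Context: A dual Coxeter system of (finite) rank $n$ is a pair $(W,T)$ where $W$ is a group, $T\subseteq W$ generates $W$, and there is $S\subseteq T$ with $|S|=n$ such that $(W,S)$ is a Coxeter system and $T=\{wsw^{-1}\mid w\in W,\ s\in S\}$. A subset $S'\subseteq T$ is called a simple system for $(W,T)$ if $(W,S')$ is a Coxeter system (then automatically $|S'|=n$ and $T$ is its set of reflections). Affine Coxeter groups: let $V$ be a Euclidean vector space with inner product $(-\mid-)$ and $\Phi\subset V$ a crystallographic root system. For $\alpha\in\Phi$ put $\alpha^\vee=2\alpha/(\alpha\mid\alpha)$, and for $k\in\mathbb Z$ let $s_{\alpha,k}:V\to V$, $v\mapsto v-((v\mid\alpha)-k)\alpha^\vee$. The affine Coxeter group (affine Weyl group) of $\Phi$ is $W_{a,\Phi}=\langle s_{\alpha,k}\mid \alpha\in\Phi,k\in\mathbb Z\rangle$; it is a Coxeter group whose set of reflections is $T_a=\{s_{\alpha,k}\mid\alpha\in\Phi,k\in\mathbb Z\}$. The dual Coxeter system $(W,T)$ is affine if it is (isomorphic to) such a pair $(W_{a,\Phi},T_a)$. For $w\in W$, $\ell_T(w)$ is the minimal $m$ such that $w$ is a product of $m$ elements of $T$, and $\mathrm{Red}_T(w)=\{(t_1,\dots,t_m)\in T^m\mid w=t_1\cdots t_m,\ m=\ell_T(w)\}$.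 An element $w\in W$ is a parabolic quasi-Coxeter element for $(W,T)$ if there are a simple system $S=\{s_1,\dots,s_n\}$ for $(W,T)$ and $(t_1,\dots,t_m)\in\mathrm{Red}_T(w)$ with $m\le n$ such that $\langle t_1,\dots,t_m\rangle=\langle s_1,\dots,s_m\rangle$. Hurwitz action: the braid group $\mathcal B_m$ on $m$ strands with standard generators $\sigma_1,\dots,\sigma_{m-1}$ acts on $T^m$ by $\sigma_i\cdot(t_1,\dots,t_m)=(t_1,\dots,t_{i-1},t_it_{i+1}t_i,t_i,t_{i+2},\dots,t_m)$. This preserves $\mathrm{Red}_T(w)$ (where $m=\ell_T(w)$). *)

theory Defs
  imports "HOL-Analysis.Analysis" "HOL-Algebra.Elementary_Groups" "HOL-Algebra.Group_Action"
begin

section \<open>Group presentations\<close>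

text \<open>In a word, \<open>(a, True)\<close> stands for the generator \<open>a\<close> and \<open>(a, False)\<close> for its formal inverse.
  A relation \<open>(u, v)\<close> stands for \<open>u = v\<close>.\<close>

type_synonym 'a gen_word = "('a \<times> bool) list"

abbreviation gen_words :: "'a set \<Rightarrow> 'a gen_word set" where
  "gen_words S \<equiv> lists (S \<times> UNIV)"

inductive_set word_cong :: "'a set \<Rightarrow> ('a gen_word \<times> 'a gen_word) set \<Rightarrow> ('a gen_word \<times> 'a gen_word) set"
  for S :: "'a set" and R :: "('a gen_word \<times> 'a gen_word) set" where
  refl: "u \<in> gen_words S \<Longrightarrow> (u, u) \<in> word_cong S R"
| sym: "(u, v) \<in> word_cong S R \<Longrightarrow> (v, u) \<in> word_cong S R"
| trans: "(u, v) \<in> word_cong S R \<Longrightarrow> (v, w) \<in> word_cong S R \<Longrightarrow> (u, w) \<in> word_cong S R"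
| cancel: "x \<in> gen_words S \<Longrightarrow> y \<in> gen_words S \<Longrightarrow> a \<in> S \<Longrightarrow>
    (x @ [(a, b), (a, \<not> b)] @ y, x @ y) \<in> word_cong S R"
| relation: "x \<in> gen_words S \<Longrightarrow> y \<in> gen_words S \<Longrightarrow> (u, v) \<in> R \<Longrightarrow>
    u \<in> gen_words S \<Longrightarrow> v \<in> gen_words S \<Longrightarrow>
    (x @ u @ y, x @ v @ y) \<in> word_cong S R"

text \<open>The group \<open>\<langle>S | R\<rangle>\<close>.\<close>

definition presented_group ::
  "'a set \<Rightarrow> ('a gen_word \<times> 'a gen_word) set \<Rightarrow> 'a gen_word set monoid" where
  "presented_group S R =
    \<lparr>carrier = gen_words S // word_cong S R,
     mult = (\<lambda>A B. \<Union>u\<in>A. \<Union>v\<in>B. word_cong S R `` {u @ v}),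
     one = word_cong S R `` {[]}\<rparr>"

definition word_eval :: "('g, 'm) monoid_scheme \<Rightarrow> ('a \<Rightarrow> 'g) \<Rightarrow> 'a gen_word \<Rightarrow> 'g" where
  "word_eval G f u =
    foldr (\<lambda>(a, b) x. (if b then f a else inv\<^bsub>G\<^esub> (f a)) \<otimes>\<^bsub>G\<^esub> x) u \<one>\<^bsub>G\<^esub>"

text \<open>The homomorphism from a presented group to \<open>G\<close> given by \<open>f\<close> on the generators. It is only
  meaningful if \<open>f\<close> respects the relations (see \<open>presented_hom_hom\<close> below).\<close>

definition presented_hom ::
  "('g, 'm) monoid_scheme \<Rightarrow> ('a \<Rightarrow> 'g) \<Rightarrow> 'a gen_word set \<Rightarrow> 'g" where
  "presented_hom G f A = the_elem (word_eval G f ` A)"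


section \<open>Coxeter systems and dual Coxeter systems\<close>

text \<open>A Coxeter matrix with the entry \<open>\<infinity>\<close> encoded as \<open>0\<close>; the relation \<open>(s t)\<^sup>0 = 1\<close> is vacuous.\<close>

definition coxeter_matrix :: "'a set \<Rightarrow> ('a \<Rightarrow> 'a \<Rightarrow> nat) \<Rightarrow> bool" where
  "coxeter_matrix S m \<longleftrightarrow>
    (\<forall>s\<in>S. m s s = 1) \<and>
    (\<forall>s\<in>S. \<forall>t\<in>S. m s t = m t s) \<and>
    (\<forall>s\<in>S. \<forall>t\<in>S. s \<noteq> t \<longrightarrow> m s t \<noteq> 1)"

definition coxeter_relations :: "'a set \<Rightarrow> ('a \<Rightarrow> 'a \<Rightarrow> nat) \<Rightarrow> ('a gen_word \<times> 'a gen_word) set" where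
  "coxeter_relations S m =
    {(concat (replicate (m s t) [(s, True), (t, True)]), []) | s t. s \<in> S \<and> t \<in> S}"

definition coxeter_system :: "('g, 'm) monoid_scheme \<Rightarrow> 'g set \<Rightarrow> bool" where
  "coxeter_system W S \<longleftrightarrow>
    group W \<and> S \<subseteq> carrier W \<and>
    (\<exists>m. coxeter_matrix S m \<and>
      (\<exists>h \<in> iso (presented_group S (coxeter_relations S m)) W.
        \<forall>s\<in>S. h (word_cong S (coxeter_relations S m) `` {[(s, True)]}) = s))"

definition conjugates :: "('g, 'm) monoid_scheme \<Rightarrow> 'g set \<Rightarrow> 'g set" where
  "conjugates W S = {w \<otimes>\<^bsub>W\<^esub> s \<otimes>\<^bsub>W\<^esub> inv\<^bsub>W\<^esub> w | w s. w \<in> carrier W \<and> s \<in> S}"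

definition dual_coxeter_system :: "nat \<Rightarrow> ('g, 'm) monoid_scheme \<Rightarrow> 'g set \<Rightarrow> bool" where
  "dual_coxeter_system n W T \<longleftrightarrow>
    group W \<and> T \<subseteq> carrier W \<and> generate W T = carrier W \<and>
    (\<exists>S \<subseteq> T. finite S \<and> card S = n \<and> coxeter_system W S \<and> T = conjugates W S)"

definition simple_system :: "('g, 'm) monoid_scheme \<Rightarrow> 'g set \<Rightarrow> 'g set \<Rightarrow> bool" where
  "simple_system W T S \<longleftrightarrow> S \<subseteq> T \<and> coxeter_system W S"


section \<open>Reflection factorizations\<close>

text \<open>Tuples are represented by lists.\<close>

definition list_prod :: "('g, 'm) monoid_scheme \<Rightarrow> 'g list \<Rightarrow> 'g" where
  "list_prod G ts = foldr (\<otimes>\<^bsub>G\<^esub>) ts \<one>\<^bsub>G\<^esub>"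

definition reflection_length :: "('g, 'm) monoid_scheme \<Rightarrow> 'g set \<Rightarrow> 'g \<Rightarrow> nat" where
  "reflection_length W T w = (LEAST m. \<exists>ts \<in> lists T. length ts = m \<and> list_prod W ts = w)"

definition Red :: "('g, 'm) monoid_scheme \<Rightarrow> 'g set \<Rightarrow> 'g \<Rightarrow> 'g list set" where
  "Red W T w = {ts \<in> lists T. length ts = reflection_length W T w \<and> list_prod W ts = w}"

definition parabolic_quasi_coxeter ::
  "nat \<Rightarrow> ('g, 'm) monoid_scheme \<Rightarrow> 'g set \<Rightarrow> 'g \<Rightarrow> bool" where
  "parabolic_quasi_coxeter n W T w \<longleftrightarrow>
    (\<exists>ss. distinct ss \<and> length ss = n \<and> simple_system W T (set ss) \<and>
      (\<exists>ts \<in> Red W T w. length ts \<le> n \<and>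
        generate W (set ts) = generate W (set (take (length ts) ss))))"


section \<open>The braid group and the Hurwitz action\<close>

definition braid_relations :: "nat \<Rightarrow> (nat gen_word \<times> nat gen_word) set" where
  "braid_relations m =
    {([(i, True), (j, True)], [(j, True), (i, True)]) | i j.
       i \<in> {1..<m} \<and> j \<in> {1..<m} \<and> i + 1 < j} \<union>
    {([(i, True), (i + 1, True), (i, True)], [(i + 1, True), (i, True), (i + 1, True)]) | i.
       i \<in> {1..<m} \<and> i + 1 \<in> {1..<m}}"

definition braid_group :: "nat \<Rightarrow> nat gen_word set monoid" where
  "braid_group m = presented_group {1..<m} (braid_relations m)"

text \<open>The generator index \<open>i\<close> is 1-based, list positions are 0-based: the move replaces
  \<open>(t\<^sub>i, t\<^sub>i\<^sub>+\<^sub>1)\<close> by \<open>(t\<^sub>i t\<^sub>i\<^sub>+\<^sub>1 t\<^sub>i, t\<^sub>i)\<close>.\<close>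

definition hurwitz_move :: "('g, 'm) monoid_scheme \<Rightarrow> nat \<Rightarrow> 'g list \<Rightarrow> 'g list" where
  "hurwitz_move G i ts =
    (let a = ts ! (i - 1); b = ts ! i
     in take (i - 1) ts @ [a \<otimes>\<^bsub>G\<^esub> b \<otimes>\<^bsub>G\<^esub> a, a] @ drop (i + 1) ts)"

text \<open>The action of the braid group on a set \<open>X\<close> of tuples stable under the Hurwitz moves.\<close>

definition hurwitz_action ::
  "('g, 'm) monoid_scheme \<Rightarrow> 'g list set \<Rightarrow> nat gen_word set \<Rightarrow> 'g list \<Rightarrow> 'g list" where
  "hurwitz_action G X = presented_hom (BijGroup X) (\<lambda>i. restrict (hurwitz_move G i) X)"


section \<open>Affine Coxeter groups\<close>

definition coroot :: "'v::euclidean_space \<Rightarrow> 'v" where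
  "coroot \<alpha> = (2 / (\<alpha> \<bullet> \<alpha>)) *\<^sub>R \<alpha>"

definition affine_reflection :: "'v::euclidean_space \<Rightarrow> int \<Rightarrow> 'v \<Rightarrow> 'v" where
  "affine_reflection \<alpha> k v = v - (v \<bullet> \<alpha> - of_int k) *\<^sub>R coroot \<alpha>"

text \<open>A root system need not span the ambient space and may be reducible or empty.\<close>

definition crystallographic_root_system :: "'v::euclidean_space set \<Rightarrow> bool" where
  "crystallographic_root_system \<Phi> \<longleftrightarrow>
    finite \<Phi> \<and> 0 \<notin> \<Phi> \<and>
    (\<forall>\<alpha>\<in>\<Phi>. \<Phi> \<inter> range (\<lambda>c. c *\<^sub>R \<alpha>) = {\<alpha>, - \<alpha>}) \<and>
    (\<forall>\<alpha>\<in>\<Phi>. affine_reflection \<alpha> 0 ` \<Phi> = \<Phi>) \<and>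
    (\<forall>\<alpha>\<in>\<Phi>. \<forall>\<beta>\<in>\<Phi>. \<beta> \<bullet> coroot \<alpha> \<in> \<int>)"

definition affine_reflections :: "'v::euclidean_space set \<Rightarrow> ('v \<Rightarrow> 'v) set" where
  "affine_reflections \<Phi> = {affine_reflection \<alpha> k | \<alpha> k. \<alpha> \<in> \<Phi>}"

definition affine_coxeter_group :: "'v::euclidean_space set \<Rightarrow> ('v \<Rightarrow> 'v) monoid" where
  "affine_coxeter_group \<Phi> = subgroup_generated (BijGroup UNIV) (affine_reflections \<Phi>)"

definition affine_of_type ::
  "'v::euclidean_space set \<Rightarrow> ('g, 'm) monoid_scheme \<Rightarrow> 'g set \<Rightarrow> bool" where
  "affine_of_type \<Phi> W T \<longleftrightarrow>
    (\<exists>h \<in> iso W (affine_coxeter_group \<Phi>). h ` T = affine_reflections \<Phi>)"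


section \<open>Well-definedness\<close>

lemma affine_reflection_involution:
  assumes "\<alpha> \<noteq> 0"
  shows "affine_reflection \<alpha> k (affine_reflection \<alpha> k v) = v"
proof -
  let ?r = "affine_reflection \<alpha> k v"
  have "coroot \<alpha> \<bullet> \<alpha> = 2" using assms by (simp add: coroot_def)
  then have e: "?r \<bullet> \<alpha> - of_int k = - (v \<bullet> \<alpha> - of_int k)"
    by (simp add: affine_reflection_def inner_diff_left)
  have "affine_reflection \<alpha> k ?r = ?r - (?r \<bullet> \<alpha> - of_int k) *\<^sub>R coroot \<alpha>"
    by (rule affine_reflection_def)
  also have "\<dots> = ?r + (v \<bullet> \<alpha> - of_int k) *\<^sub>R coroot \<alpha>"
    unfolding e scaleR_minus_left by simp
  also have "\<dots> = v" by (simp add: affine_reflection_def)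
  finally show ?thesis .
qed

text \<open>Hence \<open>subgroup_generated\<close>, which intersects with the carrier, drops no reflection.\<close>

lemma affine_reflections_subset:
  assumes "0 \<notin> \<Phi>"
  shows "affine_reflections \<Phi> \<subseteq> carrier (BijGroup UNIV)"
proof
  fix f assume "f \<in> affine_reflections \<Phi>"
  then obtain \<alpha> k where f: "f = affine_reflection \<alpha> k" "\<alpha> \<noteq> 0"
    using assms unfolding affine_reflections_def by auto
  then have "bij f"
    by (intro o_bij[of f f]) (auto simp: fun_eq_iff affine_reflection_involution)
  then show "f \<in> carrier (BijGroup UNIV)"
    by (simp add: BijGroup_def Bij_def)
qed

lemma word_cong_words:
  "(u, v) \<in> word_cong S R \<Longrightarrow> u \<in> gen_words S \<and> v \<in> gen_words S"
  by (induction rule: word_cong.induct) auto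

lemma equiv_word_cong: "equiv (gen_words S) (word_cong S R)"
proof (rule equivI)
  show "refl_on (gen_words S) (word_cong S R)"
    by (intro refl_onI word_cong.refl)
  show "word_cong S R \<subseteq> gen_words S \<times> gen_words S"
    using word_cong_words by fast
  show "sym (word_cong S R)" by (rule symI) (rule word_cong.sym)
  show "trans (word_cong S R)" by (rule transI) (rule word_cong.trans)
qed

lemma word_cong_context:
  "(u, v) \<in> word_cong S R \<Longrightarrow> x \<in> gen_words S \<Longrightarrow> y \<in> gen_words S \<Longrightarrow>
    (x @ u @ y, x @ v @ y) \<in> word_cong S R"
proof (induction rule: word_cong.induct)
  case (refl u)
  then show ?case by (intro word_cong.refl) auto
next
  case (sym u v)
  then show ?case by (simp add: word_cong.sym[of "x @ u @ y"])
next
  case (trans u v w)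
  then show ?case using word_cong.trans[of "x @ u @ y" "x @ v @ y"] by blast
next
  case (cancel x' y' a b)
  then show ?case using word_cong.cancel[of "x @ x'" S "y' @ y" a b R] by simp
next
  case (relation x' y' u v)
  then show ?case using word_cong.relation[of "x @ x'" S "y' @ y" u v R] by simp
qed

lemma word_cong_append:
  assumes "(u, u') \<in> word_cong S R" "(v, v') \<in> word_cong S R"
  shows "(u @ v, u' @ v') \<in> word_cong S R"
proof (rule word_cong.trans)
  show "(u @ v, u' @ v) \<in> word_cong S R"
    using word_cong_context[OF assms(1), of "[]" v] word_cong_words[OF assms(2)] by simp
  show "(u' @ v, u' @ v') \<in> word_cong S R"
    using word_cong_context[OF assms(2), of u' "[]"] word_cong_words[OF assms(1)] by simp
qed

lemma presented_mult:
  assumes "u \<in> gen_words S" "v \<in> gen_words S"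
  shows "(word_cong S R `` {u}) \<otimes>\<^bsub>presented_group S R\<^esub> (word_cong S R `` {v})
    = word_cong S R `` {u @ v}"
proof -
  have *: "word_cong S R `` {u' @ v'} = word_cong S R `` {u @ v}"
    if "(u, u') \<in> word_cong S R" "(v, v') \<in> word_cong S R" for u' v'
    using equiv_class_eq[OF equiv_word_cong word_cong_append[OF that]] by simp
  have "u \<in> word_cong S R `` {u}" "v \<in> word_cong S R `` {v}"
    using assms by (simp_all add: word_cong.refl)
  then have ne: "word_cong S R `` {u} \<noteq> {}" "word_cong S R `` {v} \<noteq> {}" by blast+
  have "(\<Union>u'\<in>word_cong S R `` {u}. \<Union>v'\<in>word_cong S R `` {v}. word_cong S R `` {u' @ v'})
      = (\<Union>u'\<in>word_cong S R `` {u}. \<Union>v'\<in>word_cong S R `` {v}. word_cong S R `` {u @ v})"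
    using * by (intro SUP_cong HOL.refl) (simp add: Image_singleton_iff)
  also have "\<dots> = word_cong S R `` {u @ v}" using ne by (simp only: UN_constant if_False)
  finally show ?thesis by (simp add: presented_group_def)
qed

lemma word_inverse:
  assumes "u \<in> gen_words S"
  shows "(rev (map (\<lambda>(a, b). (a, \<not> b)) u) @ u, []) \<in> word_cong S R"
  using assms
proof (induction u)
  case (Cons p u)
  obtain a b where p: "p = (a, b)" by force
  let ?i = "rev (map (\<lambda>(a, b). (a, \<not> b)) u)"
  have i: "?i \<in> gen_words S" "u \<in> gen_words S" "a \<in> S" using Cons p by auto
  have "(?i @ [(a, \<not> b), (a, \<not> \<not> b)] @ u, ?i @ u) \<in> word_cong S R"
    using i by (intro word_cong.cancel)
  then have "(rev (map (\<lambda>(a, b). (a, \<not> b)) (p # u)) @ p # u, ?i @ u) \<in> word_cong S R"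
    by (simp add: p)
  then show ?case using Cons.IH i(2) word_cong.trans by blast
next
  case Nil
  show ?case by (simp add: word_cong.refl)
qed

lemma group_presented_group: "group (presented_group S R)"
proof (rule groupI)
  let ?P = "presented_group S R" and ?c = "\<lambda>u. word_cong S R `` {u}"
  have C: "\<exists>u \<in> gen_words S. A = ?c u" if "A \<in> carrier ?P" for A
    using that by (auto simp: presented_group_def elim!: quotientE)
  have I: "?c u \<in> carrier ?P" if "u \<in> gen_words S" for u
    using that by (auto simp: presented_group_def intro: quotientI)
  have one: "\<one>\<^bsub>?P\<^esub> = ?c []" by (simp add: presented_group_def)
  show "\<one>\<^bsub>?P\<^esub> \<in> carrier ?P" using I[of "[]"] by (simp add: one)
  fix A assume "A \<in> carrier ?P"
  then obtain u where u: "u \<in> gen_words S" "A = ?c u" using C by blast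
  show "\<one>\<^bsub>?P\<^esub> \<otimes>\<^bsub>?P\<^esub> A = A" using u presented_mult[of "[]" S u R] by (simp add: one)
  let ?i = "rev (map (\<lambda>(a, b). (a, \<not> b)) u)"
  have i: "?i \<in> gen_words S" using u by auto
  have "?c ?i \<otimes>\<^bsub>?P\<^esub> A = \<one>\<^bsub>?P\<^esub>"
    using presented_mult[OF i u(1)] equiv_class_eq[OF equiv_word_cong word_inverse[OF u(1)]]
    by (simp add: one u(2))
  then show "\<exists>B\<in>carrier ?P. B \<otimes>\<^bsub>?P\<^esub> A = \<one>\<^bsub>?P\<^esub>" using I[OF i] by blast
  fix B assume "B \<in> carrier ?P"
  then obtain v where v: "v \<in> gen_words S" "B = ?c v" using C by blast
  show "A \<otimes>\<^bsub>?P\<^esub> B \<in> carrier ?P"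
    using u v I[of "u @ v"] by (simp add: presented_mult)
  fix D assume "D \<in> carrier ?P"
  then obtain w where w: "w \<in> gen_words S" "D = ?c w" using C by blast
  show "A \<otimes>\<^bsub>?P\<^esub> B \<otimes>\<^bsub>?P\<^esub> D = A \<otimes>\<^bsub>?P\<^esub> (B \<otimes>\<^bsub>?P\<^esub> D)"
    using u v w presented_mult[of "u @ v" S w R] presented_mult[of u S "v @ w" R]
    by (simp add: presented_mult)
qed

context group
begin

lemma word_eval_Nil [simp]: "word_eval G f [] = \<one>"
  by (simp add: word_eval_def)

lemma word_eval_Cons [simp]:
  "word_eval G f ((a, b) # u) = (if b then f a else inv (f a)) \<otimes> word_eval G f u"
  by (simp add: word_eval_def)

lemma word_eval_closed:
  "f ` S \<subseteq> carrier G \<Longrightarrow> u \<in> gen_words S \<Longrightarrow> word_eval G f u \<in> carrier G"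
  by (induction u) auto

lemma word_eval_append:
  "f ` S \<subseteq> carrier G \<Longrightarrow> u \<in> gen_words S \<Longrightarrow> v \<in> gen_words S \<Longrightarrow>
    word_eval G f (u @ v) = word_eval G f u \<otimes> word_eval G f v"
proof (induction u)
  case Nil
  then show ?case by (simp add: word_eval_closed)
next
  case (Cons p u)
  obtain a b where p: "p = (a, b)" by force
  have "f a \<in> carrier G" "word_eval G f u \<in> carrier G" "word_eval G f v \<in> carrier G"
    using Cons p by (auto intro: word_eval_closed)
  with Cons p show ?case by (auto simp: m_assoc)
qed

lemma word_eval_cong:
  assumes "(u, v) \<in> word_cong S R" and f: "f ` S \<subseteq> carrier G"
    and R: "\<And>u v. (u, v) \<in> R \<Longrightarrow> word_eval G f u = word_eval G f v"
  shows "word_eval G f u = word_eval G f v"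
  using assms(1)
proof (induction rule: word_cong.induct)
  case (cancel x y a b)
  then have "f a \<in> carrier G" using f by auto
  moreover have "word_eval G f y \<in> carrier G" using word_eval_closed[OF f] cancel by auto
  ultimately have "word_eval G f ([(a, b), (a, \<not> b)] @ y) = word_eval G f y"
    by (simp add: m_assoc[symmetric])
  then show ?case
    using cancel word_eval_append[OF f, of x "[(a, b), (a, \<not> b)] @ y"] word_eval_append[OF f, of x y]
    by simp
next
  case (relation x y u v)
  then show ?case using R[OF relation(3)] by (simp add: word_eval_append[OF f])
qed auto

lemma presented_hom_class:
  assumes f: "f ` S \<subseteq> carrier G" and u: "u \<in> gen_words S"
    and R: "\<And>u v. (u, v) \<in> R \<Longrightarrow> word_eval G f u = word_eval G f v"
  shows "presented_hom G f (word_cong S R `` {u}) = word_eval G f u"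
proof -
  have "word_eval G f ` (word_cong S R `` {u}) = {word_eval G f u}"
    using word_eval_cong[OF _ f R, symmetric] word_cong.refl[OF u, of R] by blast
  then show ?thesis by (simp add: presented_hom_def)
qed

lemma presented_hom_hom:
  assumes f: "f ` S \<subseteq> carrier G"
    and R: "\<And>u v. (u, v) \<in> R \<Longrightarrow> word_eval G f u = word_eval G f v"
  shows "presented_hom G f \<in> hom (presented_group S R) G"
proof (rule homI)
  let ?P = "presented_group S R"
  note cl = presented_hom_class[OF f _ R]
  have C: "\<exists>u \<in> gen_words S. A = word_cong S R `` {u}" if "A \<in> carrier ?P" for A
    using that by (auto simp: presented_group_def elim!: quotientE)
  fix A assume "A \<in> carrier ?P"
  then obtain u where u: "u \<in> gen_words S" "A = word_cong S R `` {u}" using C by blast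
  show "presented_hom G f A \<in> carrier G"
    using u by (simp add: cl word_eval_closed[OF f])
  fix B assume "B \<in> carrier ?P"
  then obtain v where v: "v \<in> gen_words S" "B = word_cong S R `` {v}" using C by blast
  show "presented_hom G f (A \<otimes>\<^bsub>?P\<^esub> B) = presented_hom G f A \<otimes> presented_hom G f B"
    using u v cl[of "u @ v"] by (simp add: presented_mult cl word_eval_append[OF f])
qed

end

lemma hurwitz_move_split:
  "length xs + 1 = i \<Longrightarrow>
    hurwitz_move G i (xs @ a # b # ys) = xs @ (a \<otimes>\<^bsub>G\<^esub> b \<otimes>\<^bsub>G\<^esub> a) # a # ys"
  by (auto simp: hurwitz_move_def nth_append)

lemma split_at:
  assumes "1 \<le> i" "i < length ts"
  obtains xs a b ys where "ts = xs @ a # b # ys" "length xs + 1 = i"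
proof
  have "ts = take (i - 1) ts @ ts ! (i - 1) # drop (Suc (i - 1)) ts"
    using assms by (intro id_take_nth_drop) simp
  also have "drop (Suc (i - 1)) ts = ts ! i # drop (Suc i) ts"
    using assms Cons_nth_drop_Suc[of i ts] by simp
  finally show "ts = take (i - 1) ts @ ts ! (i - 1) # ts ! i # drop (Suc i) ts" .
  show "length (take (i - 1) ts) + 1 = i" using assms by simp
qed

lemma hurwitz_group_action:
  fixes W :: "('g, 'm) monoid_scheme"
  assumes "group W" and T: "T \<subseteq> carrier W" "\<And>t. t \<in> T \<Longrightarrow> t \<otimes>\<^bsub>W\<^esub> t = \<one>\<^bsub>W\<^esub>"
    and X: "\<And>ts. ts \<in> X \<Longrightarrow> set ts \<subseteq> T \<and> length ts = m"
    and surj: "\<And>i. 1 \<le> i \<Longrightarrow> i < m \<Longrightarrow> hurwitz_move W i ` X = X"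
  shows "group_action (braid_group m) X (hurwitz_action W X)"
proof -
  interpret W: group W by fact
  interpret B: group "BijGroup X" by (rule group_BijGroup)
  have cancel: "a \<otimes>\<^bsub>W\<^esub> (a \<otimes>\<^bsub>W\<^esub> b) = b" if "a \<in> T" "b \<in> carrier W" for a b
  proof -
    have "a \<in> carrier W" using that T by blast
    then have "a \<otimes>\<^bsub>W\<^esub> (a \<otimes>\<^bsub>W\<^esub> b) = a \<otimes>\<^bsub>W\<^esub> a \<otimes>\<^bsub>W\<^esub> b" using that by (simp add: W.m_assoc)
    then show ?thesis using that T by simp
  qed
  let ?f = "\<lambda>i. restrict (hurwitz_move W i) X"
  have inj: "inj_on (hurwitz_move W i) X" if i: "1 \<le> i" "i < m" for i
  proof (rule inj_onI)
    fix ts us assume *: "ts \<in> X" "us \<in> X" "hurwitz_move W i ts = hurwitz_move W i us"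
    obtain xs a b ys where ts: "ts = xs @ a # b # ys" "length xs + 1 = i"
      by (rule split_at[of i ts]) (use X[OF *(1)] i in auto)
    obtain xs' a' b' ys' where us: "us = xs' @ a' # b' # ys'" "length xs' + 1 = i"
      by (rule split_at[of i us]) (use X[OF *(2)] i in auto)
    have l: "length xs = length xs'" using ts us by simp
    from *(3) have e: "xs = xs' \<and> a = a' \<and> ys = ys' \<and> a \<otimes>\<^bsub>W\<^esub> b \<otimes>\<^bsub>W\<^esub> a = a' \<otimes>\<^bsub>W\<^esub> b' \<otimes>\<^bsub>W\<^esub> a'"
      using l unfolding ts(1) us(1) hurwitz_move_split[OF ts(2)] hurwitz_move_split[OF us(2)] by auto
    have c: "a \<in> carrier W" "b \<in> carrier W" "b' \<in> carrier W"
      using X[OF *(1)] X[OF *(2)] T(1) by (auto simp: ts us)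
    have "b = b'" using e c by auto
    with e show "ts = us" by (simp add: ts us)
  qed
  have st: "hurwitz_move W i ts \<in> X" if "1 \<le> i" "i < m" "ts \<in> X" for i ts
    using surj that by blast
  have f: "?f ` {1..<m} \<subseteq> carrier (BijGroup X)"
    using inj surj st by (auto simp: BijGroup_def Bij_def bij_betw_def)
  have mult: "g \<otimes>\<^bsub>BijGroup X\<^esub> h = compose X g h"
    if "g \<in> carrier (BijGroup X)" "h \<in> carrier (BijGroup X)" for g h
    using that by (simp add: BijGroup_def)
  have ext: "g = h" if "g \<in> carrier (BijGroup X)" "h \<in> carrier (BijGroup X)"
    "\<And>x. x \<in> X \<Longrightarrow> g x = h x" for g h
    using that by (auto simp: BijGroup_def Bij_def intro: extensionalityI)
  have app: "(g \<otimes>\<^bsub>BijGroup X\<^esub> h) x = g (h x)"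
    if "g \<in> carrier (BijGroup X)" "h \<in> carrier (BijGroup X)" "x \<in> X" for g h x
    using that by (simp add: mult compose_def)
  have fc: "?f i \<in> carrier (BijGroup X)" if "1 \<le> i" "i < m" for i using f that by auto
  have far: "word_eval (BijGroup X) ?f [(i, True), (j, True)] =
      word_eval (BijGroup X) ?f [(j, True), (i, True)]"
    if ij: "1 \<le> i" "i + 1 < j" "j < m" for i j
  proof -
    have c: "?f i \<in> carrier (BijGroup X)" "?f j \<in> carrier (BijGroup X)" using fc ij by auto
    have "?f i \<otimes>\<^bsub>BijGroup X\<^esub> ?f j = ?f j \<otimes>\<^bsub>BijGroup X\<^esub> ?f i"
    proof (rule ext)
      fix ts assume ts: "ts \<in> X"
      obtain xs a b ys where 1: "ts = xs @ a # b # ys" "length xs + 1 = i"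
        by (rule split_at[of i ts]) (use X[OF ts] ij in auto)
      have len: "length xs + 2 + length ys = m" using X[OF ts] by (simp add: 1)
      obtain ys' c' d zs where 2: "ys = ys' @ c' # d # zs" "length ys' + 1 = j - i - 1"
        by (rule split_at[of "j - i - 1" ys]) (use ij 1 len in auto)
      have A: "hurwitz_move W j (xs @ p # q # ys' @ c' # d # zs)
          = xs @ p # q # ys' @ (c' \<otimes>\<^bsub>W\<^esub> d \<otimes>\<^bsub>W\<^esub> c') # c' # zs" for p q
        using hurwitz_move_split[of "xs @ p # q # ys'" j W c' d zs] 1 2 ij by simp
      show "(?f i \<otimes>\<^bsub>BijGroup X\<^esub> ?f j) ts = (?f j \<otimes>\<^bsub>BijGroup X\<^esub> ?f i) ts"
        using ts ij st[of i ts] st[of j ts] by (simp add: app[OF c] app[OF c(2,1)])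
          (simp add: 1(1) 2(1) A hurwitz_move_split[OF 1(2)])
    qed (use c in auto)
    with c show ?thesis by simp
  qed
  have near: "word_eval (BijGroup X) ?f [(i, True), (i + 1, True), (i, True)] =
      word_eval (BijGroup X) ?f [(i + 1, True), (i, True), (i + 1, True)]"
    if ij: "1 \<le> i" "i + 1 < m" for i
  proof -
    let ?j = "i + 1"
    have c: "?f i \<in> carrier (BijGroup X)" "?f ?j \<in> carrier (BijGroup X)" using fc ij by auto
    have "?f i \<otimes>\<^bsub>BijGroup X\<^esub> (?f ?j \<otimes>\<^bsub>BijGroup X\<^esub> ?f i) =
        ?f ?j \<otimes>\<^bsub>BijGroup X\<^esub> (?f i \<otimes>\<^bsub>BijGroup X\<^esub> ?f ?j)"
    proof (rule ext)
      fix ts assume ts: "ts \<in> X"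
      obtain xs a b ys where 1: "ts = xs @ a # b # ys" "length xs + 1 = i"
        by (rule split_at[of i ts]) (use X[OF ts] ij in auto)
      have len: "length xs + 2 + length ys = m" using X[OF ts] by (simp add: 1)
      obtain d zs where 2: "ys = d # zs" using ij 1 len by (cases ys) auto
      have t: "a \<in> T" "b \<in> T" "d \<in> T" using X[OF ts] by (auto simp: 1 2)
      then have tc: "a \<in> carrier W" "b \<in> carrier W" "d \<in> carrier W" using T by auto
      have A: "hurwitz_move W ?j (xs @ p # q # r # zs) = xs @ p # (q \<otimes>\<^bsub>W\<^esub> r \<otimes>\<^bsub>W\<^esub> q) # q # zs" for p q r
        using hurwitz_move_split[of "xs @ [p]" ?j W q r zs] 1 by simp
      have "hurwitz_move W i (hurwitz_move W ?j (hurwitz_move W i ts)) =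
          hurwitz_move W ?j (hurwitz_move W i (hurwitz_move W ?j ts))"
        unfolding 1(1) 2 A hurwitz_move_split[OF 1(2)] using tc t
        by (simp add: W.m_assoc cancel)
      then have "?f i (?f ?j (?f i ts)) = ?f ?j (?f i (?f ?j ts))"
        using ts ij by (simp add: st)
      then show "(?f i \<otimes>\<^bsub>BijGroup X\<^esub> (?f ?j \<otimes>\<^bsub>BijGroup X\<^esub> ?f i)) ts =
          (?f ?j \<otimes>\<^bsub>BijGroup X\<^esub> (?f i \<otimes>\<^bsub>BijGroup X\<^esub> ?f ?j)) ts"
        by (simp only: app[OF c(1) B.m_closed[OF c(2,1)] ts] app[OF c(2,1) ts]
            app[OF c(2) B.m_closed[OF c(1,2)] ts] app[OF c(1,2) ts])
    qed (use c in auto)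
    with c show ?thesis
      by (simp only: B.word_eval_Cons B.word_eval_Nil if_True B.r_one)
  qed
  have "word_eval (BijGroup X) ?f u = word_eval (BijGroup X) ?f v"
    if "(u, v) \<in> braid_relations m" for u v
    using that far near unfolding braid_relations_def by fastforce
  from B.presented_hom_hom[OF f this]
  have "hurwitz_action W X \<in> hom (braid_group m) (BijGroup X)"
    by (simp add: hurwitz_action_def braid_group_def)
  then show ?thesis
    unfolding group_action_def group_hom_def group_hom_axioms_def
    by (simp add: braid_group_def group_presented_group group_BijGroup)
qed

lemma coxeter_system_involution:
  assumes "coxeter_system W S" "s \<in> S"
  shows "s \<otimes>\<^bsub>W\<^esub> s = \<one>\<^bsub>W\<^esub>"
proof -
  obtain m h where m: "coxeter_matrix S m"
    and h: "h \<in> iso (presented_group S (coxeter_relations S m)) W"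
    and hs: "h (word_cong S (coxeter_relations S m) `` {[(s, True)]}) = s"
    using assms unfolding coxeter_system_def by blast
  let ?R = "coxeter_relations S m"
  let ?P = "presented_group S ?R" and ?c = "\<lambda>u. word_cong S ?R `` {u}"
  have W: "group W" using assms(1) by (simp add: coxeter_system_def)
  have w: "[(s, True)] \<in> gen_words S" using assms(2) by simp
  then have c: "?c [(s, True)] \<in> carrier ?P" by (simp add: presented_group_def quotientI)
  have "m s s = 1" using m assms(2) by (simp add: coxeter_matrix_def)
  then have "([(s, True), (s, True)], []) \<in> ?R"
    using assms(2) unfolding coxeter_relations_def by (intro CollectI exI[of _ s]) simp
  then have "([(s, True), (s, True)], []) \<in> word_cong S ?R"
    using word_cong.relation[of "[]" S "[]" "[(s, True), (s, True)]" "[]" ?R] assms(2) by simp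
  then have "?c [(s, True), (s, True)] = \<one>\<^bsub>?P\<^esub>"
    using equiv_class_eq[OF equiv_word_cong] by (simp add: presented_group_def)
  then have "?c [(s, True)] \<otimes>\<^bsub>?P\<^esub> ?c [(s, True)] = \<one>\<^bsub>?P\<^esub>"
    using presented_mult[OF w w] by simp
  moreover have "h \<in> hom ?P W" using h by (simp add: iso_def)
  ultimately show ?thesis
    using hom_mult[of h ?P W, OF _ c c] hom_one[OF _ group_presented_group W, of h] hs by metis
qed

lemma dual_coxeter_system_reflections:
  assumes "dual_coxeter_system n W T"
  shows "group W" "T \<subseteq> carrier W"
    and "\<And>t. t \<in> T \<Longrightarrow> t \<otimes>\<^bsub>W\<^esub> t = \<one>\<^bsub>W\<^esub>"
    and "\<And>s t. s \<in> T \<Longrightarrow> t \<in> T \<Longrightarrow> s \<otimes>\<^bsub>W\<^esub> t \<otimes>\<^bsub>W\<^esub> s \<in> T"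
proof -
  show W: "group W" and T: "T \<subseteq> carrier W" using assms by (auto simp: dual_coxeter_system_def)
  interpret W: group W by fact
  obtain S where S: "S \<subseteq> T" "coxeter_system W S" "T = conjugates W S"
    using assms by (auto simp: dual_coxeter_system_def)
  show inv: "t \<otimes>\<^bsub>W\<^esub> t = \<one>\<^bsub>W\<^esub>" if t: "t \<in> T" for t
  proof -
    obtain w s where ws: "t = w \<otimes>\<^bsub>W\<^esub> s \<otimes>\<^bsub>W\<^esub> inv\<^bsub>W\<^esub> w" "w \<in> carrier W" "s \<in> S"
      using t S by (auto simp: conjugates_def)
    have s: "s \<in> carrier W" "s \<otimes>\<^bsub>W\<^esub> s = \<one>\<^bsub>W\<^esub>"
      using ws S T coxeter_system_involution by auto
    have c: "inv\<^bsub>W\<^esub> w \<otimes>\<^bsub>W\<^esub> (w \<otimes>\<^bsub>W\<^esub> x) = x" if "x \<in> carrier W" for x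
      using that ws(2) by (simp add: W.m_assoc[symmetric])
    have "t \<otimes>\<^bsub>W\<^esub> t = w \<otimes>\<^bsub>W\<^esub> (s \<otimes>\<^bsub>W\<^esub> s) \<otimes>\<^bsub>W\<^esub> inv\<^bsub>W\<^esub> w"
      using ws(2) s(1) by (simp add: ws(1) W.m_assoc c)
    then show ?thesis using ws s by simp
  qed
  fix s t assume st: "s \<in> T" "t \<in> T"
  have s: "s \<in> carrier W" "inv\<^bsub>W\<^esub> s = s" using st T inv[of s] W.inv_equality[of s s] by auto
  obtain w r where wr: "t = w \<otimes>\<^bsub>W\<^esub> r \<otimes>\<^bsub>W\<^esub> inv\<^bsub>W\<^esub> w" "w \<in> carrier W" "r \<in> S"
    using st S by (auto simp: conjugates_def)
  have r: "r \<in> carrier W" using wr S T by auto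
  have "s \<otimes>\<^bsub>W\<^esub> t \<otimes>\<^bsub>W\<^esub> s = (s \<otimes>\<^bsub>W\<^esub> w) \<otimes>\<^bsub>W\<^esub> r \<otimes>\<^bsub>W\<^esub> inv\<^bsub>W\<^esub> (s \<otimes>\<^bsub>W\<^esub> w)"
    using s r wr(2) by (simp add: wr(1) W.m_assoc W.inv_mult_group)
  then show "s \<otimes>\<^bsub>W\<^esub> t \<otimes>\<^bsub>W\<^esub> s \<in> T"
    using S(3) s wr unfolding conjugates_def by blast
qed

lemma (in monoid) list_prod_closed: "set ts \<subseteq> carrier G \<Longrightarrow> list_prod G ts \<in> carrier G"
  by (induction ts) (auto simp: list_prod_def)

lemma (in monoid) list_prod_append:
  "set ts \<subseteq> carrier G \<Longrightarrow> set us \<subseteq> carrier G \<Longrightarrow>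
    list_prod G (ts @ us) = list_prod G ts \<otimes> list_prod G us"
proof (induction ts)
  case Nil
  then show ?case using list_prod_closed[of us] by (simp add: list_prod_def)
next
  case (Cons t ts)
  then show ?case using list_prod_closed[of us] list_prod_closed[of ts]
    by (simp add: list_prod_def m_assoc)
qed

lemma hurwitz_action_Red:
  assumes dual: "dual_coxeter_system n W T"
  shows "group_action (braid_group (reflection_length W T w)) (Red W T w)
    (hurwitz_action W (Red W T w))"
proof (rule hurwitz_group_action)
  note T = dual_coxeter_system_reflections[OF dual]
  interpret W: group W by (rule T(1))
  show "group W" "T \<subseteq> carrier W" "\<And>t. t \<in> T \<Longrightarrow> t \<otimes>\<^bsub>W\<^esub> t = \<one>\<^bsub>W\<^esub>" by (fact T)+
  show "\<And>ts. ts \<in> Red W T w \<Longrightarrow> set ts \<subseteq> T \<and> length ts = reflection_length W T w"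
    by (auto simp: Red_def)
  have cancel: "a \<otimes>\<^bsub>W\<^esub> (a \<otimes>\<^bsub>W\<^esub> b) = b" if "a \<in> T" "b \<in> carrier W" for a b
  proof -
    have "a \<in> carrier W" using that T(2) by blast
    then have "a \<otimes>\<^bsub>W\<^esub> (a \<otimes>\<^bsub>W\<^esub> b) = a \<otimes>\<^bsub>W\<^esub> a \<otimes>\<^bsub>W\<^esub> b" using that by (simp add: W.m_assoc)
    then show ?thesis using that T by simp
  qed
  have Red: "xs @ a # b # ys \<in> Red W T w \<longleftrightarrow> xs @ c # d # ys \<in> Red W T w"
    if "a \<in> T" "b \<in> T" "c \<in> T" "d \<in> T" "a \<otimes>\<^bsub>W\<^esub> b = c \<otimes>\<^bsub>W\<^esub> d" for xs ys a b c d
  proof (cases "set xs \<subseteq> T \<and> set ys \<subseteq> T")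
    case True
    have C: "a \<in> carrier W" "b \<in> carrier W" "c \<in> carrier W" "d \<in> carrier W"
      "set xs \<subseteq> carrier W" "set ys \<subseteq> carrier W"
      using that True T(2) by auto
    have "list_prod W (a # b # ys) = list_prod W (c # d # ys)"
      using C W.list_prod_closed[OF C(6)] that(5)
      by (simp add: list_prod_def W.m_assoc[symmetric])
    then have "list_prod W (xs @ a # b # ys) = list_prod W (xs @ c # d # ys)"
      using C by (simp add: W.list_prod_append)
    then show ?thesis using that True by (auto simp: Red_def)
  qed (use that in \<open>auto simp: Red_def\<close>)
  fix i assume i: "1 \<le> i" "i < reflection_length W T w"
  show "hurwitz_move W i ` Red W T w = Red W T w"
  proof (intro equalityI subsetI)
    fix us assume "us \<in> hurwitz_move W i ` Red W T w"
    then obtain ts where ts: "ts \<in> Red W T w" "us = hurwitz_move W i ts" by blast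
    obtain xs a b ys where 1: "ts = xs @ a # b # ys" "length xs + 1 = i"
      by (rule split_at[of i ts]) (use ts i in \<open>auto simp: Red_def\<close>)
    have ab: "a \<in> T" "b \<in> T" using ts(1) by (auto simp: 1 Red_def)
    then have "a \<in> carrier W" "b \<in> carrier W" using T(2) by auto
    then have "a \<otimes>\<^bsub>W\<^esub> b = a \<otimes>\<^bsub>W\<^esub> b \<otimes>\<^bsub>W\<^esub> a \<otimes>\<^bsub>W\<^esub> a"
      using T(3)[OF ab(1)] by (simp add: W.m_assoc)
    then show "us \<in> Red W T w"
      using Red[OF ab T(4)[OF ab] ab(1), of xs ys] ts(1)
      unfolding ts(2) 1(1) hurwitz_move_split[OF 1(2)] by blast
  next
    fix us assume us: "us \<in> Red W T w"
    obtain xs a b ys where 1: "us = xs @ a # b # ys" "length xs + 1 = i"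
      by (rule split_at[of i us]) (use us i in \<open>auto simp: Red_def\<close>)
    let ?ts = "xs @ b # (b \<otimes>\<^bsub>W\<^esub> a \<otimes>\<^bsub>W\<^esub> b) # ys"
    have ab: "a \<in> T" "b \<in> T" using us by (auto simp: 1 Red_def)
    then have C: "a \<in> carrier W" "b \<in> carrier W" using T(2) by auto
    have "a \<otimes>\<^bsub>W\<^esub> b = b \<otimes>\<^bsub>W\<^esub> (b \<otimes>\<^bsub>W\<^esub> a \<otimes>\<^bsub>W\<^esub> b)"
      using C ab by (simp add: W.m_assoc cancel)
    then have "?ts \<in> Red W T w"
      using Red[OF ab ab(2) T(4)[OF ab(2,1)], of xs ys] us unfolding 1(1) by blast
    moreover have "hurwitz_move W i ?ts = us"
      unfolding 1(1) hurwitz_move_split[OF 1(2)]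
      using C ab T(3)[OF ab(2)] by (simp add: W.m_assoc cancel)
    ultimately show "us \<in> hurwitz_move W i ` Red W T w" by blast
  qed
qed

end

theory Submission
  imports Defs
begin

text \<open>
  Affine reflections are encoded by roots in \<open>V \<oplus> \<real>\<^sup>2\<close> with a nondegenerate form, so that by
  Carter's argument any two shortest factorizations of \<open>w\<close> into \<open>m\<close> reflections, one of which has
  linearly independent roots \<open>a\<^sub>1, \<dots>, a\<^sub>m\<close>, have roots spanning the same space \<open>U\<close>.
  By induction on \<open>m\<close> it suffices to find in the Hurwitz orbit of \<open>(a\<^sub>1, \<dots>, a\<^sub>m)\<close> a tuple ending with a
  prescribed root \<open>r\<close> of another factorization. Hurwitz moves conjugate the tuple by \<open>w\<close>, so \<open>r\<close> may be
  replaced by any \<open>w\<^sup>j r\<close>, and by induction it is enough that some \<open>w\<^sup>j r\<close> is \<open>\<plusminus>a\<^sub>m\<close> or lies in the span of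
  \<open>a\<^sub>1, \<dots>, a\<^sub>m\<^sub>-\<^sub>1\<close>, i.e. has coefficient zero at \<open>a\<^sub>m\<close>. Because the \<open>a\<^sub>i\<close> extend to a generating set of
  independent reflections, this coefficient is, after a rescaling by root lengths, an integer; passing from
  \<open>w\<^sup>j r\<close> to \<open>w\<^sup>j\<^sup>+\<^sup>1 r\<close> changes it by at most one. So it vanishes somewhere if it takes
  values of both signs. If \<open>U\<close> is positive definite, it does, since the sum of \<open>w\<^sup>j r\<close> over a period is
  fixed by \<open>w\<close> and hence zero. Otherwise \<open>U\<close> contains the radical \<open>\<real> \<delta>\<close> of the form, and for suitable \<open>a\<^sub>m\<close>
  and \<open>r\<close> the coefficient grows linearly with \<open>j\<close>, while \<open>\<delta>\<close> is not in the span of \<open>a\<^sub>1, \<dots>, a\<^sub>m\<^sub>-\<^sub>1\<close>.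

  That the roots of a simple system are independent (in each component) follows from the Coxeter
  presentation: the hyperplanes of the simple reflections can be moved arbitrarily and independently,
  preserving the linear parts, and still give a homomorphism to the affine isometries of \<open>V\<close>; but every
  homomorphism with these linear parts comes from a translation and a scaling of each component.
\<close>

section \<open>Reflections of a bilinear form and Hurwitz equivalence\<close>

definition indep_list :: "'e::euclidean_space list \<Rightarrow> bool" where
  "indep_list xs \<longleftrightarrow> distinct xs \<and> independent (set xs)"

lemma indep_list_prefix: "indep_list (xs @ ys) \<Longrightarrow> indep_list xs"
  unfolding indep_list_def by (auto elim!: independent_mono)

text \<open>Dimension count: length xs \<le> dim (set ys) \<le> card (set ys) \<le> length ys, and
  the length bound turns all of these into equalities.\<close>

lemma indep_list_exchange:
  assumes "indep_list xs" "set xs \<subseteq> span (set ys)" "length ys \<le> length xs"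
  shows "indep_list ys" "length ys = length xs"
proof -
  have c: "card (set xs) = length xs" "independent (set xs)"
    using assms(1) by (auto simp: indep_list_def distinct_card)
  have "dim (set xs) \<le> dim (span (set ys))" by (rule dim_subset) (rule assms(2))
  then have "length xs \<le> dim (set ys)"
    using c by (simp add: dim_eq_card_independent)
  moreover have "dim (set ys) \<le> card (set ys)" by (rule dim_le_card') simp
  moreover have "card (set ys) \<le> length ys" by (rule card_length)
  ultimately have e: "card (set ys) = length ys" "dim (set ys) = card (set ys)"
    "length ys = length xs" using assms(3) by linarith+
  then show "length ys = length xs" by simp
  have "independent (set ys)"
    using e by (intro card_le_dim_spanning[of _ "set ys"]) (auto intro: span_base)
  with e show "indep_list ys" by (simp add: indep_list_def card_distinct)
qed

lemma indep_list_notin_span: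
  "indep_list (xs @ a # ys) \<Longrightarrow> a \<notin> span (set (xs @ ys))"
proof -
  assume "indep_list (xs @ a # ys)"
  then have "independent (insert a (set (xs @ ys)))" "a \<notin> set (xs @ ys)"
    by (auto simp: indep_list_def)
  then show ?thesis by (auto simp: independent_insert)
qed

text \<open>The form may be indefinite. Nondegeneracy is stated as representability of functionals
  because it serves to produce vectors with prescribed values on an independent set
  (\<open>dual_vector\<close>).\<close>

locale form_space =
  fixes q :: "'e::euclidean_space \<Rightarrow> 'e \<Rightarrow> real"
  assumes q_bilinear: "bilinear q"
    and q_sym: "q x y = q y x"
    and q_represent: "linear f \<Longrightarrow> \<exists>u. \<forall>x. q u x = f x"
begin

lemma q_simps [simp]:
  "q (x + y) z = q x z + q y z" "q z (x + y) = q z x + q z y"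
  "q (x - y) z = q x z - q y z" "q z (x - y) = q z x - q z y"
  "q (- x) z = - q x z" "q z (- x) = - q z x"
  "q (c *\<^sub>R x) z = c * q x z" "q z (c *\<^sub>R x) = c * q z x"
  "q 0 z = 0" "q z 0 = 0"
  using q_bilinear
  by (simp_all add: bilinear_ladd bilinear_radd bilinear_lsub bilinear_rsub bilinear_lneg
      bilinear_rneg bilinear_lmul bilinear_rmul bilinear_lzero bilinear_rzero)

lemma q_sum: "q x (\<Sum>i\<in>A. g i) = (\<Sum>i\<in>A. q x (g i))"
  by (induction A rule: infinite_finite_induct) auto

lemma dual_vector:
  assumes "independent B"
  obtains u where "\<And>b. b \<in> B \<Longrightarrow> q u b = f b"
proof -
  obtain g where g: "linear g" "\<forall>b\<in>B. g b = f b"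
    using linear_independent_extend[OF assms, of f] by blast
  obtain u where "\<forall>x. q u x = g x" using q_represent[OF g(1)] by blast
  then have "\<And>b. b \<in> B \<Longrightarrow> q u b = f b" using g by simp
  then show ?thesis by (rule that)
qed

lemma orth_span: "x \<in> span A \<Longrightarrow> (\<And>a. a \<in> A \<Longrightarrow> q u a = 0) \<Longrightarrow> q u x = 0"
  by (induction rule: span_induct_alt) auto

text \<open>For \<open>q a a = 0\<close> division by zero makes this the identity.\<close>

definition reflection :: "'e \<Rightarrow> 'e \<Rightarrow> 'e" where
  "reflection a x = x - (2 * q x a / q a a) *\<^sub>R a"

definition rprod :: "'e list \<Rightarrow> 'e \<Rightarrow> 'e" where
  "rprod as = foldr (\<lambda>a g. reflection a \<circ> g) as id"

lemma rprod_Nil [simp]: "rprod [] = id" by (simp add: rprod_def)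

lemma rprod_Cons [simp]: "rprod (a # as) = reflection a \<circ> rprod as" by (simp add: rprod_def)

lemma rprod_append [simp]: "rprod (as @ bs) = rprod as \<circ> rprod bs"
  by (induction as) (auto simp: fun_eq_iff)

lemma linear_reflection: "linear (reflection a)"
  by (rule linearI) (auto simp: reflection_def algebra_simps add_divide_distrib)

lemma linear_rprod: "linear (rprod as)"
  by (induction as) (simp_all only: rprod_Nil rprod_Cons linear_id linear_compose linear_reflection)

lemmas rprod_linear_simps =
  linear_add[OF linear_rprod] linear_diff[OF linear_rprod] linear_scale[OF linear_rprod]
  linear_neg[OF linear_rprod] linear_0[OF linear_rprod]

lemma reflection_self: "q a a \<noteq> 0 \<Longrightarrow> reflection a a = - a"
  by (simp add: reflection_def scaleR_2)

lemma reflection_null: "q a a = 0 \<Longrightarrow> reflection a = id"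
  by (simp add: reflection_def fun_eq_iff)

lemma reflection_involution [simp]: "reflection a (reflection a x) = x"
  by (cases "q a a = 0") (auto simp: reflection_null reflection_def field_simps)

lemma reflection_uminus [simp]: "reflection (- a) = reflection a"
  by (simp add: reflection_def fun_eq_iff)

lemma q_reflection: "q (reflection a x) (reflection a y) = q x y"
proof (cases "q a a = 0")
  case False
  define s t where "s = 2 * q x a / q a a" and "t = 2 * q y a / q a a"
  then have "s * q a a = 2 * q x a" "t * q a a = 2 * q y a" using False by simp_all
  moreover have "q (reflection a x) (reflection a y) = q x y - t * q x a - s * q y a + s * (t * q a a)"
    unfolding reflection_def s_def[symmetric] t_def[symmetric]
    by (simp add: q_sym[of a y] algebra_simps)
  moreover have "t * q x a = s * q y a" by (simp add: s_def t_def)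
  ultimately show ?thesis by simp
qed (simp add: reflection_null)

lemma q_rprod: "q (rprod as x) (rprod as y) = q x y"
  by (induction as) (auto simp: q_reflection)

lemma rprod_rev [simp]: "rprod (rev as) (rprod as x) = x"
  by (induction as arbitrary: x) auto

lemma rprod_rev' [simp]: "rprod as (rprod (rev as) x) = x"
  using rprod_rev[of "rev as" x] by simp

lemma reflection_rprod: "reflection (rprod as a) = rprod as \<circ> reflection a \<circ> rprod (rev as)"
proof
  fix x
  have "q x (rprod as a) = q (rprod (rev as) x) a"
    using q_rprod[of as "rprod (rev as) x" a] by simp
  then show "reflection (rprod as a) x = (rprod as \<circ> reflection a \<circ> rprod (rev as)) x"
    by (simp add: reflection_def rprod_linear_simps q_rprod)
qed

lemma rprod_map: "rprod (map (rprod cs) as) = rprod cs \<circ> rprod as \<circ> rprod (rev cs)"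
  by (induction as) (auto simp: reflection_rprod fun_eq_iff)

lemma reflection_reflection:
  "reflection (reflection b a) x = reflection b (reflection a (reflection b x))"
  using reflection_rprod[of "[b]" a] by simp

section \<open>Moved and fixed spaces of a product of reflections (Carter)\<close>

lemma rprod_diff_in_span: "rprod as x - x \<in> span (set as)"
proof (induction as)
  case Nil
  then show ?case by (simp add: span_zero)
next
  case (Cons a as)
  let ?y = "rprod as x"
  have "?y - x \<in> span (set (a # as))"
    using Cons span_mono[of "set as" "set (a # as)"] by auto
  moreover have "(2 * q ?y a / q a a) *\<^sub>R a \<in> span (set (a # as))"
    by (intro span_scale span_base) simp
  ultimately have "(?y - x) - (2 * q ?y a / q a a) *\<^sub>R a \<in> span (set (a # as))"
    by (rule span_diff)
  then show ?case by (simp add: reflection_def algebra_simps)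
qed

lemma rprod_span: "x \<in> span (set as) \<Longrightarrow> rprod as x \<in> span (set as)"
  using span_add[OF rprod_diff_in_span[of as x]] by force

lemma rprod_fixes: "(\<And>a. a \<in> set as \<Longrightarrow> q x a = 0) \<Longrightarrow> rprod as x = x"
  by (induction as) (auto simp: reflection_def)

text \<open>Converse of \<open>rprod_diff_in_span\<close> for independent roots. In the induction
  the tail produces \<open>x - c *\<^sub>R a\<close>, and adding a vector orthogonal to the tail
  roots adjusts what the first reflection contributes.\<close>

lemma rprod_surj:
  assumes "indep_list as" "x \<in> span (set as)" "\<And>a. a \<in> set as \<Longrightarrow> q a a \<noteq> 0"
  obtains u where "rprod as u = u + x"
proof -
  have "\<exists>u. rprod as u = u + x" using assms
  proof (induction as arbitrary: x)
    case Nil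
    then show ?case by auto
  next
    case (Cons a as)
    have na: "a \<notin> span (set as)" using indep_list_notin_span[of "[]" a as] Cons by simp
    have ind: "indep_list as" "independent (insert a (set as))"
      using Cons by (auto simp: indep_list_def dest: independent_mono)
    obtain c where c: "x - c *\<^sub>R a \<in> span (set as)"
      using Cons.prems(2) by (auto simp: span_insert)
    obtain u where u: "rprod as u = u + (x - c *\<^sub>R a)"
      using Cons.IH[OF ind(1) c] Cons.prems by auto
    have a0: "q a a \<noteq> 0" using Cons.prems by simp
    \<comment> \<open>Chosen so that the reflection in \<open>a\<close>, applied last, adds exactly
      the missing multiple \<open>c *\<^sub>R a\<close>.\<close>
    let ?t = "- c * q a a / 2 - q (u + (x - c *\<^sub>R a)) a"
    obtain v where v: "\<And>b. b \<in> insert a (set as) \<Longrightarrow> q v b = (if b = a then ?t else 0)"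
      using dual_vector[OF ind(2), of "\<lambda>b. if b = a then ?t else 0"] by metis
    have "rprod as v = v"
      using v na by (intro rprod_fixes) (auto simp: span_base)
    then have r: "rprod as (u + v) = u + v + (x - c *\<^sub>R a)" by (simp add: rprod_linear_simps u)
    have "q (u + v + (x - c *\<^sub>R a)) a = - c * q a a / 2" using v[of a] by simp
    then have "2 * q (u + v + (x - c *\<^sub>R a)) a / q a a = - c" using a0 by simp
    then have "rprod (a # as) (u + v) = (u + v) + x"
      by (simp only: rprod_Cons o_apply r reflection_def) simp
    then show ?case by blast
  qed
  with that show ?thesis by blast
qed

text \<open>The first reflection displaces by a multiple of \<open>b\<close>, the others by an
  element of the span of the tail; by independence both displacements vanish, so the roots can be
  peeled off one at a time.\<close>

lemma rprod_fixed_orth: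
  assumes "indep_list as" "rprod as y = y" "\<And>a. a \<in> set as \<Longrightarrow> q a a \<noteq> 0" "a \<in> set as"
  shows "q y a = 0"
  using assms
proof (induction as)
  case (Cons b as)
  let ?z = "rprod as y" and ?k = "2 * q (rprod as y) b / q b b"
  have nb: "b \<notin> span (set as)" using indep_list_notin_span[of "[]" b as] Cons by simp
  have ind: "indep_list as" using Cons.prems(1) by (auto simp: indep_list_def dest: independent_mono)
  have e: "?z - y = ?k *\<^sub>R b" using Cons.prems(2) by (simp add: reflection_def algebra_simps)
  have "?k = 0"
  proof (rule ccontr)
    assume k: "?k \<noteq> 0"
    have "(1 / ?k) *\<^sub>R (?z - y) \<in> span (set as)" by (intro span_scale rprod_diff_in_span)
    then show False using k nb unfolding e by simp
  qed
  then have z: "?z = y" "q y b = 0" using e Cons.prems(3)[of b] by auto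
  with Cons.IH[OF ind] Cons.prems show ?case by auto
qed simp

text \<open>Every root of an independent factorization is a displacement of the product, and
  displacements lie in the span of the roots of any other factorization.\<close>

lemma rprod_eq_span:
  assumes "indep_list as" "rprod as = rprod bs" "\<And>a. a \<in> set as \<Longrightarrow> q a a \<noteq> 0"
  shows "set as \<subseteq> span (set bs)"
proof
  fix x assume "x \<in> set as"
  then obtain u where "rprod as u = u + x"
    using rprod_surj[OF assms(1) span_base assms(3)] by blast
  then show "x \<in> span (set bs)" using rprod_diff_in_span[of bs u] assms(2) by simp
qed

text \<open>Replacing a root by its negative does not change the reflection, hence the rule \<open>neg\<close>.\<close>

inductive hurwitz_equiv :: "'e list \<Rightarrow> 'e list \<Rightarrow> bool" where
  refl: "hurwitz_equiv as as"
| sym: "hurwitz_equiv as bs \<Longrightarrow> hurwitz_equiv bs as"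
| trans: "hurwitz_equiv as bs \<Longrightarrow> hurwitz_equiv bs cs \<Longrightarrow> hurwitz_equiv as cs"
| move: "hurwitz_equiv (xs @ a # b # ys) (xs @ reflection a b # a # ys)"
| neg: "hurwitz_equiv (xs @ a # ys) (xs @ (- a) # ys)"

section \<open>Hurwitz equivalence: invariants and conjugation by the product\<close>

lemma hurwitz_equiv_context:
  "hurwitz_equiv as bs \<Longrightarrow> hurwitz_equiv (xs @ as @ ys) (xs @ bs @ ys)"
proof (induction rule: hurwitz_equiv.induct)
  case (move us a b vs)
  then show ?case using hurwitz_equiv.move[of "xs @ us" a b "vs @ ys"] by simp
next
  case (neg us a vs)
  then show ?case using hurwitz_equiv.neg[of "xs @ us" a "vs @ ys"] by simp
qed (auto intro: hurwitz_equiv.intros)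

lemma hurwitz_equiv_length: "hurwitz_equiv as bs \<Longrightarrow> length as = length bs"
  by (induction rule: hurwitz_equiv.induct) auto

lemma hurwitz_equiv_rprod: "hurwitz_equiv as bs \<Longrightarrow> rprod as = rprod bs"
  by (induction rule: hurwitz_equiv.induct) (auto simp: fun_eq_iff reflection_reflection)

lemma hurwitz_equiv_closed:
  assumes "hurwitz_equiv as bs" "\<And>a. a \<in> Ps \<Longrightarrow> - a \<in> Ps"
    "\<And>a b. a \<in> Ps \<Longrightarrow> b \<in> Ps \<Longrightarrow> reflection a b \<in> Ps"
  shows "set as \<subseteq> Ps \<longleftrightarrow> set bs \<subseteq> Ps"
  using assms(1)
proof (induction rule: hurwitz_equiv.induct)
  case (move xs a b ys)
  then show ?case using assms(3)[of a b] assms(3)[of a "reflection a b"] by auto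
next
  case (neg xs a ys)
  then show ?case using assms(2)[of a] assms(2)[of "- a"] by auto
qed auto

lemma hurwitz_equiv_move_inv: "hurwitz_equiv (xs @ a # b # ys) (xs @ b # reflection b a # ys)"
  using hurwitz_equiv.sym[OF hurwitz_equiv.move[of xs b "reflection b a" ys]] by simp

lemma hurwitz_equiv_to_end:
  "hurwitz_equiv (xs @ a # ys) (xs @ ys @ [rprod (rev ys) a])"
proof (induction ys arbitrary: xs a)
  case (Cons y ys)
  have "hurwitz_equiv (xs @ a # y # ys) ((xs @ [y]) @ reflection y a # ys)"
    using hurwitz_equiv_move_inv[of xs a y ys] by simp
  from hurwitz_equiv.trans[OF this Cons.IH] show ?case by simp
qed (simp add: hurwitz_equiv.refl)

lemma hurwitz_equiv_to_front:
  "hurwitz_equiv (xs @ a # ys) (rprod xs a # xs @ ys)"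
proof (induction xs arbitrary: a ys rule: rev_induct)
  case (snoc x xs)
  have "hurwitz_equiv ((xs @ [x]) @ a # ys) (xs @ reflection x a # x # ys)"
    using hurwitz_equiv.move[of xs x a ys] by simp
  from hurwitz_equiv.trans[OF this snoc.IH] show ?case by simp
qed (simp add: hurwitz_equiv.refl)

lemma hurwitz_equiv_neg_last: "hurwitz_equiv (xs @ [a]) (xs @ [- a])"
  using hurwitz_equiv.neg[of xs a "[]"] by simp

text \<open>The letters of \<open>ys\<close> are brought to the front, the last one first. Letter
  \<open>y\<close> arrives as \<open>rprod (xs @ ys) y\<close>, which is minus its image under the
  whole product since the reflection in \<open>y\<close> negates \<open>y\<close>;
  \<open>neg\<close> absorbs the sign. For isotropic \<open>y\<close> the two images agree.\<close>

lemma hurwitz_equiv_rotate: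
  "hurwitz_equiv (xs @ ys) (map (rprod (xs @ ys)) ys @ xs)"
proof (induction ys arbitrary: xs rule: rev_induct)
  case (snoc y ys)
  let ?w = "rprod (xs @ ys @ [y])"
  have w: "rprod (?w y # xs @ ys) = ?w"
    by (cases "q y y = 0") (auto simp: reflection_rprod fun_eq_iff reflection_null reflection_self
        rprod_linear_simps)
  have "hurwitz_equiv (xs @ ys @ [y]) (rprod (xs @ ys) y # xs @ ys)"
    using hurwitz_equiv_to_front[of "xs @ ys" y "[]"] by simp
  moreover have "hurwitz_equiv (rprod (xs @ ys) y # xs @ ys) (?w y # xs @ ys)"
    using hurwitz_equiv.neg[of "[]" "rprod (xs @ ys) y" "xs @ ys"]
    by (cases "q y y = 0")
      (auto simp: reflection_null reflection_self rprod_linear_simps hurwitz_equiv.refl)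
  moreover have "hurwitz_equiv (?w y # xs @ ys) (map ?w ys @ ?w y # xs)"
    using snoc.IH[of "?w y # xs"] by (simp only: append_Cons w)
  ultimately have "hurwitz_equiv (xs @ ys @ [y]) (map ?w ys @ ?w y # xs)"
    by (blast intro: hurwitz_equiv.trans)
  then show ?case by (simp add: o_def)
qed (simp add: hurwitz_equiv.refl)

text \<open>Rotating the complete list once is the action of the full twist of the braid
  group.\<close>

lemma hurwitz_equiv_conj: "hurwitz_equiv as (map (rprod as) as)"
  using hurwitz_equiv_rotate[of "[]" as] by simp

lemma hurwitz_equiv_conj_inv: "hurwitz_equiv as (map (rprod (rev as)) as)"
proof -
  let ?bs = "map (rprod (rev as)) as"
  have "rprod ?bs = rprod as" by (simp add: rprod_map fun_eq_iff)
  then have "map (rprod ?bs) ?bs = as" by (simp add: o_def)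
  with hurwitz_equiv_conj[of ?bs] show ?thesis by (simp add: hurwitz_equiv.sym)
qed

lemma hurwitz_equiv_conj_power:
  assumes "hurwitz_equiv as bs"
  shows "hurwitz_equiv as (map ((rprod as) ^^ n) bs)" "hurwitz_equiv as (map ((rprod (rev as)) ^^ n) bs)"
proof -
  have r: "rprod (rev cs) = rprod (rev as)" if "hurwitz_equiv as cs" for cs
  proof
    fix x
    have "rprod cs (rprod (rev as) x) = x"
      using hurwitz_equiv_rprod[OF that] by (metis rprod_rev')
    then show "rprod (rev cs) x = rprod (rev as) x" by (metis rprod_rev)
  qed
  have "hurwitz_equiv as (map ((rprod as) ^^ n) bs) \<and> hurwitz_equiv as (map ((rprod (rev as)) ^^ n) bs)"
  proof (induction n)
    case 0
    then show ?case using assms by simp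
  next
    case (Suc n)
    let ?c = "map ((rprod as) ^^ n) bs" and ?d = "map ((rprod (rev as)) ^^ n) bs"
    have "hurwitz_equiv ?c (map (rprod as) ?c)"
      using hurwitz_equiv_conj[of ?c] hurwitz_equiv_rprod[of as ?c] Suc by simp
    moreover have "hurwitz_equiv ?d (map (rprod (rev as)) ?d)"
      using hurwitz_equiv_conj_inv[of ?d] r[of ?d] Suc by simp
    ultimately have "hurwitz_equiv as (map (rprod as) ?c)" "hurwitz_equiv as (map (rprod (rev as)) ?d)"
      using Suc by (blast intro: hurwitz_equiv.trans)+
    then show ?case by (simp add: o_def)
  qed
  then show "hurwitz_equiv as (map ((rprod as) ^^ n) bs)"
    "hurwitz_equiv as (map ((rprod (rev as)) ^^ n) bs)" by auto
qed

lemma hurwitz_equiv_span: "hurwitz_equiv as bs \<Longrightarrow> span (set as) = span (set bs)"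
proof (induction rule: hurwitz_equiv.induct)
  case (move xs a b ys)
  let ?A = "set (xs @ a # b # ys)" and ?B = "set (xs @ reflection a b # a # ys)"
  have r: "reflection a c \<in> span A" if "a \<in> span A" "c \<in> span A" for c A
    using that by (simp add: reflection_def span_diff span_scale)
  have "reflection a b \<in> span ?A" by (rule r) (auto intro: span_base)
  then have "?B \<subseteq> span ?A" by (auto intro: span_base)
  moreover have "reflection a (reflection a b) \<in> span ?B" by (rule r) (auto intro: span_base)
  then have "?A \<subseteq> span ?B" by (auto intro: span_base)
  ultimately show ?case by (metis span_mono span_span subset_antisym)
next
  case (neg xs a ys)
  let ?A = "set (xs @ a # ys)" and ?B = "set (xs @ - a # ys)"
  have "- a \<in> span ?A" by (intro span_neg span_base) simp
  then have "?B \<subseteq> span ?A" by (auto intro: span_base)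
  moreover have "- (- a) \<in> span ?B" by (intro span_neg span_base) simp
  then have "?A \<subseteq> span ?B" by (auto intro: span_base)
  ultimately show ?case by (metis span_mono span_span subset_antisym)
qed auto

text \<open>Reflections being involutions, prefixing generators already yields a group, and proofs
  become inductions on words.\<close>

inductive_set reflection_group :: "'e set \<Rightarrow> ('e \<Rightarrow> 'e) set" for A where
  id: "id \<in> reflection_group A"
| reflection: "a \<in> A \<Longrightarrow> g \<in> reflection_group A \<Longrightarrow> reflection a \<circ> g \<in> reflection_group A"

lemma reflection_in_group: "a \<in> A \<Longrightarrow> reflection a \<in> reflection_group A"
  using reflection_group.reflection[OF _ reflection_group.id, of a A] by simp

lemma reflection_group_comp:
  "g \<in> reflection_group A \<Longrightarrow> h \<in> reflection_group A \<Longrightarrow> g \<circ> h \<in> reflection_group A"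
  by (induction rule: reflection_group.induct) (auto simp: o_assoc[symmetric] intro: reflection_group.intros)

lemma reflection_group_le:
  assumes "g \<in> reflection_group A" "\<And>a. a \<in> A \<Longrightarrow> reflection a \<in> reflection_group B"
  shows "g \<in> reflection_group B"
  using assms(1)
proof induction
  case id
  show ?case by (rule reflection_group.id)
next
  case (reflection a g)
  then show ?case by (intro reflection_group_comp assms(2))
qed

lemma rprod_in_group: "set as \<subseteq> A \<Longrightarrow> rprod as \<in> reflection_group A"
  by (induction as) (auto intro: reflection_group.intros)

lemma reflection_group_hurwitz:
  "hurwitz_equiv as bs \<Longrightarrow> reflection_group (set as) = reflection_group (set bs)"
proof (induction rule: hurwitz_equiv.induct)
  case (move xs a b ys)
  let ?A = "set (xs @ a # b # ys)" and ?B = "set (xs @ reflection a b # a # ys)"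
  have e: "reflection (reflection a c) = reflection a \<circ> (reflection c \<circ> reflection a)" for c
    by (auto simp: fun_eq_iff reflection_reflection)
  have "reflection (reflection a b) \<in> reflection_group ?A"
    unfolding e by (intro reflection_group_comp reflection_in_group) auto
  then have "reflection c \<in> reflection_group ?A" if "c \<in> ?B" for c
    using that by (auto intro: reflection_in_group)
  moreover have "reflection (reflection a (reflection a b)) \<in> reflection_group ?B"
    unfolding e[of "reflection a b"] by (intro reflection_group_comp reflection_in_group) auto
  then have "reflection c \<in> reflection_group ?B" if "c \<in> ?A" for c
    using that by (auto intro: reflection_in_group)
  ultimately show ?case by (blast intro: reflection_group_le)
next
  case (neg xs a ys)
  let ?A = "set (xs @ a # ys)" and ?B = "set (xs @ - a # ys)"
  have "reflection (- a) \<in> reflection_group ?A" "reflection a \<in> reflection_group ?B"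
    using reflection_in_group[of a ?A] reflection_in_group[of "- a" ?B] by auto
  then have "reflection c \<in> reflection_group ?A" if "c \<in> ?B" for c
    using that by (auto intro: reflection_in_group)
  moreover have "reflection c \<in> reflection_group ?B" if "c \<in> ?A" for c
    using that \<open>reflection a \<in> reflection_group ?B\<close> by (auto intro: reflection_in_group)
  ultimately show ?case by (blast intro: reflection_group_le)
qed auto

end

section \<open>Transitivity for one component\<close>

text \<open>Here \<open>d\<close> stands for the coefficient of a root and \<rho> for a ratio of
  squared lengths. With e = 2d the second condition reads \<rho> e^2 = 4k; by prime factors, e is
  divisible by 2, by 4 if \<rho> = 1/2, and by 6 if \<rho> = 1/3.\<close>

lemma halves_square_Ints:
  fixes d \<rho> :: real
  assumes d: "2 * d \<in> \<int>" "\<rho> * d\<^sup>2 \<in> \<int>" and \<rho>: "\<rho> \<in> {1, 2, 3, 1/2, 1/3}"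
  shows "(if \<rho> \<ge> 1 then 1 else \<rho>) * d \<in> \<int>"
proof -
  obtain e where e: "2 * d = of_int e" using d(1) by (auto elim: Ints_cases)
  obtain k where k: "\<rho> * d\<^sup>2 = of_int k" using d(2) by (auto elim: Ints_cases)
  have d': "d = of_int e / 2" using e by simp
  have k': "\<rho> * (of_int e)\<^sup>2 = 4 * real_of_int k" using k by (simp add: d' power2_eq_square)
  have I: "real_of_int e / of_int c \<in> \<int>" if "c dvd e" for c
    using that by (simp add: of_int_divide_in_Ints)
  have ev: "even e" if "even (e * e * c)" "odd c" for c using that by auto
  consider "\<rho> = 1" | "\<rho> = 2" | "\<rho> = 3" | "\<rho> = 1/2" | "\<rho> = 1/3" using \<rho> by auto
  then show ?thesis
  proof cases
    case 1
    then have "e * e = 4 * k" using k' by (simp add: power2_eq_square flip: of_int_mult of_int_eq_iff)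
    then have "2 dvd e" using ev[of 1] by simp
    then show ?thesis using I[of 2] 1 by (simp add: d')
  next
    case 2
    then have "real_of_int (2 * (e * e)) = real_of_int (4 * k)" using k' by (simp add: power2_eq_square)
    then have "2 * (e * e) = 4 * k" by linarith
    then have "e * e = 2 * k" by linarith
    then have "2 dvd e" using ev[of 1] by simp
    then show ?thesis using I[of 2] 2 by (simp add: d')
  next
    case 3
    then have "real_of_int (3 * (e * e)) = real_of_int (4 * k)" using k' by (simp add: power2_eq_square)
    then have "e * e * 3 = 4 * k" by linarith
    then have "2 dvd e" using ev[of 3] by simp
    then show ?thesis using I[of 2] 3 by (simp add: d')
  next
    case 4
    have "real_of_int (e * e) = real_of_int (8 * k)"
      using k' unfolding 4 by (simp add: power2_eq_square)
    then have a: "e * e = 8 * k" by linarith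
    then have "2 dvd e" using ev[of 1] by simp
    then obtain f where f: "e = 2 * f" by (rule dvdE)
    then have "f * f = 2 * k" using a by simp
    then have "even f" by (metis dvd_triv_left even_mult_iff)
    then have "4 dvd e" using f by auto
    then show ?thesis using I[of 4] unfolding 4 d' by simp
  next
    case 5
    have "real_of_int (e * e) = real_of_int (12 * k)"
      using k' unfolding 5 by (simp add: power2_eq_square)
    then have a: "e * e = 12 * k" by linarith
    then have "2 dvd e" using ev[of 1] by simp
    moreover have "3 dvd e * e" using a by simp
    then have "3 dvd e" using prime_dvd_mult_iff[of "3::int"] by simp
    ultimately have "6 dvd e" by presburger
    then show ?thesis using I[of 6] unfolding 5 d' by simp
  qed
qed

text \<open>Otherwise negative values would persist from \<open>i\<close> to \<open>k\<close>. The
  alternative of jumping over zero is treated geometrically in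
  \<open>orbit_crossing_aux\<close>.\<close>

lemma int_sequence_crossing:
  fixes F :: "nat \<Rightarrow> int"
  assumes "i \<le> k" "F i \<le> 0" "0 \<le> F k"
  shows "\<exists>j. F j = 0 \<or> F j < 0 \<and> 0 < F (Suc j)"
proof (rule ccontr)
  assume n: "\<not> ?thesis"
  have "F (i + m) < 0" for m
  proof (induction m)
    case 0
    then show ?case using assms(2) n by (metis add_0_right order_le_less)
  next
    case (Suc m)
    then show ?case using n by (metis add_Suc_right linorder_neqE_linordered_idom)
  qed
  from this[of "k - i"] assms show False by simp
qed

lemma sum_zero_signs:
  fixes f :: "nat \<Rightarrow> real"
  assumes "(\<Sum>l<N. f l) = 0" "0 < N"
  obtains i k where "f i \<le> 0" "0 \<le> f k"
proof -
  have "\<exists>i. f i \<le> 0"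
  proof (rule ccontr)
    assume "\<not> ?thesis"
    then have "0 < (\<Sum>l<N. f l)" using assms(2) by (intro sum_pos) (auto simp: not_le)
    with assms show False by simp
  qed
  moreover have "\<exists>k. 0 \<le> f k"
  proof (rule ccontr)
    assume "\<not> ?thesis"
    then have "0 < (\<Sum>l<N. - f l)" using assms(2) by (intro sum_pos) (auto simp: not_le)
    with assms show False by (simp add: sum_negf)
  qed
  ultimately show thesis using that by blast
qed

text \<open>Axioms for the affine roots of one component. \<open>root_reduced\<close> concerns
  equality in Cauchy-Schwarz, that is, roots proportional modulo \<delta>;
  \<open>finite_mod_delta\<close> makes orbits periodic modulo \<delta>.\<close>

locale affine_root_space = form_space q for q :: "'e::euclidean_space \<Rightarrow> 'e \<Rightarrow> real" +
  fixes R :: "'e set" and \<delta> :: 'e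
  assumes root_pos: "a \<in> R \<Longrightarrow> 0 < q a a"
    and root_closed: "a \<in> R \<Longrightarrow> b \<in> R \<Longrightarrow> reflection a b \<in> R"
    and root_integral: "a \<in> R \<Longrightarrow> b \<in> R \<Longrightarrow> 2 * q b a / q a a \<in> \<int>"
    and root_reduced: "a \<in> R \<Longrightarrow> b \<in> R \<Longrightarrow> (q a b)\<^sup>2 = q a a * q b b \<Longrightarrow> q a a = q b b"
    and semidefinite: "x \<in> span R \<Longrightarrow> 0 \<le> q x x"
    and radical: "x \<in> span R \<Longrightarrow> q x x = 0 \<Longrightarrow> \<exists>c. x = c *\<^sub>R \<delta>"
    and delta_orth: "x \<in> span R \<Longrightarrow> q \<delta> x = 0"
    and delta_nonzero: "\<delta> \<noteq> 0"
    and finite_mod_delta: "\<exists>F. finite F \<and> (\<forall>a\<in>R. \<exists>b\<in>F. \<exists>c. a = b + c *\<^sub>R \<delta>)"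
begin

lemma root_uminus: "a \<in> R \<Longrightarrow> - a \<in> R"
  using root_closed[of a a] root_pos[of a] by (simp add: reflection_self)

lemma hurwitz_equiv_roots: "hurwitz_equiv as bs \<Longrightarrow> set as \<subseteq> R \<longleftrightarrow> set bs \<subseteq> R"
  by (rule hurwitz_equiv_closed) (auto intro: root_uminus root_closed)

lemma rprod_root: "set as \<subseteq> R \<Longrightarrow> r \<in> R \<Longrightarrow> rprod as r \<in> R"
  by (induction as) (auto intro: root_closed)

lemma cauchy_schwarz:
  assumes "a \<in> R" "b \<in> R"
  shows "(q a b)\<^sup>2 \<le> q a a * q b b"
proof -
  have "a - (q a b / q b b) *\<^sub>R b \<in> span R" using assms by (intro span_diff span_scale span_base)
  from semidefinite[OF this] have "0 \<le> q a a - (q a b)\<^sup>2 / q b b"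
    using root_pos[OF assms(2)] by (simp add: q_sym[of b a] power2_eq_square field_simps)
  then show ?thesis using root_pos[OF assms(2)] by (simp add: field_simps)
qed

text \<open>The Cartan integers m, n satisfy m n q(a,a) q(r,r) = 4 q(r,a)^2, so m n is one of 1, 2,
  3, 4 by Cauchy-Schwarz, and the ratio is n / m.\<close>

lemma root_length_ratio:
  assumes a: "a \<in> R" and r: "r \<in> R" and ne: "q r a \<noteq> 0"
  shows "q a a / q r r \<in> {1, 2, 3, 1/2, 1/3}"
proof -
  have p: "0 < q a a" "0 < q r r" using a r root_pos by auto
  obtain m where m: "2 * q r a / q a a = of_int m" using root_integral[OF a r] by (auto elim: Ints_cases)
  obtain n where n: "2 * q r a / q r r = of_int n"
    using root_integral[OF r a] by (auto elim: Ints_cases simp: q_sym[of a r])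
  have mn: "real_of_int m * q a a = 2 * q r a" "real_of_int n * q r r = 2 * q r a"
    using p by (simp_all flip: m n)
  have "real_of_int (m * n) * (q a a * q r r) = 4 * (q r a)\<^sup>2"
    using mn by (simp add: power2_eq_square algebra_simps)
  moreover have "0 < (q r a)\<^sup>2" using ne by simp
  moreover have cs: "(q r a)\<^sup>2 \<le> q a a * q r r" using cauchy_schwarz[OF a r] by (simp add: q_sym[of a r])
  ultimately have l: "0 < real_of_int (m * n) * (q a a * q r r)"
    "real_of_int (m * n) * (q a a * q r r) \<le> 4 * (q a a * q r r)" by auto
  have Q: "0 < q a a * q r r" using p by simp
  have "0 < real_of_int (m * n)" using l(1) Q by (rule zero_less_mult_pos2)
  moreover have "real_of_int (m * n) \<le> real_of_int 4"
    using mult_right_le_imp_le[OF l(2) Q] by simp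
  ultimately have mn': "0 < m * n" "m * n \<le> 4" by (simp_all only: of_int_0_less_iff of_int_le_iff)
  have ratio: "q a a / q r r = of_int n / of_int m"
  proof -
    have "m \<noteq> 0" using mn' by auto
    moreover have "q a a * real_of_int m = real_of_int n * q r r" using mn by (simp add: mult.commute)
    ultimately show ?thesis using p by (simp add: frac_eq_eq)
  qed
  show ?thesis
  \<comment> \<open>This is equality in Cauchy-Schwarz; \<open>root_reduced\<close> excludes the
    ratios 4 and 1/4.\<close>
  proof (cases "m * n = 4")
    case True
    then have "(q a r)\<^sup>2 = q a a * q r r"
      using \<open>real_of_int (m * n) * (q a a * q r r) = 4 * (q r a)\<^sup>2\<close> by (simp add: q_sym[of a r])
    from root_reduced[OF a r this] p show ?thesis by simp
  next
    case False
    then have "m * n \<in> {1, 2, 3}" using mn' by auto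
    moreover have "m * n \<noteq> 0" using mn'(1) by (metis less_irrefl)
    then have "\<bar>m\<bar> \<le> \<bar>m * n\<bar>" "\<bar>n\<bar> \<le> \<bar>m * n\<bar>"
      by (rule dvd_imp_le_int; simp)+
    ultimately have "m \<in> {-3..3}" "n \<in> {-3..3}" by auto
    then have "m \<in> {-3,-2,-1,0,1,2,3}" "n \<in> {-3,-2,-1,0,1,2,3}" by auto
    then have "m = n \<or> n = 2 * m \<or> m = 2 * n \<or> n = 3 * m \<or> m = 3 * n"
      using \<open>m * n \<in> {1, 2, 3}\<close> by (elim insertE emptyE; simp)
    moreover have "real_of_int m \<noteq> 0" "real_of_int n \<noteq> 0" using \<open>m * n \<noteq> 0\<close> by auto
    ultimately show ?thesis unfolding ratio by (elim disjE) simp_all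
  qed
qed

section \<open>Root lattices and integrality of coefficients\<close>

inductive_set root_lattice :: "'e set \<Rightarrow> 'e set" for A where
  zero: "0 \<in> root_lattice A"
| add: "x \<in> root_lattice A \<Longrightarrow> a \<in> A \<Longrightarrow> x + a \<in> root_lattice A"
| diff: "x \<in> root_lattice A \<Longrightarrow> a \<in> A \<Longrightarrow> x - a \<in> root_lattice A"

lemma lattice_diff_multiple:
  assumes "x \<in> root_lattice A" "a \<in> A" "c \<in> \<int>"
  shows "x - c *\<^sub>R a \<in> root_lattice A"
proof -
  obtain k where k: "c = of_int k" using assms(3) by (auto elim: Ints_cases)
  have "x - of_int k *\<^sub>R a \<in> root_lattice A"
  proof (induction k rule: int_induct[where k = 0])
    case (step1 i)
    from root_lattice.diff[OF step1(2) assms(2)] show ?case by (simp add: algebra_simps)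
  next
    case (step2 i)
    from root_lattice.add[OF step2(2) assms(2)] show ?case by (simp add: algebra_simps)
  qed (simp add: assms)
  then show ?thesis by (simp add: k)
qed

lemma lattice_functional:
  "x \<in> root_lattice A \<Longrightarrow> (\<And>a. a \<in> A \<Longrightarrow> q u a \<in> \<int>) \<Longrightarrow> q u x \<in> \<int>"
  by (induction rule: root_lattice.induct) auto

text \<open>\<open>x\<close> itself may lie outside the lattice: since it pairs integrally with the
  coroots of \<open>A\<close>, every generator shifts the current image by an integral multiple of
  its root.\<close>

lemma reflection_group_lattice:
  assumes "g \<in> reflection_group A" "A \<subseteq> R" "\<And>b. b \<in> A \<Longrightarrow> 2 * q x b / q b b \<in> \<int>"
  shows "g x - x \<in> root_lattice A"
  using assms(1)
proof induction
  case id
  show ?case by (simp add: root_lattice.zero)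
next
  case (reflection a g)
  let ?y = "g x - x"
  have Q: "q ((2 / q a a) *\<^sub>R a) b \<in> \<int>" if "b \<in> A" for b
    using root_integral[of a b] that assms(2) reflection(1) by (auto simp: q_sym[of a b])
  have "q ((2 / q a a) *\<^sub>R a) ?y \<in> \<int>" by (rule lattice_functional[OF reflection(3) Q])
  moreover have "q ((2 / q a a) *\<^sub>R a) ?y = 2 * q ?y a / q a a"
    by (simp only: q_sym[of _ ?y]) simp
  ultimately have "2 * q ?y a / q a a \<in> \<int>" by simp
  moreover have "2 * q x a / q a a \<in> \<int>" using reflection assms(3) by auto
  ultimately have "2 * q ?y a / q a a + 2 * q x a / q a a \<in> \<int>" by (rule Ints_add)
  then have "2 * q (g x) a / q a a \<in> \<int>" by (simp add: diff_divide_distrib algebra_simps)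
  from lattice_diff_multiple[OF reflection(3,1) this] show ?case
    by (simp add: reflection_def algebra_simps)
qed

text \<open>Substitute for a simple system: it is inherited along Hurwitz moves
  (\<open>generating_basis_hurwitz\<close>), which simple systems in general are not.\<close>

definition generating_basis :: "'e list \<Rightarrow> bool" where
  "generating_basis cs \<longleftrightarrow> set cs \<subseteq> R \<and> indep_list cs \<and> (\<forall>r\<in>R. reflection r \<in> reflection_group (set cs))"

text \<open>The reflection in \<open>r\<close> displaces two test vectors, \<open>r\<close> itself
  and a multiple of \<open>u\<close>, by lattice elements, on which \<open>u\<close> is
  integral.\<close>

lemma generating_basis_coefficient:
  assumes cs: "generating_basis cs" "a \<in> set cs" and r: "r \<in> R"
    and u: "\<And>b. b \<in> set cs \<Longrightarrow> q u b = (if b = a then 1 else 0)"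
  shows "2 * q u r \<in> \<int>" "q a a / q r r * (q u r)\<^sup>2 \<in> \<int>"
proof -
  have R: "set cs \<subseteq> R" and g: "reflection r \<in> reflection_group (set cs)"
    using cs r by (auto simp: generating_basis_def)
  have p: "0 < q r r" "0 < q a a" using r root_pos R cs by auto
  have I: "q u y \<in> \<int>" if "y \<in> root_lattice (set cs)" for y
    using that u by (intro lattice_functional[OF that]) auto
  have "reflection r r - r \<in> root_lattice (set cs)"
    using root_integral r R by (intro reflection_group_lattice[OF g R]) auto
  from I[OF this] have "- (2 * q u r) \<in> \<int>" using p by (simp add: reflection_self)
  then show "2 * q u r \<in> \<int>" by (metis Ints_minus minus_minus)
  \<comment> \<open>A fundamental weight: it pairs to 1 with the coroot of \<open>a\<close> and to 0
    with those of the other basis roots.\<close>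
  let ?x = "(q a a / 2) *\<^sub>R u"
  have "reflection r ?x - ?x \<in> root_lattice (set cs)"
    using u p by (intro reflection_group_lattice[OF g R]) auto
  from I[OF this] have "- (q a a / q r r * (q u r)\<^sup>2) \<in> \<int>"
    by (simp add: reflection_def power2_eq_square mult.assoc)
  then show "q a a / q r r * (q u r)\<^sup>2 \<in> \<int>" by (metis Ints_minus minus_minus)
qed

section \<open>The orbit of a root under the product\<close>

lemma root_nonzero: "a \<in> R \<Longrightarrow> q a a \<noteq> 0"
  using root_pos[of a] by simp

lemma power_root:
  assumes "set as \<subseteq> R" "r \<in> R"
  shows "((rprod as) ^^ j) r \<in> R"
  using assms by (induction j) (auto intro: rprod_root)

lemma power_span:
  assumes "x \<in> span (set as)"
  shows "((rprod as) ^^ j) x \<in> span (set as)"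
  using assms by (induction j) (auto intro: rprod_span)

lemma q_power: "q (((rprod as) ^^ j) x) (((rprod as) ^^ j) y) = q x y"
  by (induction j) (auto simp: q_rprod)

lemma rprod_delta: "set as \<subseteq> R \<Longrightarrow> rprod as \<delta> = \<delta>"
  by (rule rprod_fixes) (auto intro!: delta_orth span_base)

lemma linear_power: "linear ((rprod as) ^^ j)"
  by (induction j) (simp_all only: funpow.simps linear_id linear_compose linear_rprod)

lemmas power_linear_simps =
  linear_add[OF linear_power] linear_diff[OF linear_power] linear_scale[OF linear_power]
  linear_neg[OF linear_power]

lemma power_delta: "set as \<subseteq> R \<Longrightarrow> ((rprod as) ^^ j) \<delta> = \<delta>"
  by (induction j) (auto simp: rprod_delta)

lemma power_inverse:
  "((rprod as) ^^ j) (((rprod (rev as)) ^^ j) x) = x"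
  "((rprod (rev as)) ^^ j) (((rprod as) ^^ j) x) = x"
  by (induction j arbitrary: x) (auto simp: funpow_swap1)

text \<open>The coefficient of \<open>a\<close> along the orbit of \<open>r\<close> under the product \<open>w\<close> changes by
  \<open>2 q(w\<^sup>j r, a) / q(a, a)\<close> in each step. Up to a scaling it is an integer changing by at most one,
  unless \<open>w\<^sup>j r\<close> is \<open>\<plusminus>a\<close> modulo \<open>\<delta>\<close>; so it cannot change its sign without vanishing.\<close>

lemma orbit_crossing_aux:
  assumes C: "generating_basis (as @ a # cs)" and r: "r \<in> R" "r \<in> span (set (as @ [a]))"
    and u: "\<And>b. b \<in> set (as @ a # cs) \<Longrightarrow> q u b = (if b = a then 1 else 0)"
    and \<delta>: "\<delta> \<notin> span (set (as @ [a])) \<or> q u \<delta> \<noteq> 0"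
    and ik: "i \<le> k" "q u (((rprod (as @ [a])) ^^ i) r) \<le> 0" "0 \<le> q u (((rprod (as @ [a])) ^^ k) r)"
  shows "\<exists>j. ((rprod (as @ [a])) ^^ j) r \<in> span (set as) \<union> {a, - a}"
proof -
  define w where "w = rprod (as @ [a])"
  define y where "y = (\<lambda>j. (w ^^ j) r)"
  have R: "set (as @ [a]) \<subseteq> R" "a \<in> R" using C by (auto simp: generating_basis_def)
  have yR: "y j \<in> R" for j unfolding y_def w_def using R(1) r(1) by (rule power_root)
  have ysp: "y j \<in> span (set (as @ [a]))" for j unfolding y_def w_def using r(2) by (rule power_span)
  have qy: "q (y j) (y j) = q r r" for j unfolding y_def w_def by (rule q_power)
  have p: "0 < q a a" "0 < q r r" using R r root_pos by auto
  have na: "a \<notin> set as" using C by (auto simp: generating_basis_def indep_list_def)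
  have "q u b = 0" if "b \<in> set as" for b using u[of b] that na by auto
  then have uas: "q u x = 0" if "x \<in> span (set as)" for x using orth_span[OF that] by blast
  have ua: "q u a = 1" using u[of a] by simp
  have zero: "x \<in> span (set as)" if x: "x \<in> span (set (as @ [a]))" "q u x = 0" for x
  proof -
    obtain c where c: "x - c *\<^sub>R a \<in> span (set as)" using x(1) by (auto simp: span_insert)
    with uas[OF c] x(2) ua show ?thesis by simp
  qed
  \<comment> \<open>The reflections in \<open>as\<close> add elements of their span, where
    \<open>u\<close> vanishes; only the reflection in \<open>a\<close> is visible to
    \<open>u\<close>.\<close>
  have step: "q u (y (Suc j)) = q u (y j) - 2 * q (y j) a / q a a" for j
  proof -
    have "q u (w x) = q u (reflection a x)" for x
      using uas[OF rprod_diff_in_span[of as "reflection a x"]] by (simp add: w_def)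
    then show ?thesis by (simp add: y_def reflection_def ua)
  qed
  have "\<exists>j. y j \<in> span (set as) \<union> {a, - a}"
  proof (cases "\<exists>l. q (y l) a \<noteq> 0")
    case False
    then have const: "q u (y j) = q u (y 0)" for j by (induction j) (auto simp: step)
    then have "q u (y i) = 0" using ik const[of i] const[of k] by (simp add: y_def w_def)
    then show ?thesis using zero[OF ysp] by blast
  next
    case True
    then obtain l where l: "q (y l) a \<noteq> 0" by blast
    define \<rho> where "\<rho> = q a a / q r r"
    \<comment> \<open>The factor min(1, \<rho>) for which \<open>halves_square_Ints\<close> makes
      the coefficient integral.\<close>
    define \<kappa> where "\<kappa> = (if \<rho> \<ge> 1 then 1 else \<rho>)"
    have \<rho>: "\<rho> \<in> {1, 2, 3, 1/2, 1/3}"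
      using root_length_ratio[OF R(2) yR l] by (simp add: \<rho>_def qy)
    have \<kappa>: "0 < \<kappa>" using \<rho> by (auto simp: \<kappa>_def)
    define F where "F = (\<lambda>j. \<lfloor>\<kappa> * q u (y j)\<rfloor>)"
    have F: "real_of_int (F j) = \<kappa> * q u (y j)" for j
    proof -
      have "\<kappa> * q u (y j) \<in> \<int>"
        unfolding \<kappa>_def using generating_basis_coefficient[OF C _ yR u, of j] \<rho>
        by (intro halves_square_Ints) (auto simp: \<rho>_def qy)
      then show ?thesis unfolding F_def by (auto elim: Ints_cases)
    qed
    have "real_of_int (F i) \<le> 0" "0 \<le> real_of_int (F k)"
      using ik \<kappa> by (auto simp: F y_def w_def mult_le_0_iff)
    then have "F i \<le> 0" "0 \<le> F k" by simp_all
    from int_sequence_crossing[OF ik(1) this]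
    obtain j where j: "F j = 0 \<or> F j < 0 \<and> 0 < F (Suc j)" by blast
    show ?thesis
    proof (cases "F j = 0")
      case True
      then have "q u (y j) = 0" using F[of j] \<kappa> by simp
      then show ?thesis using zero[OF ysp] by blast
    next
      case False
      \<comment> \<open>A jump over zero changes \<open>F\<close> by at least 2. With Cauchy-Schwarz
        this leaves only the case that \<open>r\<close> and \<open>a\<close> have equal length and
        \<open>y j\<close> is \<open>- a\<close> modulo \<delta>.\<close>
      then have neg: "F j \<le> -1" "1 \<le> F (Suc j)" using j by auto
      define x where "x = q (y j) a"
      have fs: "real_of_int (F (Suc j)) = real_of_int (F j) - \<kappa> * (2 * x / q a a)"
        by (simp add: F step x_def algebra_simps)
      then have big: "\<kappa> * (2 * x / q a a) \<le> -2" using neg by linarith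
      have cs: "x\<^sup>2 \<le> q r r * q a a" using cauchy_schwarz[OF yR R(2)] by (simp add: x_def qy)
      have "\<rho> \<ge> 1"
      proof (rule ccontr)
        assume "\<not> \<rho> \<ge> 1"
        then have "\<kappa> = q a a / q r r" and lt: "q a a < q r r" using p by (auto simp: \<kappa>_def \<rho>_def)
        then have "2 * x / q r r \<le> -2" using big p by simp
        then have "x \<le> - q r r" using p by (simp add: field_simps)
        then have "q r r * q r r \<le> x\<^sup>2"
          using p mult_mono[of "q r r" "- x" "q r r" "- x"] by (simp add: power2_eq_square)
        moreover have "q r r * q a a < q r r * q r r" using p lt by simp
        ultimately show False using cs by linarith
      qed
      then have le: "q r r \<le> q a a" and k1: "\<kappa> = 1" using p by (auto simp: \<rho>_def \<kappa>_def field_simps)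
      then have xa: "x \<le> - q a a" using big p by (simp add: field_simps)
      then have "q a a * q a a \<le> x\<^sup>2"
        using p mult_mono[of "q a a" "- x" "q a a" "- x"] by (simp add: power2_eq_square)
      moreover have "q r r * q a a \<le> q a a * q a a" using p le by simp
      ultimately have x2: "x\<^sup>2 = q r r * q a a" "q r r * q a a = q a a * q a a" using cs by linarith+
      then have eq: "q r r = q a a" using p by simp
      have "\<bar>x\<bar> = q a a" using x2 p by (metis abs_of_pos eq power2_eq_square real_sqrt_abs)
      then have x: "x = - q a a" using xa p by linarith
      let ?z = "y j + a"
      have "?z \<in> span R" using yR R(2) by (intro span_add span_base)
      moreover have "q ?z ?z = 0" using x eq by (simp add: qy q_sym[of a "y j"] flip: x_def)
      ultimately obtain c where c: "?z = c *\<^sub>R \<delta>" using radical by blast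
      \<comment> \<open>A jump by exactly 2 starts at -1, so \<open>u\<close> vanishes on
        \<open>?z = c *\<^sub>R \<delta>\<close>; the assumption on \<delta> then gives c =
        0.\<close>
      have "real_of_int (F j) = real_of_int (-1)"
      proof -
        have "real_of_int (F (Suc j)) = real_of_int (F j) + 2" using fs x p k1 by simp
        then show ?thesis using neg by linarith
      qed
      then have "q u ?z = 0" using F[of j] k1 ua by simp
      then have "c * q u \<delta> = 0" unfolding c by simp
      moreover have "c *\<^sub>R \<delta> \<in> span (set (as @ [a]))"
        unfolding c[symmetric] using ysp by (intro span_add) (auto intro: span_base)
      then have "\<delta> \<in> span (set (as @ [a]))" if "c \<noteq> 0"
        using span_scale[of "c *\<^sub>R \<delta>" _ "1 / c"] that by simp
      ultimately have "c = 0" using \<delta> by auto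
      then have "y j = - a" using c by (simp add: eq_neg_iff_add_eq_0)
      then show ?thesis by blast
    qed
  qed
  then show ?thesis by (simp only: y_def w_def)
qed

text \<open>If the nonnegative value comes first, pass to \<open>- r\<close>, which reverses the
  signs along the orbit.\<close>

lemma orbit_crossing:
  assumes C: "generating_basis (as @ a # cs)" and r: "r \<in> R" "r \<in> span (set (as @ [a]))"
    and u: "\<And>b. b \<in> set (as @ a # cs) \<Longrightarrow> q u b = (if b = a then 1 else 0)"
    and \<delta>: "\<delta> \<notin> span (set (as @ [a])) \<or> q u \<delta> \<noteq> 0"
    and ik: "q u (((rprod (as @ [a])) ^^ i) r) \<le> 0" "0 \<le> q u (((rprod (as @ [a])) ^^ k) r)"
  shows "\<exists>j. ((rprod (as @ [a])) ^^ j) r \<in> span (set as) \<union> {a, - a}"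
proof (cases "i \<le> k")
  case True
  from orbit_crossing_aux[OF C r u \<delta> this ik] show ?thesis .
next
  case False
  have "\<exists>j. ((rprod (as @ [a])) ^^ j) (- r) \<in> span (set as) \<union> {a, - a}"
    by (rule orbit_crossing_aux[OF C _ _ u \<delta>, of _ k i])
      (use r ik False in \<open>auto simp: power_linear_simps root_uminus span_neg simp del: rprod_append\<close>)
  then obtain j where "- ((rprod (as @ [a])) ^^ j) r \<in> span (set as) \<union> {a, - a}"
    by (auto simp: power_linear_simps simp del: rprod_append)
  then have "((rprod (as @ [a])) ^^ j) r \<in> span (set as) \<union> {a, - a}"
    using span_neg[of "- ((rprod (as @ [a])) ^^ j) r" "set as"] by (auto simp: minus_equation_iff)
  then show ?thesis by blast
qed

text \<open>Pigeonhole on the finitely many classes of roots modulo \<delta>; as the product fixes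
  \<delta>, a repetition can be shifted back to \<open>r\<close>.\<close>

lemma orbit_period:
  assumes "set as \<subseteq> R" "r \<in> R"
  obtains N c where "0 < N" "((rprod as) ^^ N) r = r + c *\<^sub>R \<delta>"
proof -
  let ?w = "rprod as"
  obtain F where F: "finite F" "\<forall>a\<in>R. \<exists>b\<in>F. \<exists>c. a = b + c *\<^sub>R \<delta>" using finite_mod_delta by blast
  have "\<forall>j. \<exists>b. b \<in> F \<and> (\<exists>c. (?w ^^ j) r = b + c *\<^sub>R \<delta>)"
    using F(2) power_root[OF assms] by blast
  then obtain b where b: "\<And>j. b j \<in> F" "\<And>j. \<exists>c. (?w ^^ j) r = b j + c *\<^sub>R \<delta>" by metis
  have "\<not> inj b" using F(1) b(1) by (meson finite_subset image_subsetI infinite_UNIV_nat range_inj_infinite)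
  then obtain i k where ik: "i < k" "b i = b k" by (metis injI linorder_neqE_nat)
  obtain c c' where c: "(?w ^^ i) r = b i + c *\<^sub>R \<delta>" "(?w ^^ k) r = b i + c' *\<^sub>R \<delta>"
    using b(2)[of i] b(2)[of k] ik by auto
  have "(?w ^^ k) r = (?w ^^ i) ((?w ^^ (k - i)) r)"
    using ik by (metis add_diff_inverse_nat funpow_add less_not_sym o_apply)
  also have "\<dots> = (?w ^^ i) (r + (c' - c) *\<^sub>R \<delta>)"
    unfolding power_linear_simps power_delta[OF assms(1)] using c
    by (metis (no_types, lifting) calculation c(1) diff_add_cancel add.assoc scaleR_left_diff_distrib add.commute)
  finally have "(?w ^^ i) ((?w ^^ (k - i)) r) = (?w ^^ i) (r + (c' - c) *\<^sub>R \<delta>)"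
    using \<open>(?w ^^ k) r = (?w ^^ i) ((?w ^^ (k - i)) r)\<close> by simp
  then have "(?w ^^ (k - i)) r = r + (c' - c) *\<^sub>R \<delta>" by (metis power_inverse(2))
  then show thesis using ik by (intro that[of "k - i" "c' - c"]) simp_all
qed

lemma orbit_sum_fixed:
  "rprod as (\<Sum>l<N. ((rprod as) ^^ l) r) = (\<Sum>l<N. ((rprod as) ^^ l) r) + ((rprod as) ^^ N) r - r"
  by (induction N) (auto simp: rprod_linear_simps)

text \<open>A fixed vector is orthogonal to all the roots, hence, lying in their span,
  isotropic.\<close>

lemma fixed_in_span_radical:
  assumes "indep_list as" "set as \<subseteq> R" "x \<in> span (set as)" "rprod as x = x"
  obtains c where "x = c *\<^sub>R \<delta>"
proof -
  have "q x a = 0" if "a \<in> set as" for a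
    using rprod_fixed_orth[OF assms(1,4) _ that] assms(2) root_nonzero by blast
  then have "q x x = 0" using orth_span[OF assms(3), of x] by simp
  moreover have "x \<in> span R" using assms(2,3) span_mono by blast
  ultimately show thesis using radical that by blast
qed

lemma generating_basis_prefix_indep: "generating_basis (as @ cs) \<Longrightarrow> indep_list as \<and> set as \<subseteq> R"
  using indep_list_prefix[of as cs] by (auto simp: generating_basis_def)

lemma generating_basis_dual:
  assumes "generating_basis cs" "a \<in> set cs"
  obtains u where "\<And>b. b \<in> set cs \<Longrightarrow> q u b = (if b = a then 1 else 0)"
  using dual_vector[of "set cs" "\<lambda>b. if b = a then 1 else 0"] assms
  by (auto simp: generating_basis_def indep_list_def)

text \<open>With \<delta> outside the span the orbit is truly periodic. Its sum over a period is
  fixed by the product, hence zero, so the coefficients at \<open>a\<close> sum to zero and cannot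
  all have one strict sign.\<close>

lemma orbit_meets_prefix_finite:
  assumes C: "generating_basis (as @ a # cs)" and r: "r \<in> R" "r \<in> span (set (as @ [a]))"
    and \<delta>: "\<delta> \<notin> span (set (as @ [a]))"
  shows "\<exists>j. ((rprod (as @ [a])) ^^ j) r \<in> span (set as) \<union> {a, - a}"
proof -
  let ?bs = "as @ [a]"
  let ?w = "rprod ?bs"
  have I: "indep_list ?bs" "set ?bs \<subseteq> R" using generating_basis_prefix_indep[of ?bs cs] C by auto
  obtain u where u: "\<And>b. b \<in> set (as @ a # cs) \<Longrightarrow> q u b = (if b = a then 1 else 0)"
    using generating_basis_dual[OF C, of a] by auto
  obtain N c where N: "0 < N" "(?w ^^ N) r = r + c *\<^sub>R \<delta>" using orbit_period[OF I(2) r(1)] .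
  have "c *\<^sub>R \<delta> = (?w ^^ N) r - r" using N(2) by simp
  also have "\<dots> \<in> span (set ?bs)" using power_span[OF r(2)] r(2) by (rule span_diff)
  finally have c: "c = 0" using span_scale[of "c *\<^sub>R \<delta>" "set ?bs" "1 / c"] \<delta> by (cases "c = 0") auto
  let ?s = "\<Sum>l<N. (?w ^^ l) r"
  have "?w ?s = ?s" using N(2) by (simp only: orbit_sum_fixed) (simp add: c)
  moreover have s: "?s \<in> span (set ?bs)" by (intro span_sum power_span r(2))
  ultimately obtain d where d: "?s = d *\<^sub>R \<delta>" using fixed_in_span_radical[OF I] by blast
  then have "d = 0" using s span_scale[of "d *\<^sub>R \<delta>" "set ?bs" "1 / d"] \<delta> by (cases "d = 0") auto
  then have "(\<Sum>l<N. q u ((?w ^^ l) r)) = 0" using d q_sum[of u "\<lambda>l. (?w ^^ l) r" "{..<N}"] by simp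
  from sum_zero_signs[OF this N(1)] obtain i k
    where "q u ((?w ^^ i) r) \<le> 0" "0 \<le> q u ((?w ^^ k) r)" .
  from orbit_crossing[OF C r u _ this] \<delta> show ?thesis by blast
qed

text \<open>If \<open>\<delta>\<close> lies in the span, the orbit is not periodic: the coefficient grows linearly along it
  whenever neither \<open>a\<close> nor \<open>r\<close> can be omitted in expressing \<open>\<delta>\<close> by a factorization of \<open>w\<close>.\<close>

lemma orbit_meets_prefix_affine:
  assumes C: "generating_basis (as @ a # cs)" and r: "r \<in> R" "r \<in> span (set (as @ [a]))"
    and \<delta>: "\<delta> \<in> span (set (as @ [a]))" "\<delta> \<notin> span (set as)"
    and bs: "rprod (bs @ [r]) = rprod (as @ [a])" "\<delta> \<notin> span (set bs)"
  shows "\<exists>i j. ((rprod (as @ [a])) ^^ i) (((rprod (rev (as @ [a]))) ^^ j) r) \<in> span (set as) \<union> {a, - a}"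
proof -
  let ?as = "as @ [a]"
  let ?w = "rprod ?as" and ?v = "rprod (rev ?as)"
  have I: "indep_list ?as" "set ?as \<subseteq> R" using generating_basis_prefix_indep[of ?as cs] C by auto
  obtain u where u: "\<And>b. b \<in> set (as @ a # cs) \<Longrightarrow> q u b = (if b = a then 1 else 0)"
    using generating_basis_dual[OF C, of a] by auto
  have na: "a \<notin> set as" using C by (auto simp: generating_basis_def indep_list_def)
  have "q u b = 0" if "b \<in> set as" for b using u[of b] that na by auto
  then have uas: "q u x = 0" if "x \<in> span (set as)" for x using orth_span[OF that] by blast
  have u\<delta>: "q u \<delta> \<noteq> 0"
  proof
    assume 0: "q u \<delta> = 0"
    obtain c where c: "\<delta> - c *\<^sub>R a \<in> span (set as)" using \<delta>(1) by (auto simp: span_insert)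
    with uas[OF c] 0 u[of a] have "c = 0" by simp
    with c \<delta>(2) show False by simp
  qed
  obtain N c where N: "0 < N" "(?w ^^ N) r = r + c *\<^sub>R \<delta>" using orbit_period[OF I(2) r(1)] .
  have c: "c \<noteq> 0"
  proof
    assume "c = 0"
    let ?s = "\<Sum>l<N. (?w ^^ l) r"
    have "?w ?s = ?s" using N(2) by (simp only: orbit_sum_fixed) (simp add: \<open>c = 0\<close>)
    moreover have "?s \<in> span (set ?as)" by (intro span_sum power_span r(2))
    ultimately obtain d where d: "?s = d *\<^sub>R \<delta>" using fixed_in_span_radical[OF I] by blast
    \<comment> \<open>If the orbit were periodic, \<open>q z\<close> would be constant along it, so
      N q(z, r) would be the value of \<open>q z\<close> on \<open>?s\<close>, a multiple of q(z,
      \<delta>) = 0. Then the reflection in \<open>r\<close> fixes \<open>z\<close>, and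
      \<open>bs\<close> alone moves \<open>z\<close> by \<delta>, against \<delta> being outside the
      span of \<open>bs\<close>.\<close>
    obtain z where z: "?w z = z + \<delta>"
      using rprod_surj[OF I(1) \<delta>(1)] I(2) root_nonzero by blast
    have \<delta>o: "q \<delta> x = 0" if "x \<in> span (set ?as)" for x
      using delta_orth that span_mono[OF I(2)] by blast
    have zw: "q z (?w x) = q z x" if "x \<in> span (set ?as)" for x
    proof -
      have "q z x = q (?w z) (?w x)" by (rule q_rprod[symmetric])
      also have "\<dots> = q z (?w x)" unfolding z using \<delta>o[OF rprod_span[OF that]] by simp
      finally show ?thesis by simp
    qed
    have "q z ((?w ^^ l) r) = q z r" for l
      by (induction l) (use zw power_span[OF r(2)] in \<open>simp_all del: rprod_append\<close>)
    then have "q z ?s = real N * q z r" by (simp add: q_sum del: rprod_append)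
    \<comment> \<open>Compare \<open>q (?w z) (?w z)\<close> with \<open>q z z\<close>: they differ
      by 2 q(z, \<delta>) + q(\<delta>, \<delta>).\<close>
    moreover have "q z \<delta> = 0"
      using q_rprod[of ?as z \<delta>] zw[OF \<delta>(1)] \<delta>o[OF \<delta>(1)] q_rprod[of ?as z z] q_sym[of \<delta> z] unfolding z by simp
    ultimately have "q z r = 0" using N(1) by (simp add: d del: rprod_append)
    then have "rprod bs z = z + \<delta>" using z unfolding bs(1)[symmetric] by (simp add: reflection_def)
    then have "\<delta> \<in> span (set bs)" using rprod_diff_in_span[of bs z] by simp
    with bs(2) show False by simp
  qed
  have iter: "(?w ^^ (N * k)) r = r + (of_nat k * c) *\<^sub>R \<delta>" for k
  proof (induction k)
    case (Suc k)
    have "(?w ^^ (N * Suc k)) r = (?w ^^ N) ((?w ^^ (N * k)) r)" by (simp add: funpow_add)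
    also have "\<dots> = r + (of_nat (Suc k) * c) *\<^sub>R \<delta>"
      unfolding Suc power_linear_simps power_delta[OF I(2)] N(2) by (simp add: algebra_simps)
    finally show ?case .
  qed simp
  let ?e = "c * q u \<delta>"
  obtain K :: nat where "\<bar>q u r\<bar> / \<bar>?e\<bar> < of_nat K" using reals_Archimedean2 by blast
  then have K: "\<bar>q u r\<bar> < of_nat K * \<bar>?e\<bar>" using c u\<delta> by (simp add: field_simps)
  \<comment> \<open>Starting N K steps before \<open>r\<close> makes both ends of the orbit
    accessible to nonnegative powers; \<open>K\<close> is large enough for the coefficients there to
    have opposite signs.\<close>
  define r' where "r' = (?v ^^ (N * K)) r"
  have w0: "(?w ^^ (N * K)) r' = r" by (simp only: r'_def power_inverse)
  have "(?w ^^ (N * K)) (r - (of_nat K * c) *\<^sub>R \<delta>) = r"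
    unfolding power_linear_simps power_delta[OF I(2)] iter by simp
  then have r': "r' = r - (of_nat K * c) *\<^sub>R \<delta>" unfolding r'_def by (metis power_inverse(2))
  have "(?w ^^ (N * K + N * K)) r' = r + (of_nat K * c) *\<^sub>R \<delta>"
    by (simp only: funpow_add o_apply w0 iter)
  then have ends: "q u ((?w ^^ 0) r') = q u r - of_nat K * ?e"
    "q u ((?w ^^ (N * K + N * K)) r') = q u r + of_nat K * ?e"
    by (simp_all add: r' algebra_simps del: rprod_append)
  have r'R: "r' \<in> R" unfolding r'_def using I(2) r(1) by (intro power_root) auto
  have "r' \<in> span (set ?as)" unfolding r' using r(2) \<delta>(1) by (intro span_diff span_scale)
  note X = orbit_crossing[OF C r'R this u]
  have "\<exists>j. (?w ^^ j) r' \<in> span (set as) \<union> {a, - a}"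
  proof (cases "?e > 0")
    case True
    then have "q u ((?w ^^ 0) r') \<le> 0" "0 \<le> q u ((?w ^^ (N * K + N * K)) r')"
      unfolding ends using K by (auto simp: abs_if split: if_splits)
    then show ?thesis using X u\<delta> by blast
  next
    case False
    then have "q u ((?w ^^ (N * K + N * K)) r') \<le> 0" "0 \<le> q u ((?w ^^ 0) r')"
      unfolding ends using K by (auto simp: abs_if split: if_splits)
    then show ?thesis using X u\<delta> by blast
  qed
  then show ?thesis unfolding r'_def by blast
qed

text \<open>It suffices to end in the image \<open>x\<close> of \<open>r\<close>, since conjugation
  by powers of the product stays in the Hurwitz class. If \<open>x\<close> can be split off from
  \<open>as\<close>, one more move carries it past \<open>a\<close>.\<close>

lemma hurwitz_equiv_end_with:
  assumes x: "x = ((rprod (as @ [a])) ^^ i) (((rprod (rev (as @ [a]))) ^^ j) r)"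
    and "x \<in> span (set as) \<union> {a, - a}"
    and "x \<in> span (set as) \<Longrightarrow> \<exists>bs. hurwitz_equiv as (bs @ [x])"
  shows "\<exists>bs. hurwitz_equiv (as @ [a]) (bs @ [r])"
proof -
  have "\<exists>bs. hurwitz_equiv (as @ [a]) (bs @ [x])"
  proof (cases "x \<in> span (set as)")
    case True
    then obtain bs where "hurwitz_equiv as (bs @ [x])" using assms(3) by blast
    from hurwitz_equiv_context[OF this, of "[]" "[a]"]
    have "hurwitz_equiv (as @ [a]) (bs @ [x, a])" by simp
    from hurwitz_equiv.trans[OF this hurwitz_equiv.move[of bs x a "[]"]]
    have "hurwitz_equiv (as @ [a]) ((bs @ [reflection x a]) @ [x])" by (simp del: rprod_append)
    then show ?thesis by blast
  next
    case False
    then have "x = a \<or> x = - a" using assms(2) by auto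
    then have "hurwitz_equiv (as @ [a]) (as @ [x])"
      using hurwitz_equiv.refl[of "as @ [a]"] hurwitz_equiv_neg_last[of as a]
      by (elim disjE) (simp_all only:)
    then show ?thesis by blast
  qed
  then obtain bs where "hurwitz_equiv (as @ [a]) (bs @ [x])" by blast
  from hurwitz_equiv_conj_power(1)[OF hurwitz_equiv_conj_power(2)[OF this, of i], of j]
  have "hurwitz_equiv (as @ [a]) (map ((rprod (as @ [a])) ^^ j) (map ((rprod (rev (as @ [a]))) ^^ i) bs) @ [r])"
    by (simp only: map_append list.map x power_inverse)
  then show ?thesis by blast
qed

text \<open>Some iterate of \<open>r\<close> is the last root up to sign or falls into the span of
  the shorter prefix, where the induction hypothesis applies.\<close>

lemma hurwitz_equiv_contains_root:
  assumes "generating_basis (as @ cs)" "r \<in> R" "r \<in> span (set as)" "\<delta> \<notin> span (set as)"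
  shows "\<exists>bs. hurwitz_equiv as (bs @ [r])"
  using assms
proof (induction as arbitrary: cs r rule: rev_induct)
  case Nil
  then show ?case using root_pos[of r] by simp
next
  case (snoc a as)
  have C: "generating_basis (as @ a # cs)" using snoc.prems(1) by simp
  obtain j where j: "((rprod (as @ [a])) ^^ j) r \<in> span (set as) \<union> {a, - a}"
    using orbit_meets_prefix_finite[OF C snoc.prems(2-4)] by blast
  have R: "((rprod (as @ [a])) ^^ j) r \<in> R"
    using generating_basis_prefix_indep[of "as @ [a]" cs] snoc.prems by (intro power_root) auto
  have "\<delta> \<notin> span (set as)" using snoc.prems(4) span_mono[of "set as" "set (as @ [a])"] by auto
  then show ?case
    using j snoc.IH[OF C R] by (intro hurwitz_equiv_end_with[of _ j as a 0 r]) (auto simp del: rprod_append)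
qed

lemma generating_basis_hurwitz:
  assumes "hurwitz_equiv as bs" "generating_basis (as @ cs)"
  shows "generating_basis (bs @ cs)"
proof -
  have h: "hurwitz_equiv (as @ cs) (bs @ cs)" using hurwitz_equiv_context[OF assms(1), of "[]" cs] by simp
  have "set (as @ cs) \<subseteq> span (set (bs @ cs))"
    using span_superset[of "set (as @ cs)"] unfolding hurwitz_equiv_span[OF h] .
  moreover have "indep_list (as @ cs)" "set (as @ cs) \<subseteq> R" using assms(2) by (simp_all only: generating_basis_def)
  ultimately have "indep_list (bs @ cs)" "set (bs @ cs) \<subseteq> R"
    using hurwitz_equiv_length[OF h] hurwitz_equiv_roots[OF h]
    by (simp_all only: indep_list_exchange(1)[of "as @ cs"])
  then show ?thesis
    using assms(2) unfolding generating_basis_def reflection_group_hurwitz[OF h] by blast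
qed

text \<open>Some root has a nonzero coefficient in the expansion of \<delta>, as read off by dual
  vectors. Without it the list no longer spans \<delta>, and moving it to the end leaves the others
  unchanged.\<close>

lemma delta_last:
  assumes "set as \<subseteq> R" "\<delta> \<in> span (set as)" "indep_list as"
  obtains bs a where "hurwitz_equiv as (bs @ [a])" "\<delta> \<notin> span (set bs)"
proof -
  have "\<exists>xs a ys. as = xs @ a # ys \<and> \<delta> \<notin> span (set (xs @ ys))"
  proof (rule ccontr)
    assume n: "\<not> ?thesis"
    have "q v \<delta> = 0" if v: "a \<in> set as" "\<And>b. b \<in> set as \<Longrightarrow> q v b = (if b = a then 1 else 0)" for a v
    proof -
      obtain xs ys where xy: "as = xs @ a # ys" using v(1) by (meson split_list)
      have "a \<notin> set (xs @ ys)" using assms(3) xy by (auto simp: indep_list_def)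
      then have "q v b = 0" if "b \<in> set (xs @ ys)" for b using v(2)[of b] that xy by auto
      then show ?thesis using n xy orth_span[of \<delta> "set (xs @ ys)" v] by blast
    qed
    moreover have "\<exists>v. \<forall>b\<in>set as. q v b = (if b = a then 1 else 0)" for a
      using dual_vector[of "set as" "\<lambda>b. if b = a then 1 else 0"] assms(3)
      unfolding indep_list_def by metis
    then obtain V where V: "\<And>a b. b \<in> set as \<Longrightarrow> q (V a) b = (if b = a then 1 else 0)" by metis
    ultimately have V\<delta>: "q (V a) \<delta> = 0" if "a \<in> set as" for a using that by blast
    obtain c where c: "\<delta> = (\<Sum>b\<in>set as. c b *\<^sub>R b)"
      using assms(2) by (auto simp: span_finite)
    have "c a = 0" if a: "a \<in> set as" for a
    proof -
      have "q (V a) \<delta> = (\<Sum>b\<in>set as. c b * (if b = a then 1 else 0))"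
        unfolding c q_sum by (rule sum.cong) (auto simp: V)
      then show ?thesis using a V\<delta>[OF a] by (simp add: sum.delta if_distrib cong: if_cong)
    qed
    then have "\<delta> = 0" using c by simp
    with delta_nonzero show False ..
  qed
  then obtain xs a ys where "as = xs @ a # ys" "\<delta> \<notin> span (set (xs @ ys))" by blast
  with that[of "xs @ ys"] hurwitz_equiv_to_end[of xs a ys] show thesis by simp
qed

lemma rprod_snoc_cancel:
  assumes "rprod (as @ [a]) = rprod (bs @ [a])"
  shows "rprod as = rprod bs"
proof
  fix x
  show "rprod as x = rprod bs x" using fun_cong[OF assms, of "reflection a x"] by simp
qed

text \<open>Induction on the length: both factorizations are brought to a common last root, which is
  cancelled. By Carter's lemma \<open>bs\<close> is independent with the same span as
  \<open>as\<close>, so \<delta> lies in both spans or in neither.\<close>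

theorem hurwitz_equiv_generating_basis:
  assumes "generating_basis (as @ cs)" "set bs \<subseteq> R" "length bs = length as" "rprod as = rprod bs"
  shows "hurwitz_equiv as bs"
  using assms
proof (induction "length as" arbitrary: as bs cs)
  case 0
  then show ?case by (simp add: hurwitz_equiv.refl)
next
  case (Suc n)
  have I: "indep_list as" "set as \<subseteq> R" using generating_basis_prefix_indep[OF Suc.prems(1)] by auto
  have J: "indep_list bs" "set as \<subseteq> span (set bs)"
  proof -
    show s: "set as \<subseteq> span (set bs)"
      using I(2) root_nonzero by (intro rprod_eq_span[OF I(1) Suc.prems(4)]) blast
    show "indep_list bs" by (rule indep_list_exchange(1)[OF I(1) s]) (simp add: Suc.prems(3))
  qed
  have K: "set bs \<subseteq> span (set as)"
    using Suc.prems(2) root_nonzero by (intro rprod_eq_span[OF J(1) Suc.prems(4)[symmetric]]) blast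
  have finish: "hurwitz_equiv as bs" if h: "hurwitz_equiv as (as' @ [r])" "hurwitz_equiv bs (bs' @ [r])" for as' bs' r
  proof -
    have "generating_basis (as' @ r # cs)" using generating_basis_hurwitz[OF h(1) Suc.prems(1)] by simp
    moreover have "set bs' \<subseteq> R" using hurwitz_equiv_roots[OF h(2)] Suc.prems(2) by simp
    moreover have "length bs' = length as'" "n = length as'"
      using hurwitz_equiv_length[OF h(1)] hurwitz_equiv_length[OF h(2)] Suc by simp_all
    moreover have "rprod (as' @ [r]) = rprod (bs' @ [r])"
      using hurwitz_equiv_rprod[OF h(1)] hurwitz_equiv_rprod[OF h(2)] Suc.prems(4) by simp
    ultimately have "hurwitz_equiv as' bs'" using Suc.hyps(1) rprod_snoc_cancel by metis
    from hurwitz_equiv_context[OF this, of "[]" "[r]"] have "hurwitz_equiv (as' @ [r]) (bs' @ [r])" by simp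
    with h show ?thesis by (blast intro: hurwitz_equiv.trans hurwitz_equiv.sym)
  qed
  show ?case
  proof (cases "\<delta> \<in> span (set as)")
    case False
    obtain bs' r where bs: "bs = bs' @ [r]" using Suc by (metis length_0_conv nat.distinct(1) rev_exhaust)
    have "r \<in> R" "r \<in> span (set as)" using Suc.prems(2) K by (auto simp: bs)
    from hurwitz_equiv_contains_root[OF Suc.prems(1) this False]
    obtain as' where as': "hurwitz_equiv as (as' @ [r])" by blast
    have "hurwitz_equiv bs (bs' @ [r])" by (simp only: bs hurwitz_equiv.refl)
    with as' show ?thesis by (rule finish)
  next
    case True
    \<comment> \<open>Both last roots are chosen indispensable for \<delta>, as the affine crossing
      argument requires; once an iterate lies in the span of \<open>as'\<close>, which misses
      \<delta>, the finite case takes over.\<close>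
    obtain as' a where a: "hurwitz_equiv as (as' @ [a])" "\<delta> \<notin> span (set as')"
      using delta_last[OF I(2) True I(1)] .
    have "\<delta> \<in> span (set bs)" using True span_mono[OF J(2)] by (auto simp only: span_span)
    then obtain bs' r where r: "hurwitz_equiv bs (bs' @ [r])" "\<delta> \<notin> span (set bs')"
      using delta_last[OF Suc.prems(2) _ J(1)] by blast
    have C: "generating_basis (as' @ a # cs)" using generating_basis_hurwitz[OF a(1) Suc.prems(1)] by simp
    have rR: "r \<in> R" using hurwitz_equiv_roots[OF r(1)] Suc.prems(2) by simp
    have "r \<in> span (set bs)" using hurwitz_equiv_span[OF r(1)] by (simp add: span_base)
    then have "r \<in> span (set as)" using span_mono[OF K] by (auto simp only: span_span)
    then have rs: "r \<in> span (set (as' @ [a]))" using hurwitz_equiv_span[OF a(1)] by simp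
    have \<delta>: "\<delta> \<in> span (set (as' @ [a]))" using hurwitz_equiv_span[OF a(1)] True by simp
    have w: "rprod (bs' @ [r]) = rprod (as' @ [a])"
      using hurwitz_equiv_rprod[OF a(1)] hurwitz_equiv_rprod[OF r(1)] Suc.prems(4) by simp
    obtain i j where ij: "((rprod (as' @ [a])) ^^ i) (((rprod (rev (as' @ [a]))) ^^ j) r) \<in> span (set as') \<union> {a, - a}"
      (is "?g \<in> _")
      using orbit_meets_prefix_affine[OF C rR rs \<delta> a(2) w r(2)] by blast
    have aR: "set (as' @ [a]) \<subseteq> R" using C by (auto simp: generating_basis_def)
    then have "?g \<in> R" using rR by (intro power_root) auto
    then have "\<exists>bs. hurwitz_equiv as' (bs @ [?g])" if "?g \<in> span (set as')"
      using hurwitz_equiv_contains_root[OF C _ that a(2)] by blast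
    from hurwitz_equiv_end_with[OF HOL.refl ij this]
    obtain cs' where "hurwitz_equiv (as' @ [a]) (cs' @ [r])" by blast
    then have "hurwitz_equiv as (cs' @ [r])" using a(1) by (blast intro: hurwitz_equiv.trans)
    from finish[OF this r(1)] show ?thesis .
  qed
qed

end

section \<open>Splitting into components\<close>

lemma sum_length_filter:
  assumes "finite K" "f ` set xs \<subseteq> K"
  shows "(\<Sum>c\<in>K. length (filter (\<lambda>x. f x = c) xs)) = length xs"
  using assms(2)
proof (induction xs)
  case (Cons x xs)
  have "(\<Sum>c\<in>K. length (filter (\<lambda>y. f y = c) (x # xs)))
      = (\<Sum>c\<in>K. (if f x = c then 1 else 0) + length (filter (\<lambda>y. f y = c) xs))"
    by (rule sum.cong) auto
  also have "\<dots> = 1 + length xs" using Cons assms(1) by (simp add: sum.distrib sum.delta)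
  finally show ?case by simp
qed simp

text \<open>Summed over all fibres, one strict inequality would contradict the bound on the total
  lengths.\<close>

lemma length_filter_eqI:
  assumes "\<And>c. length (filter (\<lambda>x. f x = c) xs) \<le> length (filter (\<lambda>x. f x = c) ys)"
    and "length ys \<le> length xs"
  shows "length (filter (\<lambda>x. f x = c) xs) = length (filter (\<lambda>x. f x = c) ys)"
proof (rule ccontr)
  assume "\<not> ?thesis"
  then have lt: "length (filter (\<lambda>x. f x = c) xs) < length (filter (\<lambda>x. f x = c) ys)"
    using assms(1)[of c] by simp
  let ?K = "insert c (f ` set xs \<union> f ` set ys)"
  have "(\<Sum>c\<in>?K. length (filter (\<lambda>x. f x = c) xs)) < (\<Sum>c\<in>?K. length (filter (\<lambda>x. f x = c) ys))"
    using lt assms(1) by (intro sum_strict_mono_ex1) auto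
  moreover have "finite ?K" "f ` set xs \<subseteq> ?K" "f ` set ys \<subseteq> ?K" by auto
  ultimately have "length xs < length ys" by (simp only: sum_length_filter)
  with assms(2) show False by simp
qed

context form_space
begin

text \<open>Reflections in orthogonal roots commute, so moving a root past the selected ones only
  changes the order.\<close>

lemma hurwitz_equiv_filter:
  assumes "\<And>a b. a \<in> set as \<Longrightarrow> b \<in> set as \<Longrightarrow> P a \<Longrightarrow> \<not> P b \<Longrightarrow> q a b = 0"
  shows "hurwitz_equiv as (filter P as @ filter (\<lambda>a. \<not> P a) as)"
  using assms
proof (induction as)
  case (Cons a as)
  let ?F = "filter P as" and ?G = "filter (\<lambda>a. \<not> P a) as"
  have "hurwitz_equiv as (?F @ ?G)" using Cons by simp
  from hurwitz_equiv_context[OF this, of "[a]" "[]"]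
  have 1: "hurwitz_equiv (a # as) (a # ?F @ ?G)" by simp
  show ?case
  proof (cases "P a")
    case False
    have "rprod (rev ?F) a = a"
      using Cons.prems False by (intro rprod_fixes) (auto simp: q_sym[of a])
    then have "hurwitz_equiv (a # ?F) (?F @ [a])" using hurwitz_equiv_to_end[of "[]" a ?F] by simp
    from hurwitz_equiv_context[OF this, of "[]" ?G]
    have "hurwitz_equiv (a # ?F @ ?G) (?F @ a # ?G)" by simp
    with 1 False show ?thesis by (auto intro: hurwitz_equiv.trans)
  qed (use 1 in simp)
qed (simp add: hurwitz_equiv.refl)

text \<open>Sort both lists so that the fibre of the first root comes first; that fibre is covered
  by hypothesis, the remaining roots by induction.\<close>

lemma hurwitz_equiv_glue:
  assumes "\<And>a b. a \<in> set as \<union> set bs \<Longrightarrow> b \<in> set as \<union> set bs \<Longrightarrow> f a \<noteq> f b \<Longrightarrow> q a b = 0"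
    and "\<And>c. hurwitz_equiv (filter (\<lambda>a. f a = c) as) (filter (\<lambda>a. f a = c) bs)"
  shows "hurwitz_equiv as bs"
  using assms
proof (induction "length as" arbitrary: as bs rule: less_induct)
  case less
  show ?case
  proof (cases as)
    case Nil
    have "bs = []"
    proof (rule ccontr)
      assume "bs \<noteq> []"
      then obtain b bs' where "bs = b # bs'" by (cases bs) auto
      with hurwitz_equiv_length[OF less.prems(2)[of "f b"]] Nil show False by simp
    qed
    with Nil show ?thesis by (simp add: hurwitz_equiv.refl)
  next
    case (Cons a as')
    let ?P = "\<lambda>b. f b = f a" and ?N = "\<lambda>b. f b \<noteq> f a"
    have l: "length (filter ?N as) < length as" using Cons by (simp add: le_imp_less_Suc)
    have "hurwitz_equiv (filter ?N as) (filter ?N bs)"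
    proof (rule less.hyps[OF l])
      fix c
      have "filter (\<lambda>a. f a = c) (filter ?N xs) = (if c = f a then [] else filter (\<lambda>a. f a = c) xs)" for xs
        by (auto intro!: filter_cong)
      then show "hurwitz_equiv (filter (\<lambda>a. f a = c) (filter ?N as)) (filter (\<lambda>a. f a = c) (filter ?N bs))"
        using less.prems(2)[of c] by (simp add: hurwitz_equiv.refl)
    qed (use less.prems(1) in auto)
    from hurwitz_equiv_context[OF this, of "filter ?P as" "[]"]
    have "hurwitz_equiv (filter ?P as @ filter ?N as) (filter ?P as @ filter ?N bs)" by simp
    moreover from hurwitz_equiv_context[OF less.prems(2)[of "f a"], of "[]" "filter ?N bs"]
    have "hurwitz_equiv (filter ?P as @ filter ?N bs) (filter ?P bs @ filter ?N bs)" by simp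
    moreover have "hurwitz_equiv as (filter ?P as @ filter ?N as)"
      "hurwitz_equiv bs (filter ?P bs @ filter ?N bs)"
      using less.prems(1) by (intro hurwitz_equiv_filter; auto)+
    ultimately show ?thesis by (meson hurwitz_equiv.trans hurwitz_equiv.sym)
  qed
qed

end

section \<open>Affine reflections as linear reflections\<close>

text \<open>The reflection in the hyperplane \<open>v \<bullet> \<alpha> = k\<close> of \<open>V\<close> becomes the linear reflection in
  \<open>(\<alpha>, -k, 0)\<close> on \<open>V \<oplus> \<real>\<^sup>2\<close>, where a point \<open>v\<close> of \<open>V\<close> corresponds to the vectors \<open>(v, _, 1)\<close>. The
  additional hyperbolic plane makes the form nondegenerate.\<close>

definition affine_form :: "'v::euclidean_space \<times> real \<times> real \<Rightarrow> 'v \<times> real \<times> real \<Rightarrow> real" where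
  "affine_form x y = fst x \<bullet> fst y + fst (snd x) * snd (snd y) + snd (snd x) * fst (snd y)"

interpretation affine: form_space affine_form
proof
  show "bilinear affine_form"
    unfolding bilinear_def affine_form_def
    by (intro conjI allI linearI) (simp_all add: inner_simps algebra_simps)
  show "affine_form x y = affine_form y x" for x y :: "'a \<times> real \<times> real"
    by (simp add: affine_form_def inner_commute algebra_simps)
  fix f :: "'a \<times> real \<times> real \<Rightarrow> real" assume f: "linear f"
  let ?g = "\<Sum>b\<in>Basis. f b *\<^sub>R b"
  have "f x = x \<bullet> ?g" for x
  proof -
    have "f x = f (\<Sum>b\<in>Basis. (x \<bullet> b) *\<^sub>R b)" by (simp add: euclidean_representation)
    also have "\<dots> = x \<bullet> ?g"
      by (simp add: linear_sum[OF f] linear_scale[OF f] inner_sum_right mult.commute)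
    finally show ?thesis .
  qed
  then obtain g where g: "\<And>x. f x = x \<bullet> g" by blast
  \<comment> \<open>The hyperbolic plane pairs its two coordinates crosswise, so they are exchanged
    to represent an inner product.\<close>
  have "affine_form (fst g, snd (snd g), fst (snd g)) x = f x" for x
    unfolding g by (cases x, cases g) (simp add: affine_form_def inner_commute)
  then show "\<exists>u. \<forall>x. affine_form u x = f x" by blast
qed

text \<open>The middle coordinate is an arbitrary real offset: this also covers the displaced
  hyperplanes of the deformation argument.\<close>

definition point_reflection :: "'v::euclidean_space \<times> real \<times> real \<Rightarrow> 'v \<Rightarrow> 'v" where
  "point_reflection a v = v - (v \<bullet> fst a + fst (snd a)) *\<^sub>R coroot (fst a)"

definition point_prod :: "('v::euclidean_space \<times> real \<times> real) list \<Rightarrow> 'v \<Rightarrow> 'v" where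
  "point_prod as = foldr (\<lambda>a g. point_reflection a \<circ> g) as id"

lemma point_prod_Nil [simp]: "point_prod [] = id" by (simp add: point_prod_def)

lemma point_prod_Cons [simp]: "point_prod (a # as) = point_reflection a \<circ> point_prod as"
  by (simp add: point_prod_def)

lemma point_prod_append: "point_prod (as @ bs) = point_prod as \<circ> point_prod bs"
  by (induction as) (auto simp: fun_eq_iff)

lemma point_reflection_affine: "point_reflection (\<alpha>, - of_int k, 0) = affine_reflection \<alpha> k"
  by (simp add: point_reflection_def affine_reflection_def fun_eq_iff)

abbreviation level0 :: "('v::euclidean_space \<times> real \<times> real) set" where
  "level0 \<equiv> {a. snd (snd a) = 0}"

lemma reflection_point:
  assumes "a \<in> level0"
  shows "fst (affine.reflection a (v, k, 1)) = point_reflection a v"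
    and "snd (snd (affine.reflection a (v, k, 1))) = 1"
  using assms by (simp_all add: affine.reflection_def affine_form_def point_reflection_def coroot_def)

lemma rprod_point:
  assumes "set as \<subseteq> level0"
  shows "\<exists>k'. affine.rprod as (v, k, 1) = (point_prod as v, k', 1)"
  using assms
proof (induction as)
  case (Cons a as)
  then obtain k' where k': "affine.rprod as (v, k, 1) = (point_prod as v, k', 1)" by auto
  let ?x = "affine.reflection a (point_prod as v, k', 1)"
  have "?x = (point_prod (a # as) v, fst (snd ?x), 1)"
    using reflection_point[of a "point_prod as v" k'] Cons.prems by (simp add: prod_eq_iff)
  then show ?case using k' by (metis affine.rprod_Cons o_apply)
qed simp

text \<open>On vectors with last coordinate 1 the linear reflections induce the point reflections.
  The middle coordinate of an image is determined by invariance of the form, and these vectors span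
  the space.\<close>

lemma rprod_eq_iff_point_prod:
  assumes "set as \<subseteq> level0" "set bs \<subseteq> level0"
  shows "affine.rprod as = affine.rprod bs \<longleftrightarrow> point_prod as = point_prod bs"
proof
  assume e: "affine.rprod as = affine.rprod bs"
  show "point_prod as = point_prod bs"
  proof
    fix v
    show "point_prod as v = point_prod bs v"
      using rprod_point[OF assms(1), of v 0] rprod_point[OF assms(2), of v 0] e by auto
  qed
next
  assume e: "point_prod as = point_prod bs"
  have 1: "affine.rprod as (v, k, 1) = affine.rprod bs (v, k, 1)" for v k
  proof -
    obtain k1 where k1: "affine.rprod as (v, k, 1) = (point_prod as v, k1, 1)"
      using rprod_point[OF assms(1)] by blast
    obtain k2 where k2: "affine.rprod bs (v, k, 1) = (point_prod as v, k2, 1)"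
      using rprod_point[OF assms(2)] e by metis
    have "affine_form (point_prod as v, k1, 1) (point_prod as v, k1, 1) =
        affine_form (point_prod as v, k2, 1) (point_prod as v, k2, 1)"
      using affine.q_rprod[of as "(v, k, 1)" "(v, k, 1)"] affine.q_rprod[of bs "(v, k, 1)" "(v, k, 1)"]
      unfolding k1 k2 by simp
    then have "k1 = k2" by (simp add: affine_form_def)
    then show ?thesis using k1 k2 by simp
  qed
  show "affine.rprod as = affine.rprod bs"
  proof
    fix x :: "'a \<times> real \<times> real"
    obtain v k l where x: "x = (v, k, l)" by (cases x)
    have "x = (v, k, 1) + (l - 1) *\<^sub>R (0, 0, 1)" by (simp add: x)
    then show "affine.rprod as x = affine.rprod bs x"
      by (simp only: linear_add[OF affine.linear_rprod] linear_scale[OF affine.linear_rprod] 1)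
  qed
qed

lemma point_reflection_reflection:
  assumes "a \<in> level0" "b \<in> level0"
  shows "point_reflection (affine.reflection b a) =
    point_reflection b \<circ> (point_reflection a \<circ> point_reflection b)"
proof -
  have "affine.rprod [affine.reflection b a] = affine.rprod [b, a, b]"
    by (auto simp: fun_eq_iff affine.reflection_reflection)
  moreover have "affine.reflection b a \<in> level0"
    using assms by (simp add: affine.reflection_def)
  ultimately show ?thesis
    using rprod_eq_iff_point_prod[of "[affine.reflection b a]" "[b, a, b]"] assms by simp
qed

lemma point_reflection_involution: 
  assumes "a \<in> level0"
  shows "point_reflection a (point_reflection a v) = v"
  using rprod_eq_iff_point_prod[of "[a, a]" "[]"] assms by (auto simp: fun_eq_iff)

definition affine_roots :: "'v::euclidean_space set \<Rightarrow> ('v \<times> real \<times> real) set" where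
  "affine_roots C = {(\<alpha>, - of_int k, 0) | \<alpha> k. \<alpha> \<in> C}"

lemma affine_roots_level0: "affine_roots C \<subseteq> level0"
  by (auto simp: affine_roots_def)

lemma fst_affine_roots: "a \<in> affine_roots C \<Longrightarrow> fst a \<in> C"
  by (auto simp: affine_roots_def)

lemma affine_roots_mono: "a \<in> affine_roots D \<Longrightarrow> fst a \<in> C \<Longrightarrow> a \<in> affine_roots C"
  by (auto simp: affine_roots_def)

lemma affine_reflections_eq: "affine_reflections \<Phi> = point_reflection ` affine_roots \<Phi>"
proof (intro equalityI subsetI)
  fix g assume "g \<in> affine_reflections \<Phi>"
  then obtain \<alpha> k where "\<alpha> \<in> \<Phi>" "g = affine_reflection \<alpha> k" by (auto simp: affine_reflections_def)
  then show "g \<in> point_reflection ` affine_roots \<Phi>"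
    unfolding affine_roots_def by (intro image_eqI[of _ _ "(\<alpha>, - of_int k, 0)"]) (auto simp: point_reflection_affine)
next
  fix g assume "g \<in> point_reflection ` affine_roots \<Phi>"
  then show "g \<in> affine_reflections \<Phi>"
    unfolding affine_roots_def affine_reflections_def
    by (elim imageE CollectE exE conjE) (simp only: point_reflection_affine, blast)
qed

lemma reflection_affine_root:
  "affine.reflection (\<alpha>, - x, 0) (\<beta>, - y, 0) =
    (affine_reflection \<alpha> 0 \<beta>, - (y - (\<beta> \<bullet> coroot \<alpha>) * x), 0)"
  by (simp add: affine.reflection_def affine_form_def affine_reflection_def coroot_def algebra_simps)

section \<open>Irreducible components of the root system\<close>

definition root_component :: "'v::euclidean_space set \<Rightarrow> 'v \<Rightarrow> 'v set" where
  "root_component \<Phi> \<alpha> = {(\<alpha>, \<beta>). \<alpha> \<in> \<Phi> \<and> \<beta> \<in> \<Phi> \<and> \<alpha> \<bullet> \<beta> \<noteq> 0}\<^sup>* `` {\<alpha>}"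

locale root_system =
  fixes \<Phi> :: "'v::euclidean_space set"
  assumes root_system: "crystallographic_root_system \<Phi>"
begin

lemma finite_roots: "finite \<Phi>" and zero_not_root: "0 \<notin> \<Phi>"
  using root_system by (auto simp: crystallographic_root_system_def)

lemma root_inner_pos: "\<alpha> \<in> \<Phi> \<Longrightarrow> 0 < \<alpha> \<bullet> \<alpha>"
  using zero_not_root by (auto simp: inner_gt_zero_iff)

lemma root_reflection: "\<alpha> \<in> \<Phi> \<Longrightarrow> \<beta> \<in> \<Phi> \<Longrightarrow> affine_reflection \<alpha> 0 \<beta> \<in> \<Phi>"
  using root_system by (auto simp: crystallographic_root_system_def)

lemma root_coroot_Ints: "\<alpha> \<in> \<Phi> \<Longrightarrow> \<beta> \<in> \<Phi> \<Longrightarrow> \<beta> \<bullet> coroot \<alpha> \<in> \<int>"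
  using root_system by (auto simp: crystallographic_root_system_def)

lemma root_multiple:
  assumes "\<alpha> \<in> \<Phi>" "c *\<^sub>R \<alpha> \<in> \<Phi>" shows "c *\<^sub>R \<alpha> = \<alpha> \<or> c *\<^sub>R \<alpha> = - \<alpha>"
proof -
  have "\<Phi> \<inter> range (\<lambda>c. c *\<^sub>R \<alpha>) = {\<alpha>, - \<alpha>}"
    using root_system assms(1) by (auto simp: crystallographic_root_system_def)
  with assms(2) show ?thesis by blast
qed

lemma root_parallel:
  assumes "\<alpha> \<in> \<Phi>" "\<beta> \<in> \<Phi>" "(\<alpha> \<bullet> \<beta>)\<^sup>2 = (\<alpha> \<bullet> \<alpha>) * (\<beta> \<bullet> \<beta>)"
  shows "\<beta> = \<alpha> \<or> \<beta> = - \<alpha>"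
proof -
  let ?c = "(\<alpha> \<bullet> \<beta>) / (\<alpha> \<bullet> \<alpha>)"
  let ?z = "\<beta> - ?c *\<^sub>R \<alpha>"
  have p: "0 < \<alpha> \<bullet> \<alpha>" using assms root_inner_pos by auto
  have "?z \<bullet> ?z = \<beta> \<bullet> \<beta> - (\<alpha> \<bullet> \<beta>)\<^sup>2 / (\<alpha> \<bullet> \<alpha>)"
    using p by (simp add: inner_simps inner_commute[of \<beta> \<alpha>] power2_eq_square)
  also have "\<dots> = 0" using p by (simp add: assms(3))
  finally have "\<beta> = ?c *\<^sub>R \<alpha>" by simp
  then show ?thesis using root_multiple[of \<alpha> ?c] assms by simp
qed

lemma root_component_self: "\<alpha> \<in> root_component \<Phi> \<alpha>"
  by (simp add: root_component_def)

lemma root_component_eq: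
  assumes "\<beta> \<in> root_component \<Phi> \<alpha>" shows "root_component \<Phi> \<beta> = root_component \<Phi> \<alpha>"
proof -
  let ?r = "{(\<alpha>, \<beta>). \<alpha> \<in> \<Phi> \<and> \<beta> \<in> \<Phi> \<and> \<alpha> \<bullet> \<beta> \<noteq> 0}"
  have "sym (?r\<^sup>*)" by (intro sym_rtrancl) (auto simp: sym_def inner_commute)
  then have "(\<alpha>, \<beta>) \<in> ?r\<^sup>*" "(\<beta>, \<alpha>) \<in> ?r\<^sup>*"
    using assms by (auto simp: root_component_def dest: symD)
  then show ?thesis unfolding root_component_def by (auto intro: rtrancl_trans)
qed

lemma root_component_link:
  assumes "\<alpha> \<in> \<Phi>" "\<beta> \<in> \<Phi>" "\<alpha> \<bullet> \<beta> \<noteq> 0"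
  shows "root_component \<Phi> \<beta> = root_component \<Phi> \<alpha>"
  using assms by (intro root_component_eq) (auto simp: root_component_def)

text \<open>If \<alpha> and \<beta> are not orthogonal, both \<beta> and its mirror image are linked
  to \<alpha>; otherwise \<beta> is not moved.\<close>

lemma root_component_reflection:
  assumes "\<alpha> \<in> \<Phi>" "\<beta> \<in> \<Phi>"
  shows "root_component \<Phi> (affine_reflection \<alpha> 0 \<beta>) = root_component \<Phi> \<beta>"
proof (cases "\<alpha> \<bullet> \<beta> = 0")
  case True
  then show ?thesis by (simp add: affine_reflection_def inner_commute)
next
  case False
  have "\<alpha> \<bullet> affine_reflection \<alpha> 0 \<beta> = - (\<alpha> \<bullet> \<beta>)"
    using root_inner_pos[OF assms(1)] by (simp add: affine_reflection_def coroot_def inner_simps inner_commute)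
  then have "root_component \<Phi> (affine_reflection \<alpha> 0 \<beta>) = root_component \<Phi> \<alpha>"
    using False assms by (intro root_component_link root_reflection) auto
  also have "\<dots> = root_component \<Phi> \<beta>" using root_component_link[OF assms False] by simp
  finally show ?thesis .
qed

text \<open>Unlike \<open>root_component \<Phi> \<alpha>\<close>, the description \<open>{\<beta> \<in> \<Phi>. root_component \<Phi> \<beta> = C}\<close> gives a closed set
  of roots for an arbitrary \<open>C\<close>, possibly the empty one.\<close>

definition roots_of :: "'v set \<Rightarrow> 'v set" where
  "roots_of C = {\<beta> \<in> \<Phi>. root_component \<Phi> \<beta> = C}"

lemma roots_of_reflection:
  "\<alpha> \<in> roots_of C \<Longrightarrow> \<beta> \<in> roots_of C \<Longrightarrow> affine_reflection \<alpha> 0 \<beta> \<in> roots_of C"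
  by (auto simp: roots_of_def root_reflection root_component_reflection)

lemma reflection_affine_roots:
  assumes "a \<in> affine_roots \<Phi>" "b \<in> affine_roots \<Phi>"
  shows "affine.reflection a b \<in> affine_roots \<Phi>"
proof -
  obtain \<alpha> k \<beta> l where ab: "a = (\<alpha>, - of_int k, 0)" "b = (\<beta>, - of_int l, 0)" "\<alpha> \<in> \<Phi>" "\<beta> \<in> \<Phi>"
    using assms by (auto simp: affine_roots_def)
  obtain n where n: "\<beta> \<bullet> coroot \<alpha> = of_int n"
    using root_coroot_Ints[OF ab(3,4)] by (auto elim: Ints_cases)
  have "affine.reflection a b = (affine_reflection \<alpha> 0 \<beta>, - of_int (l - n * k), 0)"
    unfolding ab reflection_affine_root n by simp
  then show ?thesis using root_reflection[OF ab(3,4)] unfolding affine_roots_def by blast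
qed

text \<open>On vectors with last coordinate 0 the form is the inner product of the first
  coordinates, so (0, 1, 0) spans the radical there and the axioms reduce to properties of
  \<Phi>.\<close>

lemma affine_root_space_component:
  "affine_root_space affine_form (affine_roots (roots_of C)) (0, 1, 0)"
proof
  let ?R = "affine_roots (roots_of C)"
  have R: "?R \<subseteq> affine_roots \<Phi>" by (auto simp: affine_roots_def roots_of_def)
  have sp: "snd (snd x) = 0" if "x \<in> span ?R" for x
    using that by (induction rule: span_induct_alt) (auto simp: affine_roots_def)
  show "0 < affine_form a a" if "a \<in> ?R" for a
    using that root_inner_pos by (auto simp: affine_roots_def roots_of_def affine_form_def)
  show "affine.reflection a b \<in> ?R" if "a \<in> ?R" "b \<in> ?R" for a b
  proof (rule affine_roots_mono)
    show "affine.reflection a b \<in> affine_roots \<Phi>" using that R by (intro reflection_affine_roots) auto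
    show "fst (affine.reflection a b) \<in> roots_of C"
      using that roots_of_reflection[of "fst a" C "fst b"]
      by (auto simp: affine_roots_def reflection_affine_root)
  qed
  show "2 * affine_form b a / affine_form a a \<in> \<int>" if "a \<in> ?R" "b \<in> ?R" for a b
    using that root_coroot_Ints[of "fst a" "fst b"]
    by (auto simp: affine_roots_def roots_of_def affine_form_def coroot_def)
  show "affine_form a a = affine_form b b"
    if "a \<in> ?R" "b \<in> ?R" "(affine_form a b)\<^sup>2 = affine_form a a * affine_form b b" for a b
    using that root_parallel[of "fst a" "fst b"]
    by (auto simp: affine_roots_def roots_of_def affine_form_def)
  show "0 \<le> affine_form x x" if "x \<in> span ?R" for x
    using sp[OF that] by (simp add: affine_form_def)
  show "\<exists>c. x = c *\<^sub>R (0, 1, 0)" if "x \<in> span ?R" "affine_form x x = 0" for x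
    using that(2) sp[OF that(1)] by (intro exI[of _ "fst (snd x)"]) (simp add: affine_form_def prod_eq_iff)
  show "affine_form (0, 1, 0) x = 0" if "x \<in> span ?R" for x
    using sp[OF that] by (simp add: affine_form_def)
  show "(0, 1, 0) \<noteq> (0 :: 'v \<times> real \<times> real)" by (simp add: prod_eq_iff)
  show "\<exists>F. finite F \<and> (\<forall>a\<in>?R. \<exists>b\<in>F. \<exists>c. a = b + c *\<^sub>R (0, 1, 0))"
    by (rule exI[of _ "(\<lambda>\<alpha>. (\<alpha>, 0, 0)) ` \<Phi>"])
      (auto simp: affine_roots_def roots_of_def finite_roots)
qed

end

section \<open>Deformations of the generating reflections\<close>

text \<open>Reflecting neighbouring integers in each other shows that second differences
  vanish.\<close>

lemma int_arithmetic_progression: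
  fixes f :: "int \<Rightarrow> real"
  assumes "\<And>k l. f (2 * l - k) = 2 * f l - f k"
  shows "f k = f 0 + of_int k * (f 1 - f 0)"
proof -
  have up: "f (k + 2) = 2 * f (k + 1) - f k" for k using assms[of "k + 1" k] by (simp add: algebra_simps)
  have down: "f (k - 1) = 2 * f k - f (k + 1)" for k using assms[of k "k + 1"] by (simp add: algebra_simps)
  have "f k = f 0 + of_int k * (f 1 - f 0) \<and> f (k + 1) = f 0 + of_int (k + 1) * (f 1 - f 0)"
  proof (induction k rule: int_induct[where k = 0])
    case (step1 i)
    then show ?case using up[of i] by (simp add: algebra_simps)
  next
    case (step2 i)
    then show ?case using down[of i] by (simp add: algebra_simps)
  qed simp
  then show ?thesis ..
qed

lemma affine_reflection_0: "affine_reflection \<alpha> 0 v = v - (v \<bullet> \<alpha>) *\<^sub>R coroot \<alpha>"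
  by (simp add: affine_reflection_def)

lemma linear_affine_reflection_0: "linear (affine_reflection \<alpha> 0)"
  by (rule linearI) (simp_all add: affine_reflection_0 algebra_simps inner_simps)

lemma affine_reflection_0_self: "\<alpha> \<noteq> 0 \<Longrightarrow> affine_reflection \<alpha> 0 \<alpha> = - \<alpha>"
  by (simp add: affine_reflection_0 coroot_def scaleR_2)

lemma affine_reflection_0_inner:
  "affine_reflection \<alpha> 0 v \<bullet> affine_reflection \<alpha> 0 w = v \<bullet> w"
  using affine.q_reflection[of "(\<alpha>, 0, 0)" "(v, 0, 0)" "(w, 0, 0)"]
    reflection_affine_root[of \<alpha> 0 v 0] reflection_affine_root[of \<alpha> 0 w 0]
  by (simp add: affine_form_def)

lemma coroot_affine_reflection_0:
  "coroot (affine_reflection \<alpha> 0 \<beta>) = affine_reflection \<alpha> 0 (coroot \<beta>)"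
  by (simp add: coroot_def[of \<beta>] coroot_def[of "affine_reflection \<alpha> 0 \<beta>"] affine_reflection_0_inner
      linear_scale[OF linear_affine_reflection_0])

context root_system
begin

lemma component_constant:
  assumes link: "\<And>\<alpha> \<beta>. \<alpha> \<in> \<Phi> \<Longrightarrow> \<beta> \<in> \<Phi> \<Longrightarrow> \<alpha> \<bullet> \<beta> \<noteq> 0 \<Longrightarrow> g \<alpha> = g \<beta>"
    and "\<alpha> \<in> roots_of C" "\<beta> \<in> roots_of C"
  shows "g \<alpha> = g \<beta>"
proof -
  have "\<beta> \<in> root_component \<Phi> \<alpha>" using assms(2,3) root_component_self[of \<beta>] by (simp add: roots_of_def)
  then have "(\<alpha>, \<beta>) \<in> {(\<alpha>, \<beta>). \<alpha> \<in> \<Phi> \<and> \<beta> \<in> \<Phi> \<and> \<alpha> \<bullet> \<beta> \<noteq> 0}\<^sup>*" by (simp add: root_component_def)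
  then show ?thesis by induction (auto dest: link)
qed

lemma root_reflection_bij:
  assumes "\<beta> \<in> \<Phi>" shows "bij_betw (affine_reflection \<beta> 0) \<Phi> \<Phi>"
proof -
  have "\<beta> \<noteq> 0" using assms zero_not_root by auto
  then show ?thesis
    using root_reflection[OF assms]
    by (intro bij_betw_byWitness[of _ "affine_reflection \<beta> 0"])
      (auto simp: affine_reflection_involution)
qed

text \<open>The sum of the differences between \<open>x\<close> and its mirror images. It commutes
  with all reflections and, as in Schur's lemma, acts on each component by a scalar.\<close>

definition root_operator :: "'v \<Rightarrow> 'v" where
  "root_operator x = (\<Sum>\<alpha>\<in>\<Phi>. (x \<bullet> \<alpha>) *\<^sub>R coroot \<alpha>)"

lemma linear_root_operator: "linear root_operator"
  unfolding root_operator_def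
  by (rule linearI) (simp_all add: inner_simps algebra_simps sum.distrib scaleR_sum_right)

lemma root_operator_reflection:
  assumes "\<beta> \<in> \<Phi>"
  shows "root_operator (affine_reflection \<beta> 0 x) = affine_reflection \<beta> 0 (root_operator x)"
proof -
  let ?s = "affine_reflection \<beta> 0"
  have "root_operator (?s x) = (\<Sum>\<alpha>\<in>\<Phi>. (?s x \<bullet> ?s \<alpha>) *\<^sub>R coroot (?s \<alpha>))"
    unfolding root_operator_def
    by (rule sum.reindex_bij_betw[OF root_reflection_bij[OF assms], symmetric])
  also have "\<dots> = (\<Sum>\<alpha>\<in>\<Phi>. ?s ((x \<bullet> \<alpha>) *\<^sub>R coroot \<alpha>))"
    by (simp add: affine_reflection_0_inner coroot_affine_reflection_0
        linear_scale[OF linear_affine_reflection_0])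
  also have "\<dots> = ?s (root_operator x)"
    by (simp add: root_operator_def linear_sum[OF linear_affine_reflection_0])
  finally show ?thesis .
qed

definition root_eigenvalue :: "'v \<Rightarrow> real" where
  "root_eigenvalue \<beta> = (root_operator \<beta> \<bullet> \<beta>) / (\<beta> \<bullet> \<beta>)"

text \<open>The operator preserves the (-1)-eigenspace of the reflection in \<beta>, which is the
  line through \<beta>.\<close>

lemma root_operator_eigenvector:
  assumes "\<beta> \<in> \<Phi>" shows "root_operator \<beta> = root_eigenvalue \<beta> *\<^sub>R \<beta>"
proof -
  have b: "\<beta> \<noteq> 0" using assms zero_not_root by auto
  have "- root_operator \<beta> = root_operator (affine_reflection \<beta> 0 \<beta>)"
    by (simp add: affine_reflection_0_self b linear_neg[OF linear_root_operator])
  also have "\<dots> = root_operator \<beta> - (root_operator \<beta> \<bullet> \<beta>) *\<^sub>R coroot \<beta>"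
    unfolding root_operator_reflection[OF assms] by (rule affine_reflection_0)
  finally have "2 *\<^sub>R root_operator \<beta> = (root_operator \<beta> \<bullet> \<beta>) *\<^sub>R coroot \<beta>"
    by (simp add: scaleR_2 algebra_simps)
  also have "\<dots> = 2 *\<^sub>R (root_eigenvalue \<beta> *\<^sub>R \<beta>)" by (simp add: coroot_def root_eigenvalue_def)
  finally show ?thesis by (metis scaleR_cancel_left zero_neq_numeral)
qed

lemma root_eigenvalue_pos:
  assumes "\<beta> \<in> \<Phi>" shows "0 < root_eigenvalue \<beta>"
proof -
  have "root_operator \<beta> \<bullet> \<beta> = (\<Sum>\<alpha>\<in>\<Phi>. 2 * (\<beta> \<bullet> \<alpha>)\<^sup>2 / (\<alpha> \<bullet> \<alpha>))"
    unfolding root_operator_def inner_sum_left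
    by (rule sum.cong) (simp_all add: coroot_def power2_eq_square inner_commute[of _ \<beta>])
  also have "\<dots> > 0"
    using assms root_inner_pos[OF assms] finite_roots root_inner_pos
    by (intro sum_pos2[of _ \<beta>]) (auto simp: power2_eq_square)
  finally show ?thesis using root_inner_pos[OF assms] by (simp add: root_eigenvalue_def)
qed

text \<open>Evaluate the operator on the mirror image \<alpha> - t \<beta> in two ways and compare
  the multiples of \<beta>.\<close>

lemma root_eigenvalue_link:
  assumes ab: "\<alpha> \<in> \<Phi>" "\<beta> \<in> \<Phi>" "\<alpha> \<bullet> \<beta> \<noteq> 0"
  shows "root_eigenvalue \<alpha> = root_eigenvalue \<beta>"
proof -
  define t where "t = 2 * (\<alpha> \<bullet> \<beta>) / (\<beta> \<bullet> \<beta>)"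
  have t: "t \<noteq> 0" using ab root_inner_pos[OF ab(2)] by (simp add: t_def)
  have s: "affine_reflection \<beta> 0 \<alpha> = \<alpha> - t *\<^sub>R \<beta>" by (simp add: affine_reflection_0 coroot_def t_def)
  have b: "\<beta> \<noteq> 0" using ab zero_not_root by auto
  have "root_eigenvalue \<alpha> *\<^sub>R \<alpha> - (t * root_eigenvalue \<beta>) *\<^sub>R \<beta> = root_operator (affine_reflection \<beta> 0 \<alpha>)"
    by (simp add: s linear_diff[OF linear_root_operator] linear_scale[OF linear_root_operator]
        root_operator_eigenvector ab)
  also have "\<dots> = root_eigenvalue \<alpha> *\<^sub>R (\<alpha> - t *\<^sub>R \<beta>)"
    unfolding root_operator_reflection[OF ab(2)] root_operator_eigenvector[OF ab(1)]
    by (simp only: linear_scale[OF linear_affine_reflection_0] s)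
  finally have "(t * root_eigenvalue \<beta>) *\<^sub>R \<beta> = (t * root_eigenvalue \<alpha>) *\<^sub>R \<beta>"
    by (simp add: scaleR_diff_right mult.commute)
  then show ?thesis using b t by simp
qed

text \<open>The offsets of the hyperplanes after a deformation of the reflections that keeps the linear
  parts and the conjugation relations between them.\<close>

definition root_potential :: "('v \<times> real \<times> real \<Rightarrow> real) \<Rightarrow> bool" where
  "root_potential y \<longleftrightarrow> (\<forall>\<alpha>\<in>\<Phi>. \<forall>\<beta>\<in>\<Phi>. \<forall>k l. 
    y (affine.reflection (\<beta>, - of_int l, 0) (\<alpha>, - of_int k, 0)) =
    y (\<alpha>, - of_int k, 0) - (\<alpha> \<bullet> coroot \<beta>) * y (\<beta>, - of_int l, 0))"

text \<open>Within a component the offsets are affine in the level \<open>k\<close> with a common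
  slope (a scaling), and their constant terms are compatible with reflections, hence given by
  pairing with one vector (a translation).\<close>

lemma root_potential_linear:
  assumes y: "root_potential y"
  obtains u where "\<And>a. a \<in> affine_roots (roots_of C) \<Longrightarrow> y a = affine_form u a"
proof -
  define Y where "Y = (\<lambda>\<alpha> k. y (\<alpha>, - real_of_int k, 0))"
  define A where "A = (\<lambda>\<alpha>. Y \<alpha> 0)"
  define c where "c = (\<lambda>\<alpha>. Y \<alpha> 1 - Y \<alpha> 0)"
  have Y: "Y (affine_reflection \<beta> 0 \<alpha>) (k - n * l) = Y \<alpha> k - of_int n * Y \<beta> l"
    if "\<alpha> \<in> \<Phi>" "\<beta> \<in> \<Phi>" "\<alpha> \<bullet> coroot \<beta> = of_int n" for \<alpha> \<beta> k l n
    using y that unfolding root_potential_def Y_def reflection_affine_root by force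
  have self: "\<alpha> \<bullet> coroot \<alpha> = of_int 2" "affine_reflection \<alpha> 0 \<alpha> = - \<alpha>" if "\<alpha> \<in> \<Phi>" for \<alpha>
    using that root_inner_pos[OF that] zero_not_root
    by (auto simp: coroot_def intro!: affine_reflection_0_self)
  have neg: "Y (- \<alpha>) (k - 2 * l) = Y \<alpha> k - 2 * Y \<alpha> l" if "\<alpha> \<in> \<Phi>" for \<alpha> k l
    using Y[OF that that self(1)[OF that], of k l] self(2)[OF that] by simp
  \<comment> \<open>Reflecting one hyperplane of \<alpha> in a parallel one turns the potential
    condition into a symmetry of \<open>Y \<alpha>\<close> on the integers.\<close>
  have lin: "Y \<alpha> k = A \<alpha> + of_int k * c \<alpha>" if "\<alpha> \<in> \<Phi>" for \<alpha> k
    unfolding A_def c_def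
  proof (rule int_arithmetic_progression)
    fix k l
    have "Y (- \<alpha>) (k - 2 * l) = - Y \<alpha> (2 * l - k)" using neg[OF that, of "2 * l - k" "2 * l - k"] by simp
    then show "Y \<alpha> (2 * l - k) = 2 * Y \<alpha> l - Y \<alpha> k" using neg[OF that, of k l] by simp
  qed
  have A: "A (affine_reflection \<beta> 0 \<alpha>) = A \<alpha> - (\<alpha> \<bullet> coroot \<beta>) * A \<beta>"
    if ab: "\<alpha> \<in> \<Phi>" "\<beta> \<in> \<Phi>" for \<alpha> \<beta>
  proof -
    obtain n where n: "\<alpha> \<bullet> coroot \<beta> = of_int n" using root_coroot_Ints[OF ab(2,1)] by (auto elim: Ints_cases)
    show ?thesis using Y[OF ab n, of 0 0] by (simp add: A_def n)
  qed
  \<comment> \<open>Shifting the hyperplane of \<alpha> compares the slope of the mirror image with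
    that of \<alpha>; shifting the mirror compares it with that of \<beta>.\<close>
  have c: "c \<alpha> = c \<beta>" if ab: "\<alpha> \<in> \<Phi>" "\<beta> \<in> \<Phi>" "\<alpha> \<bullet> \<beta> \<noteq> 0" for \<alpha> \<beta>
  proof -
    obtain n where n: "\<alpha> \<bullet> coroot \<beta> = of_int n" using root_coroot_Ints[OF ab(2,1)] by (auto elim: Ints_cases)
    have "n \<noteq> 0" using n ab root_inner_pos[OF ab(2)] by (auto simp: coroot_def)
    let ?\<gamma> = "affine_reflection \<beta> 0 \<alpha>"
    have g: "?\<gamma> \<in> \<Phi>" using root_reflection ab by blast
    have "c ?\<gamma> = c \<alpha>"
      using Y[OF ab(1,2) n, of 0 0] Y[OF ab(1,2) n, of 1 0] by (simp add: lin g ab)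
    moreover have "A ?\<gamma> = A \<alpha> - of_int n * A \<beta>" using A[OF ab(1,2)] by (simp add: n)
    then have "of_int n * c ?\<gamma> = of_int n * c \<beta>"
      using Y[OF ab(1,2) n, of 0 1]
      by (simp only: lin[OF g] lin[OF ab(1)] lin[OF ab(2)]) (auto simp: algebra_simps)
    ultimately show ?thesis using \<open>n \<noteq> 0\<close> by simp
  qed
  \<comment> \<open>The translation vector up to the eigenvalue of \<open>root_operator\<close>:
    reindexing this sum by the reflection in \<beta> isolates \<open>A \<beta>\<close>.\<close>
  define v where "v = (\<Sum>\<alpha>\<in>\<Phi>. A \<alpha> *\<^sub>R coroot \<alpha>)"
  have v: "v \<bullet> \<beta> = root_eigenvalue \<beta> * A \<beta>" if b: "\<beta> \<in> \<Phi>" for \<beta>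
  proof -
    let ?s = "affine_reflection \<beta> 0"
    have b0: "\<beta> \<noteq> 0" using b zero_not_root by auto
    have i: "?s x \<bullet> \<beta> = - (x \<bullet> \<beta>)" for x
      using affine_reflection_0_inner[of \<beta> x \<beta>] by (simp add: affine_reflection_0_self b0)
    have vb: "v \<bullet> \<beta> = (\<Sum>\<alpha>\<in>\<Phi>. A \<alpha> * (coroot \<alpha> \<bullet> \<beta>))" by (simp add: v_def inner_sum_left)
    also have "\<dots> = (\<Sum>\<alpha>\<in>\<Phi>. A (?s \<alpha>) * (coroot (?s \<alpha>) \<bullet> \<beta>))"
      by (rule sum.reindex_bij_betw[OF root_reflection_bij[OF b], symmetric])
    also have "\<dots> = (\<Sum>\<alpha>\<in>\<Phi>. - (A \<alpha> * (coroot \<alpha> \<bullet> \<beta>)) + A \<beta> * ((\<alpha> \<bullet> coroot \<beta>) * (coroot \<alpha> \<bullet> \<beta>)))"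
      by (rule sum.cong) (simp_all add: A b coroot_affine_reflection_0 i algebra_simps)
    also have "\<dots> = - (v \<bullet> \<beta>) + A \<beta> * (root_operator (coroot \<beta>) \<bullet> \<beta>)"
      by (simp only: sum.distrib sum_negf vb root_operator_def inner_sum_left inner_scaleR_left
          sum_distrib_left inner_commute[of "coroot \<beta>"])
    also have "root_operator (coroot \<beta>) \<bullet> \<beta> = 2 * root_eigenvalue \<beta>"
      using root_inner_pos[OF b]
      by (simp add: coroot_def linear_scale[OF linear_root_operator] root_operator_eigenvector b)
    finally show ?thesis by simp
  qed
  show thesis
  proof (cases "roots_of C = {}")
    case True
    then show thesis using that[of 0] by (simp add: affine_roots_def)
  next
    case False
    then obtain \<gamma> where \<gamma>: "\<gamma> \<in> roots_of C" by blast
    \<comment> \<open>The last coordinate pairs with the entry -k of an affine root, hence the sign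
      of \<open>c \<gamma>\<close>.\<close>
    let ?u = "((1 / root_eigenvalue \<gamma>) *\<^sub>R v, 0, - c \<gamma>)"
    have "y a = affine_form ?u a" if a: "a \<in> affine_roots (roots_of C)" for a
    proof -
      obtain \<alpha> k where \<alpha>: "a = (\<alpha>, - of_int k, 0)" "\<alpha> \<in> roots_of C" using a by (auto simp: affine_roots_def)
      then have \<alpha>\<Phi>: "\<alpha> \<in> \<Phi>" by (simp add: roots_of_def)
      have "c \<alpha> = c \<gamma>" by (rule component_constant[of c, OF c \<alpha>(2) \<gamma>])
      moreover have "root_eigenvalue \<alpha> = root_eigenvalue \<gamma>"
        by (rule component_constant[of root_eigenvalue, OF root_eigenvalue_link \<alpha>(2) \<gamma>])
      ultimately show ?thesis
        using lin[OF \<alpha>\<Phi>, of k] v[OF \<alpha>\<Phi>] root_eigenvalue_pos[OF \<alpha>\<Phi>]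
        by (simp add: \<alpha>(1) Y_def affine_form_def field_simps)
    qed
    then show thesis by (rule that)
  qed
qed

text \<open>Prescribing offset 1 for \<open>s\<close> and 0 for all others gives a potential that is
  linear on the component; as a functional it extracts the coefficient of \<open>s\<close> from a
  relation.\<close>

lemma deformable_indep:
  assumes S: "S \<subseteq> affine_roots \<Phi>" "finite S"
    and deform: "\<And>x. \<exists>y. root_potential y \<and> (\<forall>s\<in>S. y s = x s)"
  shows "independent {s \<in> S. fst s \<in> roots_of C}"
proof (rule independent_if_scalars_zero)
  let ?S = "{s \<in> S. fst s \<in> roots_of C}"
  show "finite ?S" using S by simp
  fix f s assume f: "(\<Sum>t\<in>?S. f t *\<^sub>R t) = 0" and s: "s \<in> ?S"
  obtain y where y: "root_potential y" "\<forall>t\<in>S. y t = (if t = s then 1 else 0)"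
    using deform[of "\<lambda>t. if t = s then 1 else 0"] by blast
  obtain u where u: "\<And>a. a \<in> affine_roots (roots_of C) \<Longrightarrow> y a = affine_form u a"
    using root_potential_linear[OF y(1)] by blast
  have "affine_form u t = (if t = s then 1 else 0)" if "t \<in> ?S" for t
    using u[of t] y(2) that S(1) affine_roots_mono[of t \<Phi> "roots_of C"] by auto
  then have "(\<Sum>t\<in>?S. f t * affine_form u t) = (\<Sum>t\<in>?S. f t * (if t = s then 1 else 0))"
    by (intro sum.cong) auto
  also have "\<dots> = f s" using s S(2) by (simp add: if_distrib sum.delta cong: if_cong)
  finally have "f s = affine_form u (\<Sum>t\<in>?S. f t *\<^sub>R t)" by (simp add: affine.q_sum)
  then show "f s = 0" by (simp add: f)
qed

end

section \<open>Homomorphisms from a Coxeter group\<close>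

lemma hom_presented_group_word:
  assumes "group G" and h: "h \<in> hom (presented_group S Rel) G" and S: "S \<subseteq> carrier G"
    and hs: "\<And>s. s \<in> S \<Longrightarrow> h (word_cong S Rel `` {[(s, True)]}) = s"
    and u: "u \<in> gen_words S"
  shows "h (word_cong S Rel `` {u}) = word_eval G (\<lambda>s. s) u"
proof -
  interpret G: group G by fact
  let ?P = "presented_group S Rel" and ?c = "\<lambda>u. word_cong S Rel `` {u}"
  have car: "?c v \<in> carrier ?P" if "v \<in> gen_words S" for v
    using that by (simp add: presented_group_def quotientI)
  have one: "h (?c []) = \<one>\<^bsub>G\<^esub>"
    using hom_one[OF h group_presented_group \<open>group G\<close>] by (simp add: presented_group_def)
  have mult: "h (?c (v @ w)) = h (?c v) \<otimes>\<^bsub>G\<^esub> h (?c w)" if "v \<in> gen_words S" "w \<in> gen_words S" for v w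
    using hom_mult[OF h car[OF that(1)] car[OF that(2)]] presented_mult[OF that] by simp
  show ?thesis using u
  proof (induction u rule: list.induct)
    case Nil
    then show ?case by (simp add: one)
  next
    case (Cons p u)
    obtain s b where p: "p = (s, b)" by force
    have s: "s \<in> S" "u \<in> gen_words S" using Cons.prems p by auto
    have "h (?c [(s, b)]) = (if b then s else inv\<^bsub>G\<^esub> s)"
    proof (cases b)
      case False
      have "([] @ [(s, False), (s, \<not> False)] @ [], [] @ []) \<in> word_cong S Rel"
        by (rule word_cong.cancel) (use s in auto)
      then have "?c ([(s, False)] @ [(s, True)]) = ?c []"
        by (intro equiv_class_eq[OF equiv_word_cong]) simp
      then have "h (?c [(s, False)]) \<otimes>\<^bsub>G\<^esub> s = \<one>\<^bsub>G\<^esub>"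
        using mult[of "[(s, False)]" "[(s, True)]"] s one hs by simp
      moreover have "h (?c [(s, False)]) \<in> carrier G"
        using hom_in_carrier[OF h] car[of "[(s, False)]"] s by auto
      ultimately show ?thesis using False s S G.inv_equality[of "h (?c [(s, False)])" s] by auto
    qed (use hs s in simp)
    then show ?case using mult[of "[(s, b)]" u] Cons.IH s by (simp add: p)
  qed
qed

lemma (in group) word_eval_in_generate:
  "S \<subseteq> carrier G \<Longrightarrow> u \<in> gen_words S \<Longrightarrow> word_eval G (\<lambda>s. s) u \<in> generate G S"
proof (induction u)
  case (Cons p u)
  obtain s b where p: "p = (s, b)" by force
  have "(if b then s else inv s) \<in> generate G S"
    using Cons.prems p by (auto intro: generate.incl generate.inv)
  then show ?case using Cons p by (auto intro: generate.eng)
qed (simp add: generate.one)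

lemma (in group) word_eval_power:
  assumes "f s \<in> carrier G" "f t \<in> carrier G"
  shows "word_eval G f (concat (replicate k [(s, True), (t, True)])) = (f s \<otimes> f t) [^] k"
proof (induction k)
  case (Suc k)
  have "(f s \<otimes> f t) [^] Suc k = (f s \<otimes> f t) \<otimes> (f s \<otimes> f t) [^] k"
    using assms by (intro nat_pow_Suc2) simp
  then show ?case using Suc assms by (simp add: m_assoc)
qed simp

lemma coxeter_system_generate:
  assumes "coxeter_system W S" shows "generate W S = carrier W"
proof -
  obtain m h where h: "h \<in> iso (presented_group S (coxeter_relations S m)) W"
    and hs: "\<forall>s\<in>S. h (word_cong S (coxeter_relations S m) `` {[(s, True)]}) = s"
    and W: "group W" "S \<subseteq> carrier W"
    using assms unfolding coxeter_system_def by blast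
  interpret W: group W by fact
  let ?Rel = "coxeter_relations S m"
  have "w \<in> generate W S" if w: "w \<in> carrier W" for w
  proof -
    have "w \<in> h ` carrier (presented_group S ?Rel)" using h w by (auto simp: iso_def bij_betw_def)
    then obtain u where u: "u \<in> gen_words S" "w = h (word_cong S ?Rel `` {u})"
      by (auto simp: presented_group_def elim!: quotientE)
    have "h \<in> hom (presented_group S ?Rel) W" using h by (simp add: iso_def)
    from hom_presented_group_word[OF W(1) this W(2) _ u(1)] hs W.word_eval_in_generate[OF W(2) u(1)]
    show ?thesis by (simp add: u(2))
  qed
  then show ?thesis using W.generate_incl[OF W(2)] by blast
qed

text \<open>Universal property of the presentation. \<open>rel\<close> ranges over all exponents
  because the Coxeter matrix is hidden behind an existential quantifier.\<close>

lemma coxeter_system_hom: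
  assumes cox: "coxeter_system W S" and B: "group B" and F: "F ` S \<subseteq> carrier B"
    and rel: "\<And>s t k. s \<in> S \<Longrightarrow> t \<in> S \<Longrightarrow> (s \<otimes>\<^bsub>W\<^esub> t) [^]\<^bsub>W\<^esub> (k :: nat) = \<one>\<^bsub>W\<^esub> \<Longrightarrow>
      (F s \<otimes>\<^bsub>B\<^esub> F t) [^]\<^bsub>B\<^esub> k = \<one>\<^bsub>B\<^esub>"
  obtains f where "f \<in> hom W B" "\<And>s. s \<in> S \<Longrightarrow> f s = F s"
proof -
  obtain m h where h: "h \<in> iso (presented_group S (coxeter_relations S m)) W"
    and hs: "\<forall>s\<in>S. h (word_cong S (coxeter_relations S m) `` {[(s, True)]}) = s"
    and W: "group W" "S \<subseteq> carrier W"
    using cox unfolding coxeter_system_def by blast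
  interpret W: group W by fact
  interpret B: group B by fact
  let ?Rel = "coxeter_relations S m"
  let ?P = "presented_group S ?Rel" and ?c = "\<lambda>u. word_cong S ?Rel `` {u}"
  have hom: "h \<in> hom ?P W" using h by (simp add: iso_def)
  have R: "word_eval B F u = word_eval B F v" if uv: "(u, v) \<in> ?Rel" for u v
  proof -
    obtain s t where st: "s \<in> S" "t \<in> S" "u = concat (replicate (m s t) [(s, True), (t, True)])" "v = []"
      using uv unfolding coxeter_relations_def by blast
    have "concat (replicate k [(s, True), (t, True)]) \<in> gen_words S" for k
      by (induction k) (use st(1,2) in auto)
    then have ug: "u \<in> gen_words S" by (simp only: st(3))
    have "(u, v) \<in> word_cong S ?Rel"
      using word_cong.relation[OF _ _ uv ug, of "[]" "[]"] st(4) by simp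
    then have "h (?c u) = h (?c v)" using equiv_class_eq[OF equiv_word_cong] by metis
    then have "word_eval W (\<lambda>s. s) u = \<one>\<^bsub>W\<^esub>"
      using hom_presented_group_word[OF W(1) hom W(2) _ ug] hom_presented_group_word[OF W(1) hom W(2), of "[]"]
        hs st(4) by simp
    moreover have "s \<in> carrier W" "t \<in> carrier W" using st(1,2) W(2) by auto
    ultimately have "(s \<otimes>\<^bsub>W\<^esub> t) [^]\<^bsub>W\<^esub> m s t = \<one>\<^bsub>W\<^esub>"
      using W.word_eval_power[of "\<lambda>s. s" s t "m s t"] st(3) by simp
    from rel[OF st(1,2) this] show ?thesis
      using B.word_eval_power[of F s t "m s t"] st F by auto
  qed
  let ?f = "presented_hom B F \<circ> inv_into (carrier ?P) h"
  have "inv_into (carrier ?P) h \<in> iso W ?P" using group.iso_set_sym[OF group_presented_group h] .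
  then have "?f \<in> hom W B"
    using B.presented_hom_hom[OF F R] by (intro hom_compose[of _ W ?P]) (auto simp: iso_def)
  moreover have "?f s = F s" if s: "s \<in> S" for s
  proof -
    have w: "[(s, True)] \<in> gen_words S" using s by simp
    have c: "?c [(s, True)] \<in> carrier ?P" using w by (simp add: presented_group_def quotientI)
    have "inj_on h (carrier ?P)" using h by (simp add: iso_def bij_betw_def)
    from inv_into_f_f[OF this c] have "inv_into (carrier ?P) h s = ?c [(s, True)]" using hs s by simp
    then have "?f s = presented_hom B F (?c [(s, True)])" by simp
    also have "\<dots> = F s" using B.presented_hom_class[OF F w R] F s by auto
    finally show ?thesis .
  qed
  ultimately show thesis using that by blast
qed

section \<open>The affine group\<close>

lemma bij_idempotent: "bij f \<Longrightarrow> f \<circ> f = f \<Longrightarrow> f = id"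
  by (metis bij_is_inj comp_apply eq_id_iff injD)

lemma funpow_translate:
  fixes v :: "'a :: group_add"
  assumes "\<And>w. g w = h (w - v) + v"
  shows "(g ^^ j) w = (h ^^ j) (w - v) + v"
  by (induction j) (auto simp: assms)

lemma funpow_add_const:
  fixes c :: "'a :: real_vector"
  assumes "\<And>w. g w = w + c"
  shows "(g ^^ j) w = w + real j *\<^sub>R c"
  by (induction j) (auto simp: assms algebra_simps)

lemma BijGroup_UNIV_mult:
  "bij f \<Longrightarrow> bij g \<Longrightarrow> f \<otimes>\<^bsub>BijGroup UNIV\<^esub> g = f \<circ> g"
  by (auto simp: BijGroup_def Bij_def compose_def fun_eq_iff)

lemma BijGroup_UNIV_carrier: "f \<in> carrier (BijGroup UNIV) \<longleftrightarrow> bij f"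
  by (simp add: BijGroup_def Bij_def)

lemma BijGroup_UNIV_one: "\<one>\<^bsub>BijGroup UNIV\<^esub> = id"
  by (simp add: BijGroup_def fun_eq_iff)

lemma BijGroup_UNIV_pow: "bij f \<Longrightarrow> f [^]\<^bsub>BijGroup UNIV\<^esub> (k :: nat) = f ^^ k"
proof (induction k)
  case (Suc k)
  interpret B: group "BijGroup UNIV" by (rule group_BijGroup)
  have "bij (f ^^ k)" using Suc.prems by (rule bij_fn)
  then have "f [^]\<^bsub>BijGroup UNIV\<^esub> Suc k = f ^^ k \<circ> f" using Suc by (simp add: BijGroup_UNIV_mult)
  then show ?case by (simp add: fun_eq_iff funpow_swap1)
qed (simp add: BijGroup_UNIV_one)

lemma bij_point_reflection: "snd (snd a) = 0 \<Longrightarrow> bij (point_reflection a)"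
  using point_reflection_involution[of a]
  by (intro o_bij[of "point_reflection a"]) (auto simp: fun_eq_iff)

lemma point_reflection_offset:
  assumes "\<alpha> \<noteq> 0" "point_reflection (\<alpha>, x, 0) = point_reflection (\<alpha>, y, 0)"
  shows "x = y"
  using fun_cong[OF assms(2), of 0] assms(1) by (simp add: point_reflection_def coroot_def)

locale affine_dual = root_system \<Phi> + group W
  for \<Phi> :: "'v::euclidean_space set" and W :: "('g, 'm) monoid_scheme" (structure) +
  fixes T :: "'g set" and \<eta> :: "'g \<Rightarrow> 'v \<Rightarrow> 'v"
  assumes T_carrier: "T \<subseteq> carrier W"
    and \<eta>: "\<eta> \<in> iso W (affine_coxeter_group \<Phi>)" and \<eta>_T: "\<eta> ` T = affine_reflections \<Phi>"
begin

lemma \<eta>_bij: "g \<in> carrier W \<Longrightarrow> bij (\<eta> g)"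
proof -
  assume "g \<in> carrier W"
  then have "\<eta> g \<in> carrier (affine_coxeter_group \<Phi>)" using \<eta> by (auto simp: iso_def hom_def)
  then have "\<eta> g \<in> carrier (BijGroup UNIV)"
    unfolding affine_coxeter_group_def
    using group.carrier_subgroup_generated_subset[OF group_BijGroup] by blast
  then show ?thesis by (simp add: BijGroup_UNIV_carrier)
qed

lemma \<eta>_mult: "g \<in> carrier W \<Longrightarrow> h \<in> carrier W \<Longrightarrow> \<eta> (g \<otimes> h) = \<eta> g \<circ> \<eta> h"
proof -
  assume "g \<in> carrier W" "h \<in> carrier W"
  moreover have "\<eta> \<in> hom W (affine_coxeter_group \<Phi>)" using \<eta> by (simp add: iso_def)
  ultimately have "\<eta> (g \<otimes> h) = \<eta> g \<otimes>\<^bsub>BijGroup UNIV\<^esub> \<eta> h"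
    by (simp add: hom_mult affine_coxeter_group_def)
  then show ?thesis using \<open>g \<in> carrier W\<close> \<open>h \<in> carrier W\<close> by (simp add: BijGroup_UNIV_mult \<eta>_bij)
qed

lemma \<eta>_inj: "g \<in> carrier W \<Longrightarrow> h \<in> carrier W \<Longrightarrow> \<eta> g = \<eta> h \<Longrightarrow> g = h"
  using \<eta> by (auto simp: iso_def bij_betw_def dest: inj_onD)

lemma \<eta>_one: "\<eta> \<one> = id"
proof -
  have "\<eta> \<one> \<circ> \<eta> \<one> = \<eta> \<one>" using \<eta>_mult[of \<one> \<one>] by simp
  then show ?thesis using \<eta>_bij[of \<one>] by (intro bij_idempotent) simp_all
qed

lemma \<eta>_pow: "g \<in> carrier W \<Longrightarrow> \<eta> (g [^] (k :: nat)) = \<eta> g ^^ k"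
  by (induction k) (auto simp: \<eta>_one \<eta>_mult fun_eq_iff funpow_swap1)

text \<open>A reflection determines its root only up to sign; one of the two is fixed, and
  \<open>reflection_of\<close> undoes the choice.\<close>

definition root_of :: "'g \<Rightarrow> 'v \<times> real \<times> real" where
  "root_of t = (SOME a. a \<in> affine_roots \<Phi> \<and> \<eta> t = point_reflection a)"

definition reflection_of :: "'v \<times> real \<times> real \<Rightarrow> 'g" where
  "reflection_of a = inv_into T \<eta> (point_reflection a)"

lemma root_of:
  assumes "t \<in> T" shows "root_of t \<in> affine_roots \<Phi>" "\<eta> t = point_reflection (root_of t)"
proof -
  have "\<exists>a. a \<in> affine_roots \<Phi> \<and> \<eta> t = point_reflection a"
    using assms \<eta>_T unfolding affine_reflections_eq by blast
  from someI_ex[OF this] show "root_of t \<in> affine_roots \<Phi>" "\<eta> t = point_reflection (root_of t)"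
    by (simp_all add: root_of_def)
qed

lemma reflection_of:
  assumes "a \<in> affine_roots \<Phi>"
  shows "reflection_of a \<in> T" "reflection_of a \<in> carrier W" "\<eta> (reflection_of a) = point_reflection a"
proof -
  have a: "point_reflection a \<in> \<eta> ` T" using assms \<eta>_T by (simp add: affine_reflections_eq)
  show "reflection_of a \<in> T" "\<eta> (reflection_of a) = point_reflection a"
    unfolding reflection_of_def using inv_into_into[OF a] f_inv_into_f[OF a] by auto
  then show "reflection_of a \<in> carrier W" using T_carrier by auto
qed

lemma reflection_of_root_of: "t \<in> T \<Longrightarrow> reflection_of (root_of t) = t"
  using root_of[of t] reflection_of[of "root_of t"] T_carrier by (intro \<eta>_inj) auto

lemma affine_root_level0: "a \<in> affine_roots \<Phi> \<Longrightarrow> snd (snd a) = 0"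
  by (auto simp: affine_roots_def)

lemma reflection_of_reflection:
  assumes "a \<in> affine_roots \<Phi>" "b \<in> affine_roots \<Phi>"
  shows "reflection_of (affine.reflection b a) = reflection_of b \<otimes> reflection_of a \<otimes> reflection_of b"
proof (rule \<eta>_inj)
  show "\<eta> (reflection_of (affine.reflection b a)) = \<eta> (reflection_of b \<otimes> reflection_of a \<otimes> reflection_of b)"
    using assms reflection_affine_roots[OF assms(2,1)]
    by (simp add: reflection_of \<eta>_mult point_reflection_reflection affine_root_level0 o_assoc)
qed (use assms reflection_affine_roots[OF assms(2,1)] in \<open>auto simp: reflection_of\<close>)

text \<open>Moving the two hyperplanes preserves the order of the product of the reflections: if they are
  not parallel, then it amounts to a translation, and otherwise the order is infinite.\<close>

lemma reflection_relation:
  assumes ab: "a \<in> affine_roots \<Phi>" "b \<in> affine_roots \<Phi>"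
    and k: "(point_reflection a \<circ> point_reflection b) ^^ k = id"
    and same: "point_reflection a = point_reflection b \<Longrightarrow> a = b \<and> x = y"
  shows "(point_reflection (fst a, - x, 0) \<circ> point_reflection (fst b, - y, 0)) ^^ k = id"
proof -
  obtain \<alpha> m where a: "a = (\<alpha>, - of_int m, 0)" "\<alpha> \<in> \<Phi>" using ab(1) by (auto simp: affine_roots_def)
  obtain \<beta> n where b: "b = (\<beta>, - of_int n, 0)" "\<beta> \<in> \<Phi>" using ab(2) by (auto simp: affine_roots_def)
  let ?A = "point_reflection (\<alpha>, - x, 0)" and ?B = "point_reflection (\<beta>, - y, 0)"
  have p: "0 < \<alpha> \<bullet> \<alpha>" "0 < \<beta> \<bullet> \<beta>" using a b root_inner_pos by auto
  show ?thesis
  proof (cases "\<beta> = \<alpha> \<or> \<beta> = - \<alpha>")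
    case False
    define D where "D = (\<alpha> \<bullet> \<alpha>) * (\<beta> \<bullet> \<beta>) - (\<alpha> \<bullet> \<beta>)\<^sup>2"
    have D: "D \<noteq> 0" using root_parallel[OF a(2) b(2)] False by (auto simp: D_def)
    \<comment> \<open>Cramer's rule for v \<bullet> \<alpha> = x - m, v \<bullet> \<beta> = y - n,
      with Gram determinant \<open>D\<close>: translation by \<open>v\<close> carries the old
      hyperplanes to the new ones.\<close>
    define v where "v = (1 / D) *\<^sub>R (((x - m) * (\<beta> \<bullet> \<beta>) - (y - n) * (\<alpha> \<bullet> \<beta>)) *\<^sub>R \<alpha>
      + ((y - n) * (\<alpha> \<bullet> \<alpha>) - (x - m) * (\<alpha> \<bullet> \<beta>)) *\<^sub>R \<beta>)"
    have "v \<bullet> \<alpha> = (1 / D) * ((x - m) * D)" "v \<bullet> \<beta> = (1 / D) * ((y - n) * D)"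
      unfolding v_def D_def
      by (simp_all add: inner_add_left inner_commute[of \<beta> \<alpha>] power2_eq_square algebra_simps)
    then have v: "v \<bullet> \<alpha> = x - m" "v \<bullet> \<beta> = y - n" using D by simp_all
    have AB: "(?A \<circ> ?B) w = (point_reflection a \<circ> point_reflection b) (w - v) + v" for w
    proof -
      have "?A w = point_reflection a (w - v) + v" "?B w = point_reflection b (w - v) + v" for w
        by (simp_all add: a b point_reflection_def inner_diff_left v)
      then show ?thesis by simp
    qed
    from funpow_translate[of "?A \<circ> ?B" "point_reflection a \<circ> point_reflection b" v k, OF AB] k
    have "((?A \<circ> ?B) ^^ k) w = w" for w by simp
    then show ?thesis by (simp add: a b fun_eq_iff)
  next
    case True
    then obtain n' :: real where n': "point_reflection b = point_reflection (\<alpha>, n', 0)"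
    proof
      assume "\<beta> = - \<alpha>"
      moreover have "coroot (- \<alpha>) = - coroot \<alpha>" by (simp add: coroot_def)
      ultimately have "point_reflection b = point_reflection (\<alpha>, of_int n, 0)"
        by (simp add: b point_reflection_def fun_eq_iff algebra_simps)
      then show thesis by (rule that)
    qed (simp add: b)
    \<comment> \<open>For parallel hyperplanes the product is a translation along the coroot, so a
      trivial power means k = 0 or equal reflections; \<open>same\<close> settles the
      latter.\<close>
    have AB: "(point_reflection a \<circ> point_reflection b) w = w + (n' + m) *\<^sub>R coroot \<alpha>" for w
    proof -
      define c s where "c = coroot \<alpha>" and "s = w \<bullet> \<alpha> + n'"
      have c: "c \<bullet> \<alpha> = 2" using p by (simp add: c_def coroot_def)
      have "(point_reflection a \<circ> point_reflection b) w = (w - s *\<^sub>R c) - ((w - s *\<^sub>R c) \<bullet> \<alpha> - m) *\<^sub>R c"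
        by (simp add: n' a point_reflection_def c_def s_def)
      also have "\<dots> = w - (s + ((w - s *\<^sub>R c) \<bullet> \<alpha> - m)) *\<^sub>R c"
        by (simp only: scaleR_left_distrib diff_diff_eq)
      also have "s + ((w - s *\<^sub>R c) \<bullet> \<alpha> - m) = - (n' + m)"
        by (simp add: inner_diff_left c s_def)
      finally show ?thesis by (simp only: c_def scaleR_minus_left diff_minus_eq_add)
    qed
    have "0 + real k *\<^sub>R ((n' + m) *\<^sub>R coroot \<alpha>) = 0"
      using funpow_add_const[of "point_reflection a \<circ> point_reflection b" _ k 0, OF AB] k by simp
    then have "k = 0 \<or> n' + m = 0" using p by (auto simp: coroot_def)
    then show ?thesis
    proof
      assume "n' + m = 0"
      then have "n' = - m" by simp
      then have "point_reflection a = point_reflection b" by (simp add: n' a)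
      from same[OF this] have "fst a = fst b" "x = y" by auto
      then have "point_reflection (fst a, - x, 0) \<circ> point_reflection (fst b, - y, 0) = id"
        by (simp add: fun_eq_iff point_reflection_involution)
      then show ?thesis by (simp add: id_funpow)
    qed simp
  qed
qed

text \<open>By \<open>reflection_relation\<close> the displaced generators satisfy the Coxeter
  relations, so they define a homomorphism \<open>f\<close> with the linear parts of \<eta>. Each
  reflection is then mapped to one with a parallel hyperplane, whose offset is the
  potential.\<close>

lemma coxeter_system_deformation:
  assumes cox: "coxeter_system W S" and S: "S \<subseteq> T"
  shows "\<exists>y. root_potential y \<and> (\<forall>s\<in>S. y (root_of s) = x s)"
proof -
  let ?B = "BijGroup (UNIV :: 'v set)"
  let ?F = "\<lambda>s. point_reflection (fst (root_of s), - x s, 0)"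
  have SW: "S \<subseteq> carrier W" using S T_carrier by auto
  have F: "bij (?F s)" for s by (simp add: bij_point_reflection)
  have gen: "carrier W = generate W S" using coxeter_system_generate[OF cox] by simp
  obtain f where f: "f \<in> hom W ?B" "\<And>s. s \<in> S \<Longrightarrow> f s = ?F s"
  proof (rule coxeter_system_hom[OF cox group_BijGroup, of ?F])
    show "?F ` S \<subseteq> carrier ?B" using F by (auto simp: BijGroup_UNIV_carrier)
    fix s t and k :: nat assume st: "s \<in> S" "t \<in> S" "(s \<otimes> t) [^] k = \<one>"
    then have c: "s \<in> carrier W" "t \<in> carrier W" "s \<in> T" "t \<in> T" using SW S by auto
    have "(point_reflection (root_of s) \<circ> point_reflection (root_of t)) ^^ k = \<eta> ((s \<otimes> t) [^] k)"
      using c by (simp add: \<eta>_pow \<eta>_mult root_of(2))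
    also have "\<dots> = id" using st(3) \<eta>_one by simp
    finally have "(?F s \<circ> ?F t) ^^ k = id"
    proof (rule reflection_relation[OF root_of(1)[OF c(3)] root_of(1)[OF c(4)]])
      assume "point_reflection (root_of s) = point_reflection (root_of t)"
      then have "s = t" using c root_of(2) \<eta>_inj by metis
      then show "root_of s = root_of t \<and> x s = x t" by simp
    qed
    then show "(?F s \<otimes>\<^bsub>?B\<^esub> ?F t) [^]\<^bsub>?B\<^esub> k = \<one>\<^bsub>?B\<^esub>"
      using F by (simp add: BijGroup_UNIV_mult BijGroup_UNIV_pow BijGroup_UNIV_one bij_comp)
  qed blast
  have fb: "bij (f g)" if "g \<in> carrier W" for g
    using f(1) that by (auto simp: hom_def BijGroup_UNIV_carrier)
  have fm: "f (g \<otimes> h) = f g \<circ> f h" if "g \<in> carrier W" "h \<in> carrier W" for g h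
    using hom_mult[OF f(1) that] fb that by (simp add: BijGroup_UNIV_mult)
  have sinv: "inv s = s" if "s \<in> S" for s
    using coxeter_system_involution[OF cox that] SW that by (intro inv_equality) auto
  \<comment> \<open>Equal linear parts, expressed through differences of values, a form stable under
    composition.\<close>
  have lin_s: "f s u - f s v = \<eta> s u' - \<eta> s v'" if "s \<in> S" "u - v = u' - v'" for s u v u' v'
  proof -
    have e: "point_reflection a p - point_reflection a p'
        = (p - p') - ((p - p') \<bullet> fst a) *\<^sub>R coroot (fst a)" for a p p'
      by (simp add: point_reflection_def inner_diff_left algebra_simps)
    have "point_reflection a u - point_reflection a v = point_reflection b u' - point_reflection b v'"
      if "fst a = fst b" for a b
      unfolding e that \<open>u - v = u' - v'\<close> ..
    then show ?thesis using f(2)[OF that(1)] root_of(2)[of s] S that(1) by auto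
  qed
  have lin: "f g u - f g v = \<eta> g u' - \<eta> g v'" if "g \<in> carrier W" "u - v = u' - v'" for g u v u' v'
    using that unfolding gen
  proof (induction arbitrary: u v u' v')
    case one
    have "f \<one> \<circ> f \<one> = f \<one>" using fm[of \<one> \<one>] by simp
    then have "f \<one> = id" using fb[of \<one>] by (intro bij_idempotent) simp_all
    then show ?case using one by (simp add: \<eta>_one)
  next
    case (incl h)
    then show ?case by (rule lin_s)
  next
    case (inv h)
    then show ?case using lin_s sinv by simp
  next
    case (eng g h)
    then have "g \<in> carrier W" "h \<in> carrier W" using gen by auto
    then show ?case
      using eng.IH(1)[OF eng.IH(2)[OF eng.prems]] by (simp add: fm \<eta>_mult)
  qed
  \<comment> \<open>Reflection in the hyperplane of offset y sends 0 to y times the coroot, whose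
    inner product with the root is 2.\<close>
  define y where "y = (\<lambda>a. (f (reflection_of a) 0 \<bullet> fst a) / 2)"
  have fy: "f (reflection_of a) = point_reflection (fst a, - y a, 0)" if a: "a \<in> affine_roots \<Phi>" for a
  proof
    fix v
    let ?t = "reflection_of a" and ?\<alpha> = "fst a"
    define z where "z = f ?t 0"
    have fv: "f ?t u = z + (u - (u \<bullet> ?\<alpha>) *\<^sub>R coroot ?\<alpha>)" for u
      using lin[of ?t u 0 u 0] reflection_of[OF a]
      by (simp add: z_def point_reflection_def algebra_simps)
    have "?t \<otimes> ?t = \<one>"
      using reflection_of[OF a] point_reflection_involution[of a] affine_root_level0[OF a]
      by (intro \<eta>_inj) (auto simp: \<eta>_mult \<eta>_one fun_eq_iff)
    then have "f ?t \<circ> f ?t = f \<one>" using fm[of ?t ?t] reflection_of[OF a] by simp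
    moreover have "f \<one> \<circ> f \<one> = f \<one>" using fm[of \<one> \<one>] by simp
    then have "f \<one> = id" using fb[of \<one>] by (intro bij_idempotent) simp_all
    \<comment> \<open>A map with this linear part might be a glide reflection; being an involution,
      it moves 0 only in the direction of the coroot.\<close>
    ultimately have "f ?t (f ?t 0) = 0" by (simp add: fun_eq_iff)
    then have "2 *\<^sub>R z = (z \<bullet> ?\<alpha>) *\<^sub>R coroot ?\<alpha>" by (simp add: fv scaleR_2 algebra_simps)
    then have "(1/2) *\<^sub>R (2 *\<^sub>R z) = (1/2) *\<^sub>R ((z \<bullet> ?\<alpha>) *\<^sub>R coroot ?\<alpha>)" by simp
    then have "z = ((z \<bullet> ?\<alpha>) / 2) *\<^sub>R coroot ?\<alpha>" by simp
    then show "f ?t v = point_reflection (?\<alpha>, - y a, 0) v"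
      unfolding fv point_reflection_def y_def z_def[symmetric] by (simp add: algebra_simps)
  qed
  have "root_potential y" unfolding root_potential_def
  proof (intro ballI allI)
    fix \<alpha> \<beta> k l assume ab: "\<alpha> \<in> \<Phi>" "\<beta> \<in> \<Phi>"
    let ?a = "(\<alpha>, - real_of_int k, 0)" and ?b = "(\<beta>, - real_of_int l, 0)"
    let ?r = "affine.reflection ?b ?a"
    have A: "?a \<in> affine_roots \<Phi>" "?b \<in> affine_roots \<Phi>" using ab by (auto simp: affine_roots_def)
    have r: "?r \<in> affine_roots \<Phi>" using reflection_affine_roots[OF A(2,1)] .
    have fr: "fst ?r = affine_reflection \<beta> 0 \<alpha>" by (simp add: reflection_affine_root)
    have "point_reflection (fst ?r, - y ?r, 0) = f (reflection_of ?b) \<circ> f (reflection_of ?a) \<circ> f (reflection_of ?b)"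
      using fy[OF r] reflection_of_reflection[OF A] reflection_of[OF A(1)] reflection_of[OF A(2)] by (simp add: fm)
    also have "\<dots> = point_reflection (affine.reflection (\<beta>, - y ?b, 0) (\<alpha>, - y ?a, 0))"
      using fy[OF A(1)] fy[OF A(2)] by (simp add: point_reflection_reflection o_assoc)
    finally have "point_reflection (fst ?r, - y ?r, 0) =
        point_reflection (fst ?r, - (y ?a - (\<alpha> \<bullet> coroot \<beta>) * y ?b), 0)"
      by (simp only: reflection_affine_root[of \<beta> "y ?b" \<alpha>] fr)
    then have "- y ?r = - (y ?a - (\<alpha> \<bullet> coroot \<beta>) * y ?b)"
      using fst_affine_roots[OF r] zero_not_root by (intro point_reflection_offset[of "fst ?r"]) auto
    then show "y ?r = y ?a - (\<alpha> \<bullet> coroot \<beta>) * y ?b" by simp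
  qed
  moreover have "y (root_of s) = x s" if "s \<in> S" for s
  proof -
    have s: "s \<in> T" using that S by auto
    have "point_reflection (fst (root_of s), - y (root_of s), 0) = point_reflection (fst (root_of s), - x s, 0)"
      using fy[OF root_of(1)[OF s]] f(2)[OF that] by (simp add: reflection_of_root_of s)
    then have "- y (root_of s) = - x s"
      using fst_affine_roots[OF root_of(1)[OF s]] zero_not_root
      by (intro point_reflection_offset[of "fst (root_of s)"]) auto
    then show ?thesis by simp
  qed
  ultimately show ?thesis by blast
qed

end

section \<open>The action of the braid generators\<close>

definition hurwitz_move_inv :: "('g, 'm) monoid_scheme \<Rightarrow> nat \<Rightarrow> 'g list \<Rightarrow> 'g list" where
  "hurwitz_move_inv G i ts =
    (let a = ts ! (i - 1); b = ts ! i
     in take (i - 1) ts @ [b, b \<otimes>\<^bsub>G\<^esub> a \<otimes>\<^bsub>G\<^esub> b] @ drop (i + 1) ts)"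

lemma hurwitz_move_inv_split:
  "length xs + 1 = i \<Longrightarrow>
    hurwitz_move_inv G i (xs @ a # b # ys) = xs @ b # (b \<otimes>\<^bsub>G\<^esub> a \<otimes>\<^bsub>G\<^esub> b) # ys"
  by (auto simp: hurwitz_move_inv_def nth_append)

lemma hurwitz_move_commute:
  assumes "1 \<le> i" "i + 1 < j" "j < length ts"
  shows "hurwitz_move G i (hurwitz_move G j ts) = hurwitz_move G j (hurwitz_move G i ts)"
proof -
  obtain xs a b ys where 1: "ts = xs @ a # b # ys" "length xs + 1 = i"
    by (rule split_at[of i ts]) (use assms in auto)
  obtain zs c d us where 2: "ys = zs @ c # d # us" "length zs + 1 = j - i - 1"
    by (rule split_at[of "j - i - 1" ys]) (use assms 1 in auto)
  have "hurwitz_move G j (xs @ p # q # zs @ c # d # us) = xs @ p # q # zs @ (c \<otimes>\<^bsub>G\<^esub> d \<otimes>\<^bsub>G\<^esub> c) # c # us" for p q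
    using hurwitz_move_split[of "xs @ p # q # zs" j G c d us] 1(2) 2(2) assms by simp
  then show ?thesis by (simp add: 1(1) 2(1) hurwitz_move_split[OF 1(2)])
qed

locale reflection_lists = group W for W :: "('g, 'm) monoid_scheme" (structure) +
  fixes T :: "'g set"
  assumes reflections_carrier: "T \<subseteq> carrier W"
    and T_involution: "t \<in> T \<Longrightarrow> t \<otimes> t = \<one>"
    and T_conj: "s \<in> T \<Longrightarrow> t \<in> T \<Longrightarrow> s \<otimes> t \<otimes> s \<in> T"
begin

lemma cancel_reflection: "t \<in> T \<Longrightarrow> x \<in> carrier W \<Longrightarrow> t \<otimes> (t \<otimes> x) = x"
  using reflections_carrier T_involution[of t] m_assoc[of t t x] by auto

lemma hurwitz_move_braid:
  assumes "1 \<le> i" "i + 1 < length ts" "set ts \<subseteq> T"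
  shows "hurwitz_move W i (hurwitz_move W (i + 1) (hurwitz_move W i ts)) =
    hurwitz_move W (i + 1) (hurwitz_move W i (hurwitz_move W (i + 1) ts))"
proof -
  obtain xs a b ys where 1: "ts = xs @ a # b # ys" "length xs + 1 = i"
    by (rule split_at[of i ts]) (use assms in auto)
  obtain d zs where 2: "ys = d # zs" using assms 1 by (cases ys) auto
  have t: "a \<in> T" "b \<in> T" "d \<in> T" using assms by (auto simp: 1 2)
  then have tc: "a \<in> carrier W" "b \<in> carrier W" "d \<in> carrier W" using reflections_carrier by auto
  have A: "hurwitz_move W (i + 1) (xs @ p # q # r # zs) = xs @ p # (q \<otimes> r \<otimes> q) # q # zs" for p q r
    using hurwitz_move_split[of "xs @ [p]" "i + 1" W q r zs] 1 by simp
  show ?thesis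
    unfolding 1(1) 2 A hurwitz_move_split[OF 1(2)] using tc t
    by (simp add: m_assoc cancel_reflection)
qed

lemma Red_replace:
  assumes "a \<in> T" "b \<in> T" "c \<in> T" "d \<in> T" "a \<otimes> b = c \<otimes> d"
  shows "xs @ a # b # ys \<in> Red W T w \<longleftrightarrow> xs @ c # d # ys \<in> Red W T w"
proof (cases "set xs \<subseteq> T \<and> set ys \<subseteq> T")
  case True
  have C: "a \<in> carrier W" "b \<in> carrier W" "c \<in> carrier W" "d \<in> carrier W"
    "set xs \<subseteq> carrier W" "set ys \<subseteq> carrier W"
    using assms True reflections_carrier by auto
  have "list_prod W (a # b # ys) = list_prod W (c # d # ys)"
    using C list_prod_closed[OF C(6)] assms(5) by (simp add: list_prod_def flip: m_assoc)
  then have "list_prod W (xs @ a # b # ys) = list_prod W (xs @ c # d # ys)"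
    using C by (simp add: list_prod_append)
  then show ?thesis using assms True by (auto simp: Red_def)
qed (use assms in \<open>auto simp: Red_def\<close>)

lemma Red_move:
  assumes "a \<in> T" "b \<in> T"
  shows "xs @ a # b # ys \<in> Red W T w \<longleftrightarrow> xs @ (a \<otimes> b \<otimes> a) # a # ys \<in> Red W T w"
    and "xs @ a # b # ys \<in> Red W T w \<longleftrightarrow> xs @ b # (b \<otimes> a \<otimes> b) # ys \<in> Red W T w"
proof -
  have c: "a \<in> carrier W" "b \<in> carrier W" using assms reflections_carrier by auto
  show "xs @ a # b # ys \<in> Red W T w \<longleftrightarrow> xs @ (a \<otimes> b \<otimes> a) # a # ys \<in> Red W T w"
    using assms c T_conj[OF assms] by (intro Red_replace) (simp_all add: m_assoc T_involution)
  show "xs @ a # b # ys \<in> Red W T w \<longleftrightarrow> xs @ b # (b \<otimes> a \<otimes> b) # ys \<in> Red W T w"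
    using assms c T_conj[OF assms(2,1)] by (intro Red_replace) (simp_all add: m_assoc cancel_reflection)
qed

lemma bij_hurwitz_move:
  assumes "1 \<le> i" "i < reflection_length W T w"
  shows "bij_betw (hurwitz_move W i) (Red W T w) (Red W T w)"
proof -
  have split: "\<exists>xs a b ys. ts = xs @ a # b # ys \<and> length xs + 1 = i \<and> a \<in> T \<and> b \<in> T \<and> a \<in> carrier W \<and> b \<in> carrier W"
    if ts: "ts \<in> Red W T w" for ts
  proof -
    obtain xs a b ys where 1: "ts = xs @ a # b # ys" "length xs + 1 = i"
      by (rule split_at[of i ts]) (use assms ts in \<open>auto simp: Red_def\<close>)
    then have "a \<in> T" "b \<in> T" using ts by (auto simp: Red_def)
    with 1 reflections_carrier show ?thesis by blast
  qed
  have "hurwitz_move_inv W i (hurwitz_move W i ts) = ts \<and> hurwitz_move W i ts \<in> Red W T w \<and>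
    hurwitz_move W i (hurwitz_move_inv W i ts) = ts \<and> hurwitz_move_inv W i ts \<in> Red W T w"
    if ts: "ts \<in> Red W T w" for ts
  proof -
    obtain xs a b ys where 1: "ts = xs @ a # b # ys" "length xs + 1 = i"
      and ab: "a \<in> T" "b \<in> T" "a \<in> carrier W" "b \<in> carrier W"
      using split[OF ts] by blast
    show ?thesis
      using ts Red_move[OF ab(1,2), of xs ys w] ab
      unfolding 1(1) hurwitz_move_split[OF 1(2)] hurwitz_move_inv_split[OF 1(2)]
      by (simp add: m_assoc cancel_reflection T_involution)
  qed
  then show ?thesis by (intro bij_betw_byWitness[of _ "hurwitz_move_inv W i"]) auto
qed

text \<open>\<open>presented_hom\<close> is evaluated on representatives of a class, so the braid
  relations must be checked for the moves before the class of a generator can be evaluated.\<close>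

lemma hurwitz_action_generator:
  assumes i: "1 \<le> i" "i < reflection_length W T w" and ts: "ts \<in> Red W T w"
  shows "\<exists>g\<in>carrier (braid_group (reflection_length W T w)).
    hurwitz_action W (Red W T w) g ts = hurwitz_move W i ts"
proof -
  define m X where "m = reflection_length W T w" and "X = Red W T w"
  let ?F = "\<lambda>i. restrict (hurwitz_move W i) X"
  interpret B: group "BijGroup X" by (rule group_BijGroup)
  have X: "set ts \<subseteq> T" "length ts = m" if "ts \<in> X" for ts using that by (auto simp: X_def m_def Red_def)
  have F: "?F i \<in> carrier (BijGroup X)" if "1 \<le> i" "i < m" for i
    using bij_hurwitz_move[of i w] that by (simp add: BijGroup_def Bij_def X_def m_def bij_betw_restrict_eq)
  have st: "hurwitz_move W i ts \<in> X" if "1 \<le> i" "i < m" "ts \<in> X" for i ts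
    using bij_hurwitz_move[of i w] that by (auto simp: X_def m_def bij_betw_def)
  have mult: "g \<otimes>\<^bsub>BijGroup X\<^esub> h = compose X g h"
    if "g \<in> carrier (BijGroup X)" "h \<in> carrier (BijGroup X)" for g h
    using that by (simp add: BijGroup_def)
  have cl: "compose X g h \<in> carrier (BijGroup X)"
    if "g \<in> carrier (BijGroup X)" "h \<in> carrier (BijGroup X)" for g h
    using B.m_closed[OF that] mult[OF that] by simp
  have rel: "word_eval (BijGroup X) ?F u = word_eval (BijGroup X) ?F v" if uv: "(u, v) \<in> braid_relations m" for u v
  proof -
    consider (far) i j where "u = [(i, True), (j, True)]" "v = [(j, True), (i, True)]"
        "1 \<le> i" "i + 1 < j" "j < m"
      | (near) i where "u = [(i, True), (i + 1, True), (i, True)]"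
        "v = [(i + 1, True), (i, True), (i + 1, True)]" "1 \<le> i" "i + 1 < m"
      using uv unfolding braid_relations_def by fastforce
    then show ?thesis
    proof cases
      case far
      have c: "?F i \<in> carrier (BijGroup X)" "?F j \<in> carrier (BijGroup X)" using far by (auto intro!: F)
      have "compose X (?F i) (?F j) = compose X (?F j) (?F i)"
        using far X st by (auto simp: compose_def restrict_def fun_eq_iff intro!: hurwitz_move_commute)
      then show ?thesis using c by (simp add: far mult del: compose_def)
    next
      case near
      have c: "?F i \<in> carrier (BijGroup X)" "?F (i + 1) \<in> carrier (BijGroup X)" using near by (auto intro!: F)
      have "compose X (?F i) (compose X (?F (i + 1)) (?F i)) =
          compose X (?F (i + 1)) (compose X (?F i) (?F (i + 1)))"
      proof
        fix ts
        show "compose X (?F i) (compose X (?F (i + 1)) (?F i)) ts =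
          compose X (?F (i + 1)) (compose X (?F i) (?F (i + 1))) ts"
          using near st hurwitz_move_braid[of i ts] X[of ts] by (cases "ts \<in> X") (simp_all add: compose_def)
      qed
      then show ?thesis using c cl by (simp add: near mult)
    qed
  qed
  let ?g = "word_cong {1..<m} (braid_relations m) `` {[(i, True)]}"
  have w: "[(i, True)] \<in> gen_words {1..<m}" using i by (simp add: m_def)
  have "?F ` {1..<m} \<subseteq> carrier (BijGroup X)" using F by auto
  from B.presented_hom_class[OF this w rel]
  have "hurwitz_action W X ?g = ?F i"
    using F[of i] i by (simp add: hurwitz_action_def m_def)
  then have "hurwitz_action W X ?g ts = hurwitz_move W i ts" using ts by (simp add: X_def)
  moreover have "?g \<in> carrier (braid_group m)"
    using w by (simp add: braid_group_def presented_group_def quotientI)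
  ultimately show ?thesis unfolding m_def X_def by blast
qed

end

section \<open>Transitivity for affine Coxeter groups\<close>

lemma point_prod_diff_in_span: "point_prod as v - v \<in> span (fst ` set as)"
proof (induction as)
  case (Cons a as)
  let ?p = "point_prod as v"
  have "?p - v \<in> span (fst ` set (a # as))"
    using Cons span_mono[of "fst ` set as" "fst ` set (a # as)"] by auto
  moreover have "(?p \<bullet> fst a + fst (snd a)) *\<^sub>R coroot (fst a) \<in> span (fst ` set (a # as))"
    unfolding coroot_def by (intro span_scale span_base) simp
  ultimately have "(?p - v) - (?p \<bullet> fst a + fst (snd a)) *\<^sub>R coroot (fst a) \<in> span (fst ` set (a # as))"
    by (rule span_diff)
  then show ?case by (simp add: point_reflection_def algebra_simps)
qed (simp add: span_zero)

lemma point_prod_orth: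
  "(\<And>a. a \<in> set as \<Longrightarrow> d \<bullet> fst a = 0) \<Longrightarrow> point_prod as (v + d) = point_prod as v + d"
  by (induction as) (auto simp: point_reflection_def inner_add_left)

context root_system
begin

lemma root_component_orth:
  assumes "\<alpha> \<in> \<Phi>" "\<beta> \<in> \<Phi>" "root_component \<Phi> \<alpha> \<noteq> root_component \<Phi> \<beta>"
  shows "\<alpha> \<bullet> \<beta> = 0"
  using root_component_link[OF assms(1,2)] assms(3) by auto

definition component_list :: "'v set \<Rightarrow> ('v \<times> real \<times> real) list \<Rightarrow> ('v \<times> real \<times> real) list" where
  "component_list C as = filter (\<lambda>a. root_component \<Phi> (fst a) = C) as"

lemma set_component_list:
  assumes "set as \<subseteq> affine_roots \<Phi>"
  shows "set (component_list C as) \<subseteq> affine_roots (roots_of C)"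
proof
  fix a assume "a \<in> set (component_list C as)"
  then have a: "a \<in> affine_roots \<Phi>" "root_component \<Phi> (fst a) = C"
    using assms by (auto simp: component_list_def)
  show "a \<in> affine_roots (roots_of C)"
    by (rule affine_roots_mono[OF a(1)]) (use a(2) fst_affine_roots[OF a(1)] in \<open>simp add: roots_of_def\<close>)
qed

lemma affine_form_components:
  assumes "a \<in> affine_roots \<Phi>" "b \<in> affine_roots \<Phi>" "root_component \<Phi> (fst a) \<noteq> root_component \<Phi> (fst b)"
  shows "affine_form a b = 0"
proof -
  have "snd (snd a) = 0" "snd (snd b) = 0" using assms(1,2) affine_roots_level0[of \<Phi>] by auto
  moreover have "fst a \<bullet> fst b = 0"
    by (rule root_component_orth[OF fst_affine_roots[OF assms(1)] fst_affine_roots[OF assms(2)] assms(3)])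
  ultimately show ?thesis by (simp add: affine_form_def)
qed

text \<open>After sorting, the displacement of a product is the one due to \<open>C\<close> plus a
  vector in the span of the other roots. These spans are orthogonal, so the product determines both
  summands.\<close>

lemma rprod_component:
  assumes as: "set as \<subseteq> affine_roots \<Phi>" and bs: "set bs \<subseteq> affine_roots \<Phi>"
    and eq: "point_prod as = point_prod bs"
  shows "affine.rprod (component_list C as) = affine.rprod (component_list C bs)"
proof -
  let ?P = "\<lambda>a. root_component \<Phi> (fst a) = C"
  have split: "\<exists>d. point_prod cs v - v = (point_prod (component_list C cs) v - v) + d \<and>
      d \<in> span (\<Phi> - roots_of C) \<and> point_prod (component_list C cs) v - v \<in> span (roots_of C)"
    if cs: "set cs \<subseteq> affine_roots \<Phi>" for cs v
  proof -
    let ?F = "component_list C cs" and ?G = "filter (\<lambda>a. \<not> ?P a) cs"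
    have sub: "fst ` set ?F \<subseteq> roots_of C" "fst ` set ?G \<subseteq> \<Phi> - roots_of C"
      using cs fst_affine_roots by (fastforce simp: component_list_def roots_of_def)+
    have "affine.hurwitz_equiv cs (?F @ ?G)"
      unfolding component_list_def using cs by (intro affine.hurwitz_equiv_filter affine_form_components) auto
    then have "affine.rprod cs = affine.rprod (?F @ ?G)" by (rule affine.hurwitz_equiv_rprod)
    then have "point_prod cs = point_prod (?F @ ?G)"
      using cs affine_roots_level0[of \<Phi>]
      by (subst (asm) rprod_eq_iff_point_prod) (auto simp: component_list_def)
    then have "point_prod cs v = point_prod ?F (v + (point_prod ?G v - v))"
      by (simp add: point_prod_append)
    moreover have d: "point_prod ?G v - v \<in> span (\<Phi> - roots_of C)"
      using point_prod_diff_in_span[of ?G v] span_mono[OF sub(2)] by blast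
    moreover have "(point_prod ?G v - v) \<bullet> \<alpha> = 0" if \<alpha>: "\<alpha> \<in> roots_of C" for \<alpha>
    proof -
      have "orthogonal \<alpha> (point_prod ?G v - v)"
        using d by (rule orthogonal_to_span)
          (use \<alpha> root_component_orth in \<open>auto simp: roots_of_def orthogonal_def\<close>)
      then show ?thesis by (simp add: orthogonal_def inner_commute)
    qed
    then have "point_prod ?F (v + (point_prod ?G v - v)) = point_prod ?F v + (point_prod ?G v - v)"
      using sub(1) by (intro point_prod_orth) auto
    moreover have "point_prod ?F v - v \<in> span (roots_of C)"
      using point_prod_diff_in_span[of ?F v] span_mono[OF sub(1)] by blast
    ultimately show ?thesis by (intro exI[of _ "point_prod ?G v - v"]) simp
  qed
  have "point_prod (component_list C as) = point_prod (component_list C bs)"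
  proof
    fix v
    obtain d where d: "point_prod as v - v = (point_prod (component_list C as) v - v) + d"
      "d \<in> span (\<Phi> - roots_of C)" "point_prod (component_list C as) v - v \<in> span (roots_of C)"
      using split[OF as] by blast
    obtain e where e: "point_prod bs v - v = (point_prod (component_list C bs) v - v) + e"
      "e \<in> span (\<Phi> - roots_of C)" "point_prod (component_list C bs) v - v \<in> span (roots_of C)"
      using split[OF bs] by blast
    let ?x = "point_prod (component_list C as) v - point_prod (component_list C bs) v"
    have x: "?x = e - d" using d(1) e(1) eq by (simp add: algebra_simps)
    have "?x \<in> span (roots_of C)" using span_diff[OF d(3) e(3)] by simp
    moreover have "?x \<in> span (\<Phi> - roots_of C)" unfolding x using e(2) d(2) by (rule span_diff)
    moreover have "orthogonal \<alpha> \<beta>" if "\<alpha> \<in> span (roots_of C)" "\<beta> \<in> span (\<Phi> - roots_of C)" for \<alpha> \<beta>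
    proof (rule orthogonal_to_span[OF that(2)])
      fix \<gamma> assume \<gamma>: "\<gamma> \<in> \<Phi> - roots_of C"
      have "orthogonal \<gamma> \<alpha>"
        using that(1) by (rule orthogonal_to_span)
          (use \<gamma> root_component_orth in \<open>auto simp: roots_of_def orthogonal_def\<close>)
      then show "orthogonal \<alpha> \<gamma>" by (simp add: orthogonal_commute)
    qed
    ultimately have "orthogonal ?x ?x" by blast
    then show "point_prod (component_list C as) v = point_prod (component_list C bs) v"
      by (simp add: orthogonal_def)
  qed
  then show ?thesis
    using as bs affine_roots_level0[of \<Phi>]
    by (subst rprod_eq_iff_point_prod) (auto simp: component_list_def)
qed

end

lemma indep_list_length_le:
  assumes "indep_list xs" "set xs \<subseteq> span (set ys)" shows "length xs \<le> length ys"
  using indep_list_exchange(2)[OF assms] by linarith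

lemma (in group) generate_list_prod:
  assumes "A \<subseteq> carrier G" "\<And>a. a \<in> A \<Longrightarrow> inv a = a" "g \<in> generate G A"
  shows "\<exists>zs. set zs \<subseteq> A \<and> list_prod G zs = g"
  using assms(3)
proof induction
  case one
  show ?case by (rule exI[of _ "[]"]) (simp add: list_prod_def)
next
  case (incl h)
  then show ?case using assms(1) by (intro exI[of _ "[h]"]) (auto simp: list_prod_def)
next
  case (inv h)
  then show ?case using assms by (intro exI[of _ "[h]"]) (auto simp: list_prod_def)
next
  case (eng g h)
  then obtain zs ys where "set zs \<subseteq> A" "list_prod G zs = g" "set ys \<subseteq> A" "list_prod G ys = h" by blast
  then show ?case using assms(1) by (intro exI[of _ "zs @ ys"]) (auto simp: list_prod_append)
qed

lemma point_reflection_uminus: "point_reflection (- a) = point_reflection a"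
proof -
  have "coroot (- fst a) = - coroot (fst a)" by (simp add: coroot_def)
  then show ?thesis by (simp add: point_reflection_def fun_eq_iff algebra_simps)
qed

section \<open>Generating sets and factorizations, component by component\<close>

locale affine_dual_system = affine_dual \<Phi> W T \<eta>
  for \<Phi> :: "'v::euclidean_space set" and W :: "('g, 'm) monoid_scheme" (structure)
    and T :: "'g set" and \<eta> :: "'g \<Rightarrow> 'v \<Rightarrow> 'v" +
  fixes n :: nat
  assumes dual: "dual_coxeter_system n W T"
begin

sublocale reflection_lists W T
  by unfold_locales (use dual_coxeter_system_reflections[OF dual] in auto)

lemma reflection_inv: "t \<in> T \<Longrightarrow> inv t = t"
  using T_involution T_carrier by (intro inv_equality) auto

lemma \<eta>_list_prod: "set ts \<subseteq> T \<Longrightarrow> \<eta> (list_prod W ts) = point_prod (map root_of ts)"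
proof (induction ts)
  case (Cons t ts)
  have "list_prod W ts \<in> carrier W" using Cons.prems T_carrier by (intro list_prod_closed) auto
  moreover have "t \<in> carrier W" "t \<in> T" using Cons.prems T_carrier by auto
  moreover have "list_prod W (t # ts) = t \<otimes> list_prod W ts" by (simp add: list_prod_def)
  ultimately show ?case using Cons by (simp add: \<eta>_mult root_of(2))
qed (simp add: list_prod_def \<eta>_one)

lemma set_root_of: "set ts \<subseteq> T \<Longrightarrow> set (map root_of ts) \<subseteq> affine_roots \<Phi>"
  using root_of(1) by auto

lemma root_of_inj: "inj_on root_of T"
  using reflection_of_root_of by (intro inj_on_inverseI[of _ reflection_of])

text \<open>Free deformability gives independence, but only within a component: the spans of
  different components can share the direction (0, 1, 0).\<close>

lemma component_list_map_indep:
  assumes "coxeter_system W (set ss)" "set ss \<subseteq> T" "distinct ss"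
  shows "indep_list (component_list C (map root_of ss))"
proof -
  let ?sr = "map root_of ss"
  have "\<exists>y. root_potential y \<and> (\<forall>s\<in>set ?sr. y s = x s)" for x
    using coxeter_system_deformation[OF assms(1,2), of "\<lambda>s. x (root_of s)"] by auto
  then have "independent {s \<in> set ?sr. fst s \<in> roots_of C}"
    using set_root_of[OF assms(2)] by (intro deformable_indep) auto
  moreover have "{s \<in> set ?sr. fst s \<in> roots_of C} = set (component_list C ?sr)"
    using set_root_of[OF assms(2)] fst_affine_roots by (fastforce simp: component_list_def roots_of_def)
  moreover have "distinct ?sr"
    using assms(2,3) root_of_inj by (simp add: distinct_map inj_on_subset)
  ultimately show ?thesis by (simp add: indep_list_def component_list_def)
qed

text \<open>Write the reflection as a word in the generators and discard the letters of other
  components; by \<open>rprod_component\<close> the product is unchanged.\<close>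

lemma reflection_in_component:
  assumes "set cs \<subseteq> T" "generate W (set cs) = carrier W" and r: "r \<in> affine_roots (roots_of C)"
  obtains zs where "set zs \<subseteq> set (component_list C (map root_of cs))"
    "affine.rprod zs = affine.reflection r"
proof -
  have r': "r \<in> affine_roots \<Phi>" "root_component \<Phi> (fst r) = C"
    using r affine_roots_mono[OF r, of \<Phi>] fst_affine_roots[OF r] by (auto simp: roots_of_def)
  have "set cs \<subseteq> carrier W" using assms(1) T_carrier by auto
  moreover have "inv a = a" if "a \<in> set cs" for a using that assms(1) reflection_inv by auto
  moreover have "reflection_of r \<in> generate W (set cs)" using reflection_of[OF r'(1)] assms(2) by simp
  ultimately obtain zs where zs: "set zs \<subseteq> set cs" "list_prod W zs = reflection_of r"
    using generate_list_prod by blast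
  have zT: "set zs \<subseteq> T" using zs(1) assms(1) by auto
  have "point_prod (map root_of zs) = point_prod [r]"
    using \<eta>_list_prod[OF zT] reflection_of[OF r'(1)] zs(2) by simp
  then have "affine.rprod (component_list C (map root_of zs)) = affine.rprod (component_list C [r])"
    using set_root_of[OF zT] r'(1) by (intro rprod_component) auto
  moreover have "component_list C [r] = [r]" using r'(2) by (simp add: component_list_def)
  moreover have "set (component_list C (map root_of zs)) \<subseteq> set (component_list C (map root_of cs))"
    using zs(1) by (auto simp: component_list_def)
  ultimately show thesis using that by simp
qed

text \<open>A product equal to the reflection in \<open>r\<close> displaces \<open>r\<close> by
  -2r.\<close>

lemma component_list_in_span:
  assumes "set cs \<subseteq> T" "generate W (set cs) = carrier W" and r: "r \<in> affine_roots (roots_of C)"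
  shows "r \<in> span (set (component_list C (map root_of cs)))"
proof -
  interpret R: affine_root_space affine_form "affine_roots (roots_of C)" "(0, 1, 0)"
    by (rule affine_root_space_component)
  let ?S = "set (component_list C (map root_of cs))"
  obtain zs where zs: "set zs \<subseteq> ?S" "affine.rprod zs = affine.reflection r"
    using reflection_in_component[OF assms] .
  have "affine.rprod zs r - r \<in> span ?S"
    using affine.rprod_diff_in_span[of zs r] span_mono[OF zs(1)] by blast
  then have "- (2 *\<^sub>R r) \<in> span ?S"
    using R.root_pos[OF r] by (simp add: zs(2) affine.reflection_self scaleR_2)
  then have "(- 1 / 2) *\<^sub>R (- (2 *\<^sub>R r)) \<in> span ?S" by (rule span_scale)
  then show ?thesis by simp
qed

text \<open>Completed by the remaining simple reflections, \<open>ts\<close> generates the group and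
  is as long as \<open>ss\<close>. Dimension counts make it a generating basis in every component,
  where the one-component theorem applies.\<close>

theorem hurwitz_equiv_quasi_coxeter:
  assumes cox: "coxeter_system W (set ss)" and ss: "set ss \<subseteq> T" "distinct ss"
    and ts: "set ts \<subseteq> T" "length ts \<le> length ss"
      "generate W (set ts) = generate W (set (take (length ts) ss))"
    and us: "set us \<subseteq> T" "length us = length ts" "list_prod W us = list_prod W ts"
  shows "affine.hurwitz_equiv (map root_of ts) (map root_of us)"
proof -
  let ?m = "length ts"
  let ?rest = "drop ?m ss"
  let ?cs = "ts @ ?rest"
  have cT: "set ?cs \<subseteq> T" using ts(1) ss(1) set_drop_subset[of ?m ss] by auto
  have cW: "set ?cs \<subseteq> carrier W" "set ss \<subseteq> carrier W" using cT ss(1) T_carrier by auto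
  have lcs: "length ?cs = length ss" using ts(2) by simp
  have gen: "generate W (set ?cs) = carrier W"
  proof -
    have sub: "subgroup (generate W (set ?cs)) W" by (rule generate_is_subgroup[OF cW(1)])
    have "set (take ?m ss) \<subseteq> generate W (set (take ?m ss))" by (auto intro: generate.incl)
    also have "\<dots> = generate W (set ts)" using ts(3) by simp
    also have "\<dots> \<subseteq> generate W (set ?cs)" by (rule mono_generate) auto
    finally have "set (take ?m ss) \<subseteq> generate W (set ?cs)" .
    moreover have "set ?rest \<subseteq> generate W (set ?cs)" by (auto intro: generate.incl)
    moreover have "set ss = set (take ?m ss) \<union> set ?rest"
      by (metis append_take_drop_id set_append)
    ultimately have "set ss \<subseteq> generate W (set ?cs)" by auto
    from generate_subgroup_incl[OF this sub] coxeter_system_generate[OF cox]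
    show ?thesis using generate_incl[OF cW(1)] by auto
  qed
  let ?f = "\<lambda>a. root_component \<Phi> (fst a)"
  let ?cl = "\<lambda>C xs. component_list C (map root_of xs)"
  have sI: "indep_list (?cl C ss)" for C by (rule component_list_map_indep[OF cox ss])
  have sc: "set (?cl C ss) \<subseteq> span (set (?cl C ?cs))" for C
    using component_list_in_span[OF cT gen] set_component_list[OF set_root_of[OF ss(1)], of C] by blast
  \<comment> \<open>In each component \<open>ss\<close> is independent inside the span of
    \<open>?cs\<close>, hence not longer; equal total lengths force equality in every
    component.\<close>
  have "length (?cl C ss) = length (?cl C ?cs)" for C
    unfolding component_list_def
    by (rule length_filter_eqI)
      (use indep_list_length_le[OF sI sc] lcs in \<open>simp_all add: component_list_def\<close>)
  then have cI: "indep_list (?cl C ?cs)" for C using indep_list_exchange(1)[OF sI sc, of C] by simp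
  have split: "?cl C ?cs = ?cl C ts @ ?cl C ?rest" for C by (simp add: component_list_def)
  have tI: "indep_list (?cl C ts)" for C using cI[of C] unfolding split by (rule indep_list_prefix)
  have prod: "affine.rprod (?cl C ts) = affine.rprod (?cl C us)" for C
    using \<eta>_list_prod[OF ts(1)] \<eta>_list_prod[OF us(1)] us(3) set_root_of[OF ts(1)] set_root_of[OF us(1)]
    by (intro rprod_component) simp_all
  have tu: "set (?cl C ts) \<subseteq> span (set (?cl C us))" for C
  proof (rule affine.rprod_eq_span[OF tI prod])
    interpret R: affine_root_space affine_form "affine_roots (roots_of C)" "(0, 1, 0)"
      by (rule affine_root_space_component)
    show "affine_form a a \<noteq> 0" if "a \<in> set (?cl C ts)" for a
      using R.root_pos[of a] that set_component_list[OF set_root_of[OF ts(1)], of C] by force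
  qed
  \<comment> \<open>The same count for \<open>ts\<close> and \<open>us\<close>, with Carter's lemma
    supplying the inclusion of spans.\<close>
  have len: "length (?cl C ts) = length (?cl C us)" for C
    unfolding component_list_def
    by (rule length_filter_eqI)
      (use indep_list_length_le[OF tI tu] us(2) in \<open>simp_all add: component_list_def\<close>)
  have "affine.hurwitz_equiv (?cl C ts) (?cl C us)" for C
  proof -
    interpret R: affine_root_space affine_form "affine_roots (roots_of C)" "(0, 1, 0)"
      by (rule affine_root_space_component)
    have "affine.reflection r \<in> affine.reflection_group (set (?cl C ?cs))"
      if r: "r \<in> affine_roots (roots_of C)" for r
    proof -
      obtain zs where "set zs \<subseteq> set (?cl C ?cs)" "affine.rprod zs = affine.reflection r"
        using reflection_in_component[OF cT gen r] .
      then show ?thesis using affine.rprod_in_group[of zs "set (?cl C ?cs)"] by simp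
    qed
    then have "R.generating_basis (?cl C ts @ ?cl C ?rest)"
      unfolding R.generating_basis_def split[symmetric]
      using cI[of C] set_component_list[OF set_root_of[OF cT], of C] by blast
    from R.hurwitz_equiv_generating_basis[OF this _ len[symmetric] prod] show ?thesis
      using set_component_list[OF set_root_of[OF us(1)], of C] by blast
  qed
  then have hz: "affine.hurwitz_equiv (filter (\<lambda>a. ?f a = C) (map root_of ts)) (filter (\<lambda>a. ?f a = C) (map root_of us))" for C
    by (simp only: component_list_def)
  have orth: "affine_form a b = 0"
    if "a \<in> set (map root_of ts) \<union> set (map root_of us)" "b \<in> set (map root_of ts) \<union> set (map root_of us)"
      "?f a \<noteq> ?f b" for a b
    using that set_root_of[OF ts(1)] set_root_of[OF us(1)]
    by (intro affine_form_components[OF _ _ that(3)]) blast+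
  show ?thesis by (rule affine.hurwitz_equiv_glue[where f = ?f, OF orth hz])
qed

text \<open>A move is realized by a braid generator, symmetry and transitivity by the group laws,
  and \<open>neg\<close> is invisible because opposite roots give the same reflection. Membership in
  \<open>X\<close> is carried along as an equivalence for the symmetric case.\<close>

lemma hurwitz_equiv_orbit:
  fixes w :: 'g
  defines "B \<equiv> braid_group (reflection_length W T w)" and "X \<equiv> Red W T w"
  assumes "affine.hurwitz_equiv as bs" "set as \<subseteq> affine_roots \<Phi>"
  shows "(map reflection_of as \<in> X \<longleftrightarrow> map reflection_of bs \<in> X) \<and>
    (map reflection_of as \<in> X \<longrightarrow>
      (\<exists>g\<in>carrier B. hurwitz_action W X g (map reflection_of as) = map reflection_of bs))"
proof -
  interpret A: group_action B X "hurwitz_action W X"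
    unfolding B_def X_def by (rule hurwitz_action_Red[OF dual])
  interpret G: group B using A.group_hom by (simp add: group_hom_def)
  have neg: "- a \<in> affine_roots \<Phi>" if "a \<in> affine_roots \<Phi>" for a
    using reflection_affine_roots[OF that that] root_inner_pos[OF fst_affine_roots[OF that]]
      affine_root_level0[OF that]
    by (simp add: affine.reflection_self affine_form_def)
  have closed: "set as \<subseteq> affine_roots \<Phi> \<longleftrightarrow> set bs \<subseteq> affine_roots \<Phi>"
    if "affine.hurwitz_equiv as bs" for as bs :: "('v \<times> real \<times> real) list"
    using that by (rule affine.hurwitz_equiv_closed) (auto intro: neg reflection_affine_roots)
  have self: "\<exists>g\<in>carrier B. hurwitz_action W X g x = x" if "x \<in> X" for x
    using A.id_eq_one that G.one_closed by (metis restrict_apply')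
  show ?thesis using assms(3,4)
  proof (induction rule: affine.hurwitz_equiv.induct)
    case (refl as)
    then show ?case using self by blast
  next
    case (sym as bs)
    then have "set as \<subseteq> affine_roots \<Phi>" using closed by blast
    with sym.IH have IH: "map reflection_of as \<in> X \<longleftrightarrow> map reflection_of bs \<in> X"
      "map reflection_of as \<in> X \<Longrightarrow>
        \<exists>g\<in>carrier B. hurwitz_action W X g (map reflection_of as) = map reflection_of bs" by auto
    have "\<exists>g\<in>carrier B. hurwitz_action W X g (map reflection_of bs) = map reflection_of as"
      if "map reflection_of as \<in> X"
      using IH(2)[OF that] A.orbit_sym_aux[OF _ that] G.inv_closed by metis
    with IH(1) show ?case by blast
  next
    case (trans as bs cs)
    then have "set bs \<subseteq> affine_roots \<Phi>" using closed by blast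
    with trans.IH trans.prems show ?case
      using A.composition_rule G.m_closed by metis
  next
    case (move xs a b ys)
    let ?x = "map reflection_of xs" and ?y = "map reflection_of ys"
    let ?a = "reflection_of a" and ?b = "reflection_of b"
    have ab: "a \<in> affine_roots \<Phi>" "b \<in> affine_roots \<Phi>" using move by auto
    have T: "?a \<in> T" "?b \<in> T" using reflection_of[OF ab(1)] reflection_of[OF ab(2)] by auto
    have r: "reflection_of (affine.reflection a b) = ?a \<otimes> ?b \<otimes> ?a"
      by (rule reflection_of_reflection[OF ab(2,1)])
    have "\<exists>g\<in>carrier B. hurwitz_action W X g (?x @ ?a # ?b # ?y) = ?x @ (?a \<otimes> ?b \<otimes> ?a) # ?a # ?y"
      if x: "?x @ ?a # ?b # ?y \<in> X"
    proof -
      have "length xs + 1 < reflection_length W T w" using x by (auto simp: X_def Red_def)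
      with hurwitz_action_generator[of "length xs + 1" w, OF _ _ x[unfolded X_def]]
      show ?thesis using hurwitz_move_split[of ?x "length xs + 1" W ?a ?b ?y]
        unfolding B_def X_def by simp
    qed
    then show ?case using Red_move(1)[OF T, of ?x ?y w] by (simp add: r X_def)
  next
    case (neg xs a ys)
    have "reflection_of (- a) = reflection_of a"
      by (simp add: reflection_of_def point_reflection_uminus)
    then show ?case using self by simp
  qed
qed

end

theorem theorem1p1:
  fixes W :: "('g, 'm) monoid_scheme" and T :: "'g set" and w :: 'g and n :: nat
    and \<Phi> :: "'v::euclidean_space set"
  assumes "dual_coxeter_system n W T"
    and "crystallographic_root_system \<Phi>" and "affine_of_type \<Phi> W T"
    and "w \<in> carrier W"
    and "parabolic_quasi_coxeter n W T w"
  shows "transitive_action (braid_group (reflection_length W T w)) (Red W T w)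
    (hurwitz_action W (Red W T w))"
proof -
  let ?B = "braid_group (reflection_length W T w)" and ?X = "Red W T w"
  obtain \<eta> where \<eta>: "\<eta> \<in> iso W (affine_coxeter_group \<Phi>)" "\<eta> ` T = affine_reflections \<Phi>"
    using assms(3) by (auto simp: affine_of_type_def)
  interpret group W using dual_coxeter_system_reflections(1)[OF assms(1)] .
  interpret affine_dual_system \<Phi> W T \<eta> n
    by unfold_locales (use assms \<eta> dual_coxeter_system_reflections(2)[OF assms(1)] in auto)
  interpret A: group_action ?B ?X "hurwitz_action W ?X" by (rule hurwitz_action_Red[OF assms(1)])
  obtain ss ts where ss: "distinct ss" "length ss = n" "coxeter_system W (set ss)" "set ss \<subseteq> T"
    and ts: "ts \<in> ?X" "length ts \<le> n" "generate W (set ts) = generate W (set (take (length ts) ss))"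
    using assms(5) by (auto simp: parabolic_quasi_coxeter_def simple_system_def)
  have T: "set us \<subseteq> T" "map reflection_of (map root_of us) = us" if "us \<in> ?X" for us
    using that by (auto simp: Red_def reflection_of_root_of intro!: map_idI)
  have "affine.hurwitz_equiv (map root_of ts) (map root_of us)" if "us \<in> ?X" for us
    using ts that ss T(1)
    by (intro hurwitz_equiv_quasi_coxeter[OF ss(3,4,1)]) (auto simp: Red_def)
  then have "affine.hurwitz_equiv (map root_of us) (map root_of vs)" if "us \<in> ?X" "vs \<in> ?X" for us vs
    using that by (meson affine.hurwitz_equiv.sym affine.hurwitz_equiv.trans)
  then have "\<exists>g\<in>carrier ?B. hurwitz_action W ?X g us = vs" if "us \<in> ?X" "vs \<in> ?X" for us vs
    using hurwitz_equiv_orbit[of "map root_of us" "map root_of vs" w] that T set_root_of by simp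
  then show ?thesis by unfold_locales
qed

end
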